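(* Let $n$ and $x$ be non-negative integers, and let $A_1,\dots,A_6,B_1,\dots,B_6\subseteq[n]=\{1,\dots,n\}$ satisfy $1\notin A_i\cap B_i$ for $i=1,\dots,6$. Let $H_{n,x}(\mathbf A,\mathbf B)$ and $\overline{H}_{n,x}(\mathbf A,\mathbf B)$ be the snowflake region and the flipped snowflake region described in the context. Then: (a) If $H_{n,x}(\mathbf A,\mathbf B)$ has a lozenge tiling, then $$\frac{M(\overline{H}_{n,x}(\mathbf A,\mathbf B))}{M(H_{n,x}(\mathbf A,\mathbf B))}=\frac{\prod_{a\in A_o}(a)_x\ \prod_{b\in B_o}(b)_x}{\prod_{a\in A_e}(a)_x\ \prod_{b\in B_e}(b)_x}.$$ (b) If $H_{n,x}(\mathbf A,\mathbf B)$ is cyclically symmetric (i.e. invariant under rotation by $120^\circ$ about the center of its bounding hexagon; equivalently $A_1=A_3=A_5$, $A_2=A_4=A_6$, $B_1=B_3=B_5$, $B_2=B_4=B_6$) and has a cyclically symmetric lozenge tiling, then $$\frac{M_r(\overline{H}_{n,x}(\mathbf A,\mathbf B))}{M_r(H_{n,x}(\mathbf A,\mathbf B))}=\frac{\prod_{a\in A_1}(a)_x\ \prod_{b\in B_1}(b)_x}{\prod_{a\in A_2}(a)_x\ \prod_{b\in B_2}(b)_x}=\sqrt[3]{\frac{M(\overline{H}_{n,x}(\mathbf A,\mathbf B))}{M(H_{n,x}(\mathbf A,\mathbf B))}}.$$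
   Context: We work on the triangular lattice drawn so that one family of lattice lines is horizontal; unit triangles are up- or down-pointing. A lozenge is the union of two unit triangles sharing an edge; a lozenge tiling of a region (a union of unit triangles) is a covering by lozenges without gaps or overlaps. $M(R)$ denotes the number of lozenge tilings of a region $R$. For a region invariant under rotation by $120^\circ$ about a point (its center), $M_r(R)$ denotes the number of lozenge tilings of $R$ invariant under that rotation. Pochhammer symbol: $(a)_0=1$ and $(a)_k=a(a+1)\cdots(a+k-1)$ for $k\ge1$. Construction of $H_{n,x}(\mathbf A,\mathbf B)$, where $\mathbf A=(A_1,\dots,A_6)$, $\mathbf B=(B_1,\dots,B_6)$. Let $\mathcal H$ be the lattice hexagon with side lengths $n,n+x,n,n+x,n,n+x$ going clockwise starting from its top (horizontal) side; name its vertices $V_1$ (top-left), $V_2$ (top-right), $V_3$ (right), $V_4$ (bottom-right), $V_5$ (bottom-left), $V_6$ (left). The three long diagonals $V_1V_4$ (negative slope), $V_2V_5$ (positive slope), $V_3V_6$ (horizontal) bound an up-pointing lattice triangle of side $x$ with top vertex $U=V_1V_4\cap V_2V_5$, bottom-left vertex $L=V_2V_5\cap V_3V_6$ and bottom-right vertex $R=V_1V_4\cap V_3V_6$. Consider the six segments, each of length $n$: $\sigma_1=UV_1$, $\sigma_2=UV_2$, $\sigma_3=RV_3$, $\sigma_4=RV_4$, $\sigma_5=LV_5$, $\sigma_6=LV_6$; on each, label the unit segments $1,2,\dots,n$ starting from the endpoint on the central triangle. Put $\sigma_7=\sigma_1$. These segments cut $\mathcal H$ minus the central triangle into six subregions: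 $S_1=$ triangle $UV_1V_2$, $S_2=$ trapezoid $UV_2V_3R$, $S_3=$ triangle $RV_3V_4$, $S_4=$ trapezoid $RV_4V_5L$, $S_5=$ triangle $LV_5V_6$, $S_6=$ trapezoid $LV_6V_1U$; subregion $S_i$ lies between $\sigma_i$ and $\sigma_{i+1}$. The region $H_{n,x}(\mathbf A,\mathbf B)$ is obtained from $\mathcal H$ by removing the central triangle $ULR$ and, for each $i=1,\dots,6$: for each $a\in A_i$, the unit triangle contained in $S_i$ having as a side the unit segment of $\sigma_i$ labelled $a$; and for each $b\in B_i$, the unit triangle contained in $S_i$ having as a side the unit segment of $\sigma_{i+1}$ labelled $b$ (these removed unit triangles are called unit holes). Construction of $\overline H_{n,x}(\mathbf A,\mathbf B)$. Define three "dendrites", each a long diagonal together with the unit holes attached to it: the horizontal dendrite is $V_3V_6$ with the unit holes indexed by $A_3,B_2,A_6,B_5$ (those along $\sigma_3,\sigma_6$); the positive dendrite is $V_2V_5$ with the unit holes indexed by $B_1,A_2,B_4,A_5$ (along $\sigma_2,\sigma_5$); the negative dendrite is $V_1V_4$ with the unit holes indexed by $A_1,B_6,A_4,B_3$ (along $\sigma_1,\sigma_4$). Keep the horizontal dendrite fixed, translate the positive dendrite (segment and its attached holes rigidly) by $x$ lattice units in the direction of the vector $\overrightarrow{V_2V_3}$ (southeast), and translate the negative dendrite by $x$ lattice units in the direction of $\overrightarrow{V_3V_4}$ (southwest). The three translated long diagonals now bound a down-pointing triangle of side $x$, and the convex hull of the three translated segments is a lattice hexagon with side lengths $n+x,n,n+x,n,n+x,n$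 clockwise from the top. $\overline H_{n,x}(\mathbf A,\mathbf B)$ is this hexagon with the down-pointing central triangle of side $x$ removed and with all the (translated) unit holes of the three dendrites removed. $A_o$ (resp. $A_e$) is the multiset union of $A_1,A_3,A_5$ (resp. $A_2,A_4,A_6$); $B_o$ (resp. $B_e$) is the multiset union of $B_1,B_3,B_5$ (resp. $B_2,B_4,B_6$); products over multisets count multiplicity.
   Formalization: In (b), cyclic symmetry is taken to include A_1=A_3=A_5, A_2=A_4=A_6, B_1=B_3=B_5, B_2=B_4=B_6; rotation invariance of H alone is not equivalent, since label-1 holes of A_i and B_i coincide in S_1, S_3, S_5, and the flipped region may then fail to be invariant. *)

theory Defs
  imports "HOL-Analysis.Analysis" "HOL-Library.Multiset" "HOL-Library.Disjoint_Sets"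
begin

section \<open>Regions of the triangular lattice and their lozenge tilings\<close>

text \<open>
  The lattice lives in the complex plane. A unit triangle is represented by the set of its
  three vertices, a region by the set of unit triangles it consists of, and a lozenge by the
  set of its two unit triangles, so that a tiling is a partition of the region into lozenges.
\<close>

definition tri_lattice :: "complex set" where
  "tri_lattice = {of_int a + of_int b * cis (pi / 3) | a b. True}"

definition up_triangle :: "complex \<Rightarrow> complex set" where
  "up_triangle p = {p, p + 1, p + cis (pi / 3)}"

definition down_triangle :: "complex \<Rightarrow> complex set" where
  "down_triangle p = {p, p + 1, p + cis (- pi / 3)}"

definition unit_triangles :: "complex set set" where
  "unit_triangles = up_triangle ` tri_lattice \<union> down_triangle ` tri_lattice"

text \<open>The unit triangles contained in the convex polygon with the given vertices.\<close>

definition lattice_polygon :: "complex set \<Rightarrow> complex set set" where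
  "lattice_polygon P = {t \<in> unit_triangles. t \<subseteq> convex hull P}"

text \<open>Sharing an edge means having exactly two common vertices.\<close>

definition lozenges :: "complex set set set" where
  "lozenges = {{s, t} | s t. s \<in> unit_triangles \<and> t \<in> unit_triangles \<and> card (s \<inter> t) = 2}"

definition tilings :: "complex set set \<Rightarrow> complex set set set set" where
  "tilings R = {T. T \<subseteq> lozenges \<and> partition_on R T}"

definition num_tilings :: "complex set set \<Rightarrow> nat" where
  "num_tilings R = card (tilings R)"

definition rotation :: "complex \<Rightarrow> complex \<Rightarrow> complex" where
  "rotation c z = c + cis (2 * pi / 3) * (z - c)"

definition rotate_region :: "complex \<Rightarrow> complex set set \<Rightarrow> complex set set" where
  "rotate_region c R = (\<lambda>t. rotation c ` t) ` R"

definition sym_tilings :: "complex \<Rightarrow> complex set set \<Rightarrow> complex set set set set" where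
  "sym_tilings c R = {T \<in> tilings R. rotate_region c ` T = T}"

definition num_sym_tilings :: "complex \<Rightarrow> complex set set \<Rightarrow> nat" where
  "num_sym_tilings c R = card (sym_tilings c R)"


section \<open>The snowflake region\<close>

text \<open>
  The central triangle has bottom-left vertex 0. The following functions are used for the
  indices 1, ..., 7; the index 7 gives the same value as the index 1.
\<close>

definition top_corner :: "nat \<Rightarrow> complex" where
  "top_corner x = of_nat x * cis (pi / 3)"

definition left_corner :: "nat \<Rightarrow> complex" where
  "left_corner x = 0"

definition right_corner :: "nat \<Rightarrow> complex" where
  "right_corner x = of_nat x"

text \<open>The endpoint of the \<open>i\<close>-th segment on the central triangle.\<close>

definition corner :: "nat \<Rightarrow> nat \<Rightarrow> complex" where
  "corner x i =
     (if i mod 6 \<in> {1, 2} then top_corner x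
      else if i mod 6 \<in> {3, 4} then right_corner x
      else left_corner x)"

text \<open>
  The direction of the \<open>i\<close>-th segment, away from the central triangle: northwest,
  northeast, east, southeast, southwest, west for \<open>i = 1, ..., 6\<close>.
\<close>

definition seg_dir :: "nat \<Rightarrow> complex" where
  "seg_dir i = cis ((3 - real i) * pi / 3)"

definition hex_vertex :: "nat \<Rightarrow> nat \<Rightarrow> nat \<Rightarrow> complex" where
  "hex_vertex n x i = corner x i + of_nat n * seg_dir i"

lemma hex_vertex_7: "hex_vertex n x 7 = hex_vertex n x 1"
proof -
  have "cis (- (4 * pi / 3)) = cis (2 * pi / 3)"
    using cis_mult[of "- (4 * pi / 3)" "2 * pi"] by simp
  then show ?thesis
    by (simp add: hex_vertex_def corner_def seg_dir_def field_simps)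
qed

lemma hex_sides:
  "hex_vertex n x 2 - hex_vertex n x 1 = of_nat n"
  "hex_vertex n x 3 - hex_vertex n x 2 = of_nat (n + x) * cis (- pi / 3)"
  "hex_vertex n x 4 - hex_vertex n x 3 = of_nat n * cis (- 2 * pi / 3)"
  "hex_vertex n x 5 - hex_vertex n x 4 = - of_nat (n + x)"
  "hex_vertex n x 6 - hex_vertex n x 5 = of_nat n * cis (2 * pi / 3)"
  "hex_vertex n x 1 - hex_vertex n x 6 = of_nat (n + x) * cis (pi / 3)"
  by (simp_all add: hex_vertex_def corner_def seg_dir_def top_corner_def right_corner_def
      left_corner_def complex_eq_iff cos_60 sin_60 cos_120 sin_120
      cos_120[unfolded mult.commute[of 2]] sin_120[unfolded mult.commute[of 2]] algebra_simps)

definition seg_unit :: "nat \<Rightarrow> nat \<Rightarrow> nat \<Rightarrow> complex set" where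
  "seg_unit x i k =
     {corner x i + (of_nat k - 1) * seg_dir i, corner x i + of_nat k * seg_dir i}"

definition subregion :: "nat \<Rightarrow> nat \<Rightarrow> nat \<Rightarrow> complex set set" where
  "subregion n x i =
     lattice_polygon {corner x i, hex_vertex n x i, hex_vertex n x (i + 1), corner x (i + 1)}"

text \<open>The unit holes in the \<open>i\<close>-th subregion along the \<open>j\<close>-th segment with labels in \<open>K\<close>.\<close>

definition unit_holes :: "nat \<Rightarrow> nat \<Rightarrow> nat \<Rightarrow> nat \<Rightarrow> nat set \<Rightarrow> complex set set" where
  "unit_holes n x i j K = {t \<in> subregion n x i. \<exists>k\<in>K. seg_unit x j k \<subseteq> t}"

definition snowflake :: "nat \<Rightarrow> nat \<Rightarrow> (nat \<Rightarrow> nat set) \<Rightarrow> (nat \<Rightarrow> nat set) \<Rightarrow> complex set set" where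
  "snowflake n x A B =
     lattice_polygon (hex_vertex n x ` {1..6})
     - lattice_polygon {top_corner x, left_corner x, right_corner x}
     - (\<Union>i\<in>{1..6}. unit_holes n x i i (A i) \<union> unit_holes n x i (i + 1) (B i))"

definition snowflake_center :: "nat \<Rightarrow> nat \<Rightarrow> complex" where
  "snowflake_center n x = (\<Sum>i=1..6. hex_vertex n x i) / 6"


section \<open>The flipped snowflake region\<close>

text \<open>
  The translation of the dendrite that contains the \<open>i\<close>-th segment: segments 3 and 6
  (horizontal dendrite) stay, segments 2 and 5 (positive dendrite) move southeast, segments
  1 and 4 (negative dendrite) move southwest.
\<close>

definition dendrite_shift :: "nat \<Rightarrow> nat \<Rightarrow> complex" where
  "dendrite_shift x i =
     (if i mod 3 = 0 then 0
      else if i mod 3 = 2 then of_nat x * cis (- pi / 3)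
      else of_nat x * cis (- 2 * pi / 3))"

definition translate_region :: "complex \<Rightarrow> complex set set \<Rightarrow> complex set set" where
  "translate_region v R = (\<lambda>t. (+) v ` t) ` R"

definition flipped_vertex :: "nat \<Rightarrow> nat \<Rightarrow> nat \<Rightarrow> complex" where
  "flipped_vertex n x i = hex_vertex n x i + dendrite_shift x i"

lemma flipped_sides:
  "flipped_vertex n x 2 - flipped_vertex n x 1 = of_nat (n + x)"
  "flipped_vertex n x 3 - flipped_vertex n x 2 = of_nat n * cis (- pi / 3)"
  "flipped_vertex n x 4 - flipped_vertex n x 3 = of_nat (n + x) * cis (- 2 * pi / 3)"
  "flipped_vertex n x 5 - flipped_vertex n x 4 = - of_nat n"
  "flipped_vertex n x 6 - flipped_vertex n x 5 = of_nat (n + x) * cis (2 * pi / 3)"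
  "flipped_vertex n x 1 - flipped_vertex n x 6 = of_nat n * cis (pi / 3)"
  by (simp_all add: flipped_vertex_def dendrite_shift_def hex_vertex_def corner_def seg_dir_def
      top_corner_def right_corner_def left_corner_def complex_eq_iff cos_60 sin_60 cos_120 sin_120
      cos_120[unfolded mult.commute[of 2]] sin_120[unfolded mult.commute[of 2]] algebra_simps)

text \<open>
  The translated diagonals bound the down-pointing triangle whose top side is the bottom side
  of the original central triangle.
\<close>

definition flipped_snowflake :: "nat \<Rightarrow> nat \<Rightarrow> (nat \<Rightarrow> nat set) \<Rightarrow> (nat \<Rightarrow> nat set) \<Rightarrow> complex set set" where
  "flipped_snowflake n x A B =
     lattice_polygon (flipped_vertex n x ` {1..6})
     - lattice_polygon {left_corner x, right_corner x, of_nat x * cis (- pi / 3)}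
     - (\<Union>i\<in>{1..6}. translate_region (dendrite_shift x i) (unit_holes n x i i (A i))
          \<union> translate_region (dendrite_shift x (i + 1)) (unit_holes n x i (i + 1) (B i)))"

definition flipped_center :: "nat \<Rightarrow> nat \<Rightarrow> complex" where
  "flipped_center n x = (\<Sum>i=1..6. flipped_vertex n x i) / 6"


definition odd_union :: "(nat \<Rightarrow> nat set) \<Rightarrow> nat multiset" where
  "odd_union A = mset_set (A 1) + mset_set (A 3) + mset_set (A 5)"

definition even_union :: "(nat \<Rightarrow> nat set) \<Rightarrow> nat multiset" where
  "even_union A = mset_set (A 2) + mset_set (A 4) + mset_set (A 6)"

end

theory Submission
  imports Defs
begin

text \<open>
  Cut the hexagon along the six segments. Once the set \<open>C\<^sub>i\<close> of labels at which lozenges cross the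
  \<open>i\<close>-th segment is fixed, a tiling splits into independent tilings of six dented triangles and
  trapezoids. A triangle of side \<open>n\<close>, or the trapezoid obtained from a triangle of side \<open>n + x\<close> by
  cutting off a corner of side \<open>x\<close>, with dents \<open>P\<close> and \<open>Q\<close> along the two cut sides, is tiled by
  families of nonintersecting lattice paths, which are counted by the determinant of
  \<open>(p + x - 1) choose (i + x - 1)\<close> with \<open>p \<in> P\<close> and \<open>i \<in> {1..n} - Q\<close> (and \<open>x = 0\<close> for the
  triangle). This binomial coefficient is \<open>(p - 1) choose (i - 1)\<close> times \<open>(p)\<^sub>x / (i)\<^sub>x\<close>, so that
  passing from the triangle to the trapezoid multiplies the count by \<open>(a)\<^sub>x\<close> for every dent \<open>a\<close>, up
  to a constant. Flipping the snowflake exchanges triangles and trapezoids, and every \<open>C\<^sub>i\<close> bounds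
  one of each kind; hence the factors of the \<open>C\<^sub>i\<close> cancel and the ratio is the same for every
  choice of the \<open>C\<^sub>i\<close>. Cyclically symmetric tilings are determined by two adjacent sectors, and the
  same comparison applies.
\<close>

subsection \<open>Determinants by column expansion\<close>

text \<open>The delicate spot is the corner of a triangular sector at the central triangle: the
  labels 1 on its two sides name the same cell. A family of crossing labels that takes this cell
  twice comes from no tiling, and for \<open>x > 0\<close> only the triangles have such a corner, so
  the two regions would have to be summed over different families. But the determinant with label 1
  on both sides is 0, so both sums may run over all subsets of the free labels and be compared term
  by term. Assuming that 1 is not in both \<open>A i\<close> and \<open>B i\<close> excludes the
  case in which the holes alone take the corner twice, where the determinant is 0 whatever the
  region is.

  No signs enter the path count: matching the triangles of one row from left to right mirrors the
  expansion of the determinant by Pascal's rule and linearity in its rows, and the paths stay in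
  order throughout.

  The flipped region needs no count of its own. It is an ordinary snowflake whose hole sets are
  shifted by one index, rotated by 60 degrees.\<close>

definition remove_nth :: "nat \<Rightarrow> 'a list \<Rightarrow> 'a list" where
  "remove_nth i xs = take i xs @ drop (Suc i) xs"

text \<open>Rows are functions of a column label, so that the dents themselves can index the
  columns. An array that is not square gets the value 0, just as a region with unequal numbers of
  the two kinds of unit triangle has no tiling.\<close>

fun ldet :: "'c list \<Rightarrow> ('c \<Rightarrow> 'a::comm_ring_1) list \<Rightarrow> 'a" where
  "ldet [] rs = (if rs = [] then 1 else 0)"
| "ldet (c # cs) rs = (\<Sum>i<length rs. (- 1) ^ i * (rs ! i) c * ldet cs (remove_nth i rs))"

lemma remove_nth_map: "remove_nth i (map f xs) = map f (remove_nth i xs)"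
  by (simp add: remove_nth_def take_map drop_map)

lemma remove_nth_append_left:
  "i < length us \<Longrightarrow> remove_nth i (us @ vs) = remove_nth i us @ vs"
  by (simp add: remove_nth_def)

lemma remove_nth_append_length [simp]: "remove_nth (length us) (us @ r # vs) = us @ vs"
  by (simp add: remove_nth_def)

lemma remove_nth_append_right:
  "remove_nth (Suc (length us + j)) (us @ r # vs) = us @ r # remove_nth j vs"
  by (simp add: remove_nth_def)

lemma set_remove_nth: "set (remove_nth i xs) \<subseteq> set xs"
  unfolding remove_nth_def by (metis Un_least set_append set_drop_subset set_take_subset)

text \<open>The expansion along the first column with one row singled out. In both sums the row
  \<open>r\<close> survives at a known place, which lets the properties of rows be proved by
  induction on the columns.\<close>

lemma ldet_expand_at:
  "ldet (c # cs) (us @ r # vs) =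
    (\<Sum>i<length us. (- 1) ^ i * (us ! i) c * ldet cs (remove_nth i us @ r # vs))
    + (- 1) ^ length us * r c * ldet cs (us @ vs)
    + (\<Sum>j<length vs. (- 1) ^ Suc (length us + j) * (vs ! j) c * ldet cs (us @ r # remove_nth j vs))"
proof -
  have len: "length (us @ r # vs) = Suc (length us) + length vs" by simp
  have split: "(\<Sum>i<m + k. f i) = (\<Sum>i<m. f i) + (\<Sum>j<k. f (m + j))" for f :: "nat \<Rightarrow> 'a" and m k
    by (induction k) (simp_all add: add.assoc)
  have "ldet (c # cs) (us @ r # vs) =
     (\<Sum>i<length us. (- 1) ^ i * ((us @ r # vs) ! i) c * ldet cs (remove_nth i (us @ r # vs)))
     + (- 1) ^ length us * ((us @ r # vs) ! length us) c * ldet cs (remove_nth (length us) (us @ r # vs))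
     + (\<Sum>j<length vs. (- 1) ^ (Suc (length us) + j) * ((us @ r # vs) ! (Suc (length us) + j)) c
          * ldet cs (remove_nth (Suc (length us) + j) (us @ r # vs)))"
    unfolding ldet.simps len split by simp
  also have "\<dots> = (\<Sum>i<length us. (- 1) ^ i * (us ! i) c * ldet cs (remove_nth i us @ r # vs))
    + (- 1) ^ length us * r c * ldet cs (us @ vs)
    + (\<Sum>j<length vs. (- 1) ^ Suc (length us + j) * (vs ! j) c * ldet cs (us @ r # remove_nth j vs))"
    by (intro arg_cong2[where f = "(+)"] sum.cong)
       (simp_all add: nth_append remove_nth_append_left remove_nth_append_right)
  finally show ?thesis .
qed

lemma ldet_row_add:
  "ldet cs (us @ (\<lambda>c. f c + g c) # vs) = ldet cs (us @ f # vs) + ldet cs (us @ g # vs)"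
proof (induction cs arbitrary: us vs)
  case Nil
  then show ?case by simp
next
  case (Cons c cs)
  show ?case
    unfolding ldet_expand_at Cons by (simp add: algebra_simps sum.distrib sum_subtractf sum_negf)
qed

lemma ldet_row_zero:
  assumes "\<And>c. c \<in> set cs \<Longrightarrow> r c = 0"
  shows "ldet cs (us @ r # vs) = 0"
  using assms
proof (induction cs arbitrary: us vs)
  case Nil
  then show ?case by simp
next
  case (Cons c cs)
  then show ?case unfolding ldet_expand_at by simp
qed

text \<open>By additivity: the difference of the two rows vanishes on every listed column.\<close>

lemma ldet_row_cong:
  assumes "\<And>c. c \<in> set cs \<Longrightarrow> r c = r' c"
  shows "ldet cs (us @ r # vs) = ldet cs (us @ r' # vs)"
proof -
  have "ldet cs (us @ (\<lambda>c. r' c + (r c - r' c)) # vs) = ldet cs (us @ r' # vs)"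
    unfolding ldet_row_add using assms by (simp add: ldet_row_zero)
  then show ?thesis by simp
qed

lemma ldet_adjacent_rows_equal: "ldet cs (us @ r # r # vs) = 0"
proof (induction cs arbitrary: us vs)
  case Nil
  then show ?case by simp
next
  case (Cons c cs)
  \<comment> \<open>Index 0 removes the second copy of \<open>r\<close>; this term has the opposite
    sign to the one removing the first copy and cancels it. Any later index leaves both copies
    adjacent, so that the induction hypothesis applies.\<close>
  have "ldet cs (us @ r # remove_nth j (r # vs)) = (if j = 0 then ldet cs (us @ r # vs) else 0)"
    if "j < length (r # vs)" for j
    using that Cons[of us "remove_nth (j - 1) vs"]
    by (cases j) (auto simp: remove_nth_def)
  then have "(\<Sum>j<length (r # vs). (- 1) ^ Suc (length us + j) * ((r # vs) ! j) c
        * ldet cs (us @ r # remove_nth j (r # vs)))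
      = (\<Sum>j<length (r # vs). if j = 0 then (- 1) ^ Suc (length us) * r c * ldet cs (us @ r # vs) else 0)"
    by (intro sum.cong) auto
  then show ?case
    unfolding ldet_expand_at Cons by simp
qed

lemma ldet_column_zero:
  assumes "c \<in> set cs" and "\<And>r. r \<in> set rs \<Longrightarrow> r c = 0"
  shows "ldet cs rs = 0"
  using assms
proof (induction cs arbitrary: rs)
  case Nil
  then show ?case by simp
next
  case (Cons d cs)
  show ?case
  proof (cases "c = d")
    case True
    then have "(rs ! i) d = 0" if "i < length rs" for i
      using Cons.prems(2) that by simp
    then show ?thesis by simp
  next
    case False
    have "ldet cs (remove_nth i rs) = 0" for i
      using False Cons.prems set_remove_nth[of i rs] by (intro Cons.IH) auto
    then show ?thesis by simp
  qed
qed

lemma ldet_unit_column: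
  assumes "r c = 1" and "\<And>r'. r' \<in> set rs \<Longrightarrow> r' c = 0"
  shows "ldet (c # cs) (r # rs) = ldet cs rs"
proof -
  have "(rs ! j) c = 0" if "j < length rs" for j using assms(2) that by simp
  then have "(\<Sum>j<length rs. (- 1) ^ Suc (length [] + j) * (rs ! j) c * ldet cs ([] @ r # remove_nth j rs)) = 0"
    by (intro sum.neutral) auto
  then show ?thesis
    using assms(1) ldet_expand_at[of c cs "[]" r rs] by (simp del: ldet.simps)
qed

lemma ldet_cong:
  assumes "\<And>c a. c \<in> set cs \<Longrightarrow> a \<in> set xs \<Longrightarrow> f a c = g a c"
  shows "ldet cs (map f xs) = ldet cs (map g xs)"
  using assms
proof (induction cs arbitrary: xs)
  case Nil
  then show ?case by simp
next
  case (Cons c cs)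
  have "ldet cs (map f (remove_nth i xs)) = ldet cs (map g (remove_nth i xs))" for i
    using Cons.prems set_remove_nth[of i xs] by (intro Cons.IH) auto
  then show ?case using Cons.prems by (simp add: remove_nth_map)
qed

lemma prod_list_remove_nth:
  "i < length xs \<Longrightarrow> (xs ! i) * prod_list (remove_nth i xs) = prod_list (xs :: 'a::comm_monoid_mult list)"
  by (metis id_take_nth_drop mult.left_commute prod_list.Cons prod_list.append remove_nth_def)

lemma ldet_scale:
  "ldet cs (map (\<lambda>a c. u a * v c * f a c) xs)
    = prod_list (map u xs) * prod_list (map v cs) * ldet cs (map f xs)"
proof (induction cs arbitrary: xs)
  case Nil
  then show ?case by simp
next
  case (Cons c cs)
  have "(- 1) ^ i * (u (xs ! i) * v c * f (xs ! i) c)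
      * (prod_list (map u (remove_nth i xs)) * prod_list (map v cs) * ldet cs (map f (remove_nth i xs)))
    = prod_list (map u xs) * prod_list (map v (c # cs))
      * ((- 1) ^ i * f (xs ! i) c * ldet cs (map f (remove_nth i xs)))" if "i < length xs" for i
  proof -
    have "prod_list (map u xs) = u (xs ! i) * prod_list (map u (remove_nth i xs))"
      using prod_list_remove_nth[of i "map u xs"] that by (simp add: remove_nth_map)
    then show ?thesis by (simp add: algebra_simps)
  qed
  then show ?case
    by (simp add: remove_nth_map Cons sum_distrib_left)
qed


subsection \<open>The determinants counting tilings of dented triangles and trapezoids\<close>

text \<open>A minor of the Pascal matrix, shifted by \<open>x\<close>. The columns are the ends of
  the paths, the dents \<open>P\<close> on one side; the rows are their starts, the undented places
  on the other side.\<close>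

definition binom_minor :: "nat \<Rightarrow> nat \<Rightarrow> nat set \<Rightarrow> nat set \<Rightarrow> real" where
  "binom_minor n x P Q = ldet (sorted_list_of_set P)
     (map (\<lambda>i p. real ((x + p - 1) choose (x + i - 1))) (sorted_list_of_set ({1..n} - Q)))"

lemma prod_list_sorted_list_of_set:
  "finite S \<Longrightarrow> prod_list (map f (sorted_list_of_set S)) = (\<Prod>i\<in>S. f i)"
  for f :: "'a::linorder \<Rightarrow> 'b::comm_monoid_mult"
  by (metis distinct_sorted_list_of_set prod.distinct_set_conv_list set_sorted_list_of_set)

text \<open>Absorption identity: raising both arguments of the binomial coefficient by one
  multiplies it by \<open>(x + p) / (x + i)\<close>, the quotient of the new last factors of the two
  Pochhammer symbols.\<close>

lemma choose_shift_pochhammer: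
  assumes "1 \<le> i" and "1 \<le> p"
  shows "real ((x + p - 1) choose (x + i - 1)) * pochhammer (real i) x
    = real ((p - 1) choose (i - 1)) * pochhammer (real p) x"
proof (induction x)
  case 0
  then show ?case by simp
next
  case (Suc x)
  have "Suc x + p - 1 = Suc (x + p - 1)" "Suc x + i - 1 = Suc (x + i - 1)"
    "Suc (x + i - 1) = x + i" "Suc (x + p - 1) = x + p" using assms by auto
  then have "(x + i) * ((Suc x + p - 1) choose (Suc x + i - 1)) = (x + p) * ((x + p - 1) choose (x + i - 1))"
    by (metis Suc_times_binomial_eq mult.commute)
  then have "real (x + i) * real ((Suc x + p - 1) choose (Suc x + i - 1))
      = real (x + p) * real ((x + p - 1) choose (x + i - 1))"
    by (metis of_nat_mult)
  moreover have "real ((Suc x + p - 1) choose (Suc x + i - 1)) * pochhammer (real i) (Suc x)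
      = real (x + i) * real ((Suc x + p - 1) choose (Suc x + i - 1)) * pochhammer (real i) x"
    by (simp add: pochhammer_rec' algebra_simps)
  ultimately have "real ((Suc x + p - 1) choose (Suc x + i - 1)) * pochhammer (real i) (Suc x)
      = real (x + p) * (real ((x + p - 1) choose (x + i - 1)) * pochhammer (real i) x)"
    by (simp only: mult.assoc)
  then show ?case unfolding Suc by (simp add: pochhammer_rec' algebra_simps)
qed

text \<open>Row \<open>i\<close> yields the factor \<open>1 / (i)_x\<close> and column
  \<open>p\<close> the factor \<open>(p)_x\<close>. The row factors run over the complement of
  \<open>Q\<close>; multiplying by the product over \<open>{1..n}\<close> leaves the factors of
  \<open>Q\<close> in the numerator, so both kinds of dent enter alike.\<close>

lemma binom_minor_scale:
  assumes "P \<subseteq> {1..n}" and "Q \<subseteq> {1..n}"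
  shows "binom_minor n x P Q * (\<Prod>i=1..n. pochhammer (real i) x)
    = binom_minor n 0 P Q * (\<Prod>p\<in>P. pochhammer (real p) x) * (\<Prod>q\<in>Q. pochhammer (real q) x)"
proof -
  let ?w = "\<lambda>i. pochhammer (real i) x"
  let ?cs = "sorted_list_of_set P" and ?xs = "sorted_list_of_set ({1..n} - Q)"
  have fin: "finite P" "finite Q" using assms finite_subset by blast+
  have pos: "?w i > 0" if "i \<in> {1..n}" for i using that by (intro pochhammer_pos) auto
  have "binom_minor n x P Q
      = ldet ?cs (map (\<lambda>i p. inverse (?w i) * ?w p * real ((0 + p - 1) choose (0 + i - 1))) ?xs)"
    unfolding binom_minor_def
  proof (rule ldet_cong)
    fix p i assume "p \<in> set ?cs" "i \<in> set ?xs"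
    then have "1 \<le> p" "1 \<le> i" "?w i \<noteq> 0" using assms fin pos[of i] by auto
    then show "real ((x + p - 1) choose (x + i - 1))
        = inverse (?w i) * ?w p * real ((0 + p - 1) choose (0 + i - 1))"
      using choose_shift_pochhammer[of i p x] by (simp add: field_simps)
  qed
  also have "\<dots> = (\<Prod>i\<in>{1..n} - Q. inverse (?w i)) * (\<Prod>p\<in>P. ?w p) * binom_minor n 0 P Q"
    unfolding ldet_scale binom_minor_def
    by (subst (1 2) prod_list_sorted_list_of_set) (use fin in auto)
  finally have eq: "binom_minor n x P Q
    = (\<Prod>i\<in>{1..n} - Q. inverse (?w i)) * (\<Prod>p\<in>P. ?w p) * binom_minor n 0 P Q" .
  have "(\<Prod>i=1..n. ?w i) = (\<Prod>i\<in>{1..n} - Q. ?w i) * (\<Prod>q\<in>Q. ?w q)"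
    using assms(2) by (simp add: prod.subset_diff)
  moreover have "(\<Prod>i\<in>{1..n} - Q. inverse (?w i)) * (\<Prod>i\<in>{1..n} - Q. ?w i) = 1"
    unfolding prod.distrib[symmetric] by (rule prod.neutral) (use pos in force)
  ultimately show ?thesis unfolding eq
    by (simp add: algebra_simps)
qed

text \<open>In the column of the dent 1 only row 1 has a nonzero entry, and that row is missing
  because 1 is in \<open>Q\<close>. This makes the impossible choices of crossing labels contribute
  nothing.\<close>

lemma binom_minor_eq_0:
  assumes "1 \<in> P" and "finite P" and "1 \<in> Q"
  shows "binom_minor n x P Q = 0"
  unfolding binom_minor_def
proof (rule ldet_column_zero[of 1])
  show "r 1 = 0" if "r \<in> set (map (\<lambda>i p. real ((x + p - 1) choose (x + i - 1)))
    (sorted_list_of_set ({1..n} - Q)))" for r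
  proof -
    from that obtain i where i: "i \<in> {1..n} - Q" "r = (\<lambda>p. real ((x + p - 1) choose (x + i - 1)))"
      by auto
    then have "i \<noteq> 1" "i \<ge> 1" using assms(3) by auto
    then show ?thesis using i by (auto intro: binomial_eq_0)
  qed
qed (use assms in auto)

subsection \<open>Partitions of a set into tiles\<close>

text \<open>The set \<open>L\<close> of tiles is a parameter because the same tilings are studied in
  three coordinate systems: the plane, the cells of the hexagon and the model sector.\<close>

definition tile_partitions :: "'a set set \<Rightarrow> 'a set \<Rightarrow> 'a set set set" where
  "tile_partitions L R = {T. T \<subseteq> L \<and> partition_on R T}"

lemma tilings_eq_tile_partitions: "tilings R = tile_partitions lozenges R"
  by (simp add: tilings_def tile_partitions_def)

lemma finite_tile_partitions: "finite R \<Longrightarrow> finite (tile_partitions L R)"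
  unfolding tile_partitions_def
  by (rule finite_subset[OF _ finitely_many_partition_on]) auto

lemma tile_partitions_empty [simp]: "tile_partitions L {} = {{}}"
  by (auto simp: tile_partitions_def partition_on_empty)

lemma tile_partitionsD:
  assumes "T \<in> tile_partitions L R"
  shows "T \<subseteq> L" "\<Union>T = R" "{} \<notin> T" "\<And>e f. e \<in> T \<Longrightarrow> f \<in> T \<Longrightarrow> e \<noteq> f \<Longrightarrow> e \<inter> f = {}"
  using assms by (auto simp: tile_partitions_def partition_on_def disjoint_def)

lemma tile_partitionsI:
  assumes "T \<subseteq> L" "\<Union>T = R" "{} \<notin> T" "\<And>e f. e \<in> T \<Longrightarrow> f \<in> T \<Longrightarrow> e \<noteq> f \<Longrightarrow> e \<inter> f = {}"
  shows "T \<in> tile_partitions L R"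
  using assms by (auto simp: tile_partitions_def partition_on_def disjoint_def)

lemma tile_partitions_insert:
  assumes "e \<in> L" "e \<subseteq> R" "e \<noteq> {}" "T \<in> tile_partitions L (R - e)"
  shows "insert e T \<in> tile_partitions L R" "e \<notin> T"
proof -
  have T: "T \<subseteq> L" "partition_on (R - e) T" using assms by (auto simp: tile_partitions_def)
  have "disjnt e (\<Union>T)" using partition_onD1[OF T(2)] by (auto simp: disjnt_def)
  then show "insert e T \<in> tile_partitions L R" "e \<notin> T"
    using assms T partition_on_insert[of e T R] by (auto simp: tile_partitions_def disjnt_def)
qed

lemma tile_partitions_remove:
  assumes "T \<in> tile_partitions L R" "e \<in> T"
  shows "T - {e} \<in> tile_partitions L (R - e)"
proof (rule tile_partitionsI)
  note D = tile_partitionsD[OF assms(1)]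
  show "T - {e} \<subseteq> L" "{} \<notin> T - {e}" using D(1,3) by auto
  show "f \<inter> g = {}" if "f \<in> T - {e}" "g \<in> T - {e}" "f \<noteq> g" for f g
    using D(4)[of f g] that by simp
  have "s \<notin> e" if "s \<in> f" "f \<in> T" "f \<noteq> e" for s f
    using D(4)[of f e] that assms(2) by auto
  then show "\<Union>(T - {e}) = R - e" unfolding D(2)[symmetric] by auto
qed

text \<open>Sorts the tilings by the unique tile that covers \<open>s\<close>.\<close>

lemma card_tile_partitions_peel:
  assumes "finite R" and "s \<in> R"
  shows "card (tile_partitions L R) = (\<Sum>e | e \<in> L \<and> s \<in> e \<and> e \<subseteq> R. card (tile_partitions L (R - e)))"
proof -
  let ?E = "{e. e \<in> L \<and> s \<in> e \<and> e \<subseteq> R}"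
  have fE: "finite ?E" using assms(1) by (rule finite_subset[rotated, OF finite_Pow_iff[THEN iffD2]]) auto
  have eq: "tile_partitions L R = (\<Union>e\<in>?E. insert e ` tile_partitions L (R - e))"
  proof (intro equalityI subsetI)
    fix T assume T: "T \<in> tile_partitions L R"
    then obtain e where e: "e \<in> T" "s \<in> e" using tile_partitionsD(2)[OF T] assms(2) by auto
    then have "e \<in> ?E" using tile_partitionsD[OF T] by auto
    moreover have "T = insert e (T - {e})" using e by auto
    ultimately show "T \<in> (\<Union>e\<in>?E. insert e ` tile_partitions L (R - e))"
      using tile_partitions_remove[OF T e(1)] by blast
  next
    fix T assume "T \<in> (\<Union>e\<in>?E. insert e ` tile_partitions L (R - e))"
    then obtain e T' where e: "e \<in> L" "s \<in> e" "e \<subseteq> R" "T' \<in> tile_partitions L (R - e)" "T = insert e T'"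
      by blast
    then show "T \<in> tile_partitions L R" using tile_partitions_insert(1)[of e L R T'] by blast
  qed
  have "card (tile_partitions L R) = (\<Sum>e\<in>?E. card (insert e ` tile_partitions L (R - e)))"
    unfolding eq
  proof (rule card_UN_disjoint[OF fE])
    show "\<forall>e\<in>?E. finite (insert e ` tile_partitions L (R - e))"
      using assms(1) by (simp add: finite_tile_partitions)
    have key: "e = f" if "e \<in> ?E" "f \<in> ?E" "T \<in> insert e ` tile_partitions L (R - e)"
      "T \<in> insert f ` tile_partitions L (R - f)" for e f T
    proof -
      have "T \<in> tile_partitions L R" unfolding eq using that(1,3) by (rule UN_I)
      moreover have "e \<in> T" "f \<in> T" "s \<in> e \<inter> f" using that by auto
      ultimately show ?thesis using tile_partitionsD(4) by (metis empty_iff)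
    qed
    show "\<forall>e\<in>?E. \<forall>f\<in>?E. e \<noteq> f \<longrightarrow>
      insert e ` tile_partitions L (R - e) \<inter> insert f ` tile_partitions L (R - f) = {}"
      by (intro ballI impI Int_emptyI, erule notE, rule key)
  qed
  also have "\<dots> = (\<Sum>e\<in>?E. card (tile_partitions L (R - e)))"
  proof (rule sum.cong[OF refl])
    fix e assume e: "e \<in> ?E"
    then have "e \<notin> T" if "T \<in> tile_partitions L (R - e)" for T
      using tile_partitions_insert(2)[of e L R T] that by blast
    then have "inj_on (insert e) (tile_partitions L (R - e))"
      by (intro inj_onI) (simp add: insert_ident)
    then show "card (insert e ` tile_partitions L (R - e)) = card (tile_partitions L (R - e))"
      by (rule card_image)
  qed
  finally show ?thesis .
qed

lemma card_tile_partitions_isolated: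
  assumes "finite R" and "s \<in> R" and "\<And>e. e \<in> L \<Longrightarrow> s \<in> e \<Longrightarrow> \<not> e \<subseteq> R"
  shows "card (tile_partitions L R) = 0"
proof -
  have "{e. e \<in> L \<and> s \<in> e \<and> e \<subseteq> R} = {}" using assms(3) by auto
  then show ?thesis by (simp only: card_tile_partitions_peel[OF assms(1,2)] sum.empty)
qed

text \<open>The tiles of \<open>F\<close> can be removed one at a time: a smaller region offers
  fewer competing tiles, so what was forced stays forced.\<close>

lemma card_tile_partitions_forced:
  assumes "finite F" and "finite R" and "disjoint F" and "\<Union>F \<subseteq> R" and "F \<subseteq> L"
    and "\<And>f. f \<in> F \<Longrightarrow> \<exists>s\<in>f. \<forall>e\<in>L. s \<in> e \<longrightarrow> e \<subseteq> R \<longrightarrow> e = f"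
  shows "card (tile_partitions L R) = card (tile_partitions L (R - \<Union>F))"
  using assms
proof (induction F arbitrary: R rule: finite_induct)
  case empty
  then show ?case by simp
next
  case (insert f F)
  obtain s where s: "s \<in> f" "\<forall>e\<in>L. s \<in> e \<longrightarrow> e \<subseteq> R \<longrightarrow> e = f"
    using insert.prems(5)[of f] by auto
  have f: "f \<in> L" "f \<subseteq> R" using insert.prems by auto
  have "{e. e \<in> L \<and> s \<in> e \<and> e \<subseteq> R} = {f}"
  proof (rule set_eqI)
    show "e \<in> {e. e \<in> L \<and> s \<in> e \<and> e \<subseteq> R} \<longleftrightarrow> e \<in> {f}" for e
      using s(2)[rule_format, of e] s(1) f by auto
  qed
  then have "card (tile_partitions L R) = card (tile_partitions L (R - f))"
    using card_tile_partitions_peel[OF insert.prems(1), of s L] s(1) f by (simp add: subsetD)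
  also have "\<dots> = card (tile_partitions L (R - f - \<Union>F))"
  proof (rule insert.IH)
    show "finite (R - f)" "disjoint F" "F \<subseteq> L"
      using insert.prems by (auto simp: disjoint_def)
    have "g \<inter> f = {}" if "g \<in> F" for g
      using insert.prems(2) insert.hyps(2) that by (metis disjointD insert_iff)
    then show "\<Union>F \<subseteq> R - f" using insert.prems(3) by auto
    show "\<exists>s\<in>g. \<forall>e\<in>L. s \<in> e \<longrightarrow> e \<subseteq> R - f \<longrightarrow> e = g" if "g \<in> F" for g
      using insert.prems(5)[of g] that by (meson Diff_subset insertI2 subset_trans)
  qed
  also have "R - f - \<Union>F = R - \<Union>(insert f F)" by auto
  finally show ?case .
qed

text \<open>Transport between coordinate systems. Injectivity and preservation of tiles are asked
  only inside \<open>R\<close>, as the coordinate maps are not injective on junk arguments.\<close>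

lemma tile_partitions_image:
  assumes inj: "inj_on f R" and L: "\<And>e. e \<subseteq> R \<Longrightarrow> e \<in> L \<longleftrightarrow> f ` e \<in> L'"
  shows "tile_partitions L' (f ` R) = (\<lambda>T. (`) f ` T) ` tile_partitions L R"
proof (intro equalityI subsetI)
  fix T' assume T': "T' \<in> tile_partitions L' (f ` R)"
  note D = tile_partitionsD[OF T']
  define g where "g = inv_into R f"
  have fg: "f ` g ` e = e" if "e \<subseteq> f ` R" for e
    using that unfolding g_def by (simp add: image_inv_into_cancel)
  have gR: "g ` e \<subseteq> R" if "e \<subseteq> f ` R" for e
    using that unfolding g_def by (auto intro: inv_into_into)
  have sub: "e \<subseteq> f ` R" if "e \<in> T'" for e using D(2) that by blast
  have "(`) g ` T' \<in> tile_partitions L R"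
  proof (rule tile_partitionsI)
    show "(`) g ` T' \<subseteq> L"
    proof (rule image_subsetI)
      fix e assume "e \<in> T'"
      then show "g ` e \<in> L" using L[OF gR[OF sub]] fg[OF sub] D(1) by auto
    qed
    have "\<Union>((`) g ` T') = g ` (f ` R)" unfolding D(2)[symmetric] by (simp add: image_Union)
    then show "\<Union>((`) g ` T') = R" by (simp add: g_def inj image_inv_into_cancel inv_into_image_cancel)
    show "{} \<notin> (`) g ` T'" using D(3) by auto
    fix e e' assume "e \<in> (`) g ` T'" "e' \<in> (`) g ` T'" "e \<noteq> e'"
    then obtain h h' where h: "h \<in> T'" "h' \<in> T'" "e = g ` h" "e' = g ` h'" "h \<noteq> h'" by blast
    then have "h \<inter> h' = {}" using D(4) by blast
    moreover have "inj_on g (f ` R)" unfolding g_def by (rule inj_on_inv_into) simp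
    ultimately show "e \<inter> e' = {}" using h sub by (metis image_empty inj_on_image_Int)
  qed
  moreover have "T' = (`) f ` ((`) g ` T')" 
    using fg[OF sub] by (simp add: image_image[of "(`) f" "(`) g"])
  ultimately show "T' \<in> (\<lambda>T. (`) f ` T) ` tile_partitions L R" by blast
next
  fix T' assume "T' \<in> (\<lambda>T. (`) f ` T) ` tile_partitions L R"
  then obtain T where T: "T \<in> tile_partitions L R" "T' = (`) f ` T" by blast
  note D = tile_partitionsD[OF T(1)]
  have sub: "e \<subseteq> R" if "e \<in> T" for e using D(2) that by blast
  show "T' \<in> tile_partitions L' (f ` R)"
  proof (rule tile_partitionsI)
    show "T' \<subseteq> L'" using D(1) L[OF sub] T(2) by auto
    show "\<Union>T' = f ` R" unfolding T(2) D(2)[symmetric] by (simp add: image_Union)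
    show "{} \<notin> T'" using D(3) T(2) by auto
    fix e e' assume "e \<in> T'" "e' \<in> T'" "e \<noteq> e'"
    then obtain h h' where h: "h \<in> T" "h' \<in> T" "e = f ` h" "e' = f ` h'" "h \<noteq> h'" using T(2) by blast
    then have "h \<inter> h' = {}" using D(4) by blast
    then show "e \<inter> e' = {}" using h sub inj by (metis image_empty inj_on_image_Int)
  qed
qed

lemma inj_on_image_tile_partitions:
  assumes "inj_on f R"
  shows "inj_on (\<lambda>T. (`) f ` T) (tile_partitions L R)"
proof (rule inj_on_subset)
  show "inj_on (\<lambda>T. (`) f ` T) (Pow (Pow R))"
    using assms by (intro inj_on_image_Pow)
  show "tile_partitions L R \<subseteq> Pow (Pow R)"
    using tile_partitionsD(2) by blast
qed

lemma card_tile_partitions_image: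
  assumes "inj_on f R" and "\<And>e. e \<subseteq> R \<Longrightarrow> e \<in> L \<longleftrightarrow> f ` e \<in> L'"
  shows "card (tile_partitions L' (f ` R)) = card (tile_partitions L R)"
  using tile_partitions_image[OF assms] card_image[OF inj_on_image_tile_partitions[OF assms(1)]]
  by metis

text \<open>The bijection \<open>f\<close> conjugates \<rho> into \<rho>', hence matches invariant
  tilings with invariant tilings.\<close>

lemma card_sym_tile_partitions_image:
  assumes "inj_on f R" and "\<And>e. e \<subseteq> R \<Longrightarrow> e \<in> L \<longleftrightarrow> f ` e \<in> L'"
    and "\<rho> ` R = R" and "\<And>s. s \<in> R \<Longrightarrow> \<rho>' (f s) = f (\<rho> s)"
  shows "card {T \<in> tile_partitions L' (f ` R). (`) \<rho>' ` T = T}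
    = card {T \<in> tile_partitions L R. (`) \<rho> ` T = T}"
proof -
  let ?F = "\<lambda>T. (`) f ` T"
  have PowR: "T \<in> Pow (Pow R)" if "T \<in> tile_partitions L R" for T
    using tile_partitionsD(2)[OF that] by blast
  have comm: "(`) \<rho>' ` ?F T = ?F ((`) \<rho> ` T)" if "T \<in> Pow (Pow R)" for T
  proof -
    have "\<rho>' ` f ` e = f ` \<rho> ` e" if "e \<subseteq> R" for e
      unfolding image_image using that assms(4) by (intro image_cong) auto
    then have "\<rho>' ` f ` e = f ` \<rho> ` e" if "e \<in> T" for e
      using that \<open>T \<in> Pow (Pow R)\<close> by (meson PowD subsetD)
    then show ?thesis
      unfolding image_image[of "(`) f" "(`) \<rho>"] image_image[of "(`) \<rho>'" "(`) f"] by (intro image_cong refl)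
  qed
  have inj: "inj_on ?F (Pow (Pow R))" using assms(1) by (intro inj_on_image_Pow)
  have "{T \<in> tile_partitions L' (f ` R). (`) \<rho>' ` T = T}
      = ?F ` {T \<in> tile_partitions L R. (`) \<rho> ` T = T}"
  proof -
    have "(`) \<rho>' ` ?F T = ?F T \<longleftrightarrow> (`) \<rho> ` T = T" if "T \<in> tile_partitions L R" for T
    proof -
      have T: "T \<in> Pow (Pow R)" using PowR[OF that] .
      have S: "(`) \<rho> ` T \<in> Pow (Pow R)" using T assms(3) by blast
      show ?thesis unfolding comm[OF T] by (rule inj_on_eq_iff[OF inj S T])
    qed
    then have "{T \<in> tile_partitions L R. (`) \<rho>' ` ?F T = ?F T} = {T \<in> tile_partitions L R. (`) \<rho> ` T = T}"
      by (intro Collect_cong conj_cong refl)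
    moreover have "tile_partitions L' (f ` R) = ?F ` tile_partitions L R"
      by (rule tile_partitions_image[OF assms(1,2)])
    ultimately show ?thesis by (simp only: Compr_image_eq)
  qed
  moreover have "inj_on ?F {T \<in> tile_partitions L R. (`) \<rho> ` T = T}"
    by (rule inj_on_subset[OF inj]) (use PowR in blast)
  ultimately show ?thesis by (simp add: card_image)
qed

section \<open>Tilings of a disjoint union, sorted by the tiles that cross between pieces\<close>

definition crossing_sets :: "'a set set \<Rightarrow> 'i set \<Rightarrow> ('i \<Rightarrow> 'a set) \<Rightarrow> 'a set set set" where
  "crossing_sets L I R = {E. E \<subseteq> L \<and> disjoint E \<and> \<Union>E \<subseteq> (\<Union>i\<in>I. R i) \<and> {} \<notin> E \<and>
     (\<forall>e\<in>E. \<forall>i\<in>I. \<not> e \<subseteq> R i)}"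

definition crossing_tiles :: "'i set \<Rightarrow> ('i \<Rightarrow> 'a set) \<Rightarrow> 'a set set \<Rightarrow> 'a set set" where
  "crossing_tiles I R T = {e \<in> T. \<forall>i\<in>I. \<not> e \<subseteq> R i}"

context
  fixes L :: "'a set set" and I :: "'i set" and R :: "'i \<Rightarrow> 'a set"
  assumes disj: "disjoint_family_on R I"
begin

lemma crossing_tiles_in_crossing_sets:
  "T \<in> tile_partitions L (\<Union>i\<in>I. R i) \<Longrightarrow> crossing_tiles I R T \<in> crossing_sets L I R"
  by (auto simp: crossing_sets_def crossing_tiles_def disjoint_def
      dest: tile_partitionsD(1-3) tile_partitionsD(4))

lemma restrict_in_tile_partitions:
  assumes T: "T \<in> tile_partitions L (\<Union>i\<in>I. R i)" and i: "i \<in> I"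
  shows "{e \<in> T. e \<subseteq> R i} \<in> tile_partitions L (R i - \<Union>(crossing_tiles I R T))"
proof (rule tile_partitionsI)
  note D = tile_partitionsD[OF T]
  show "{e \<in> T. e \<subseteq> R i} \<subseteq> L" "{} \<notin> {e \<in> T. e \<subseteq> R i}" using D by auto
  show "e \<inter> f = {}" if "e \<in> {e \<in> T. e \<subseteq> R i}" "f \<in> {e \<in> T. e \<subseteq> R i}" "e \<noteq> f" for e f
    using D(4) that by auto
  show "\<Union>{e \<in> T. e \<subseteq> R i} = R i - \<Union>(crossing_tiles I R T)"
  proof (intro equalityI subsetI)
    fix s assume "s \<in> \<Union>{e \<in> T. e \<subseteq> R i}"
    then obtain e where e: "e \<in> T" "e \<subseteq> R i" "s \<in> e" by auto
    have "s \<notin> f" if "f \<in> crossing_tiles I R T" for f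
      using D(4)[OF e(1), of f] that e i by (auto simp: crossing_tiles_def)
    then show "s \<in> R i - \<Union>(crossing_tiles I R T)" using e by auto
  next
    fix s assume s: "s \<in> R i - \<Union>(crossing_tiles I R T)"
    then obtain e where e: "e \<in> T" "s \<in> e" using D(2) i by blast
    then have "e \<notin> crossing_tiles I R T" using s by auto
    then obtain j where "j \<in> I" "e \<subseteq> R j" using e by (auto simp: crossing_tiles_def)
    then have "j = i" using s e i disj by (auto simp: disjoint_family_on_def)
    then show "s \<in> \<Union>{e \<in> T. e \<subseteq> R i}" using e \<open>e \<subseteq> R j\<close> by auto
  qed
qed

lemma glue_in_tile_partitions:
  assumes E: "E \<in> crossing_sets L I R" and g: "\<And>i. i \<in> I \<Longrightarrow> g i \<in> tile_partitions L (R i - \<Union>E)"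
  shows "E \<union> (\<Union>i\<in>I. g i) \<in> tile_partitions L (\<Union>i\<in>I. R i)"
    and "crossing_tiles I R (E \<union> (\<Union>i\<in>I. g i)) = E"
    and "\<And>i. i \<in> I \<Longrightarrow> {e \<in> E \<union> (\<Union>i\<in>I. g i). e \<subseteq> R i} = g i"
proof -
  note D = tile_partitionsD[OF g]
  have E': "E \<subseteq> L" "\<And>e f. e \<in> E \<Longrightarrow> f \<in> E \<Longrightarrow> e \<noteq> f \<Longrightarrow> e \<inter> f = {}" "\<Union>E \<subseteq> (\<Union>i\<in>I. R i)"
    "{} \<notin> E" "\<And>e i. e \<in> E \<Longrightarrow> i \<in> I \<Longrightarrow> \<not> e \<subseteq> R i"
    using E by (auto simp: crossing_sets_def disjoint_def)
  have sub: "e \<subseteq> R i - \<Union>E" if "e \<in> g i" "i \<in> I" for e i using D(2)[OF that(2)] that(1) by blast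
  have dis: "i = j" if "i \<in> I" "j \<in> I" "s \<in> R i" "s \<in> R j" for i j s
    using disj that by (auto simp: disjoint_family_on_def)
  show "E \<union> (\<Union>i\<in>I. g i) \<in> tile_partitions L (\<Union>i\<in>I. R i)"
  proof (rule tile_partitionsI)
    show "E \<union> (\<Union>i\<in>I. g i) \<subseteq> L" using E'(1) D(1) by (simp add: UN_least)
    show "{} \<notin> E \<union> (\<Union>i\<in>I. g i)" using E'(4) D(3) by simp
    have "\<Union>(E \<union> (\<Union>i\<in>I. g i)) = \<Union>E \<union> (\<Union>i\<in>I. \<Union>(g i))" by auto
    also have "\<dots> = \<Union>E \<union> (\<Union>i\<in>I. R i - \<Union>E)" using D(2) by simp
    also have "\<dots> = (\<Union>i\<in>I. R i)" using E'(3) by auto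
    finally show "\<Union>(E \<union> (\<Union>i\<in>I. g i)) = (\<Union>i\<in>I. R i)" .
    fix e f assume e: "e \<in> E \<union> (\<Union>i\<in>I. g i)" and f: "f \<in> E \<union> (\<Union>i\<in>I. g i)" and "e \<noteq> f"
    consider "e \<in> E" "f \<in> E" | i where "e \<in> E" "i \<in> I" "f \<in> g i" | i where "f \<in> E" "i \<in> I" "e \<in> g i"
      | i j where "i \<in> I" "e \<in> g i" "j \<in> I" "f \<in> g j" using e f by blast
    then show "e \<inter> f = {}"
    proof cases
      case 1
      then show ?thesis using E'(2) \<open>e \<noteq> f\<close> by blast
    next
      case (2 i)
      then show ?thesis using sub[of f i] by auto
    next
      case (3 i)
      then show ?thesis using sub[of e i] by auto
    next
      case (4 i j)
      show ?thesis
      proof (cases "i = j")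
        case True
        then show ?thesis using 4 D(4)[of i e f] \<open>e \<noteq> f\<close> by auto
      next
        case False
        have "s \<in> R i" "s \<in> R j" if "s \<in> e" "s \<in> f" for s
          using sub[of e i] sub[of f j] 4 that by auto
        then show ?thesis using False 4 dis[of i j] by (meson Int_emptyI)
      qed
    qed
  qed
  have inside: "\<exists>i\<in>I. e \<subseteq> R i" if "e \<in> (\<Union>i\<in>I. g i)" for e
    using that sub by (metis Diff_subset UN_E subset_trans)
  have "e \<in> crossing_tiles I R (E \<union> (\<Union>i\<in>I. g i)) \<longleftrightarrow> e \<in> E" for e
    using E'(5)[of e] inside[of e] unfolding crossing_tiles_def by auto
  then show "crossing_tiles I R (E \<union> (\<Union>i\<in>I. g i)) = E" by (rule set_eqI)
  show "{e \<in> E \<union> (\<Union>i\<in>I. g i). e \<subseteq> R i} = g i" if i: "i \<in> I" for i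
  proof -
    have "e \<in> g i" if "e \<in> g j" "j \<in> I" "e \<subseteq> R i" for e j
    proof -
      have "e \<noteq> {}" using D(3)[OF that(2)] that(1) by auto
      then obtain s where "s \<in> e" by auto
      then have "i = j" using sub[OF that(1,2)] that i dis[of i j s] by auto
      then show ?thesis using that by simp
    qed
    moreover have "e \<subseteq> R i" if "e \<in> g i" for e using sub[OF that i] by auto
    ultimately show ?thesis using E'(5) i by auto
  qed
qed

lemma glue_restrict:
  assumes T: "T \<in> tile_partitions L (\<Union>i\<in>I. R i)"
  shows "T = crossing_tiles I R T \<union> (\<Union>i\<in>I. {e \<in> T. e \<subseteq> R i})"
  by (auto simp: crossing_tiles_def)

text \<open>Once the crossing tiles are fixed, every other tile lies inside one piece, and the
  tilings of what is left of the pieces can be chosen independently.\<close>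

lemma bij_betw_tile_partitions_fibre:
  assumes E: "E \<in> crossing_sets L I R"
  shows "bij_betw (\<lambda>T. \<lambda>i\<in>I. {e \<in> T. e \<subseteq> R i})
    {T \<in> tile_partitions L (\<Union>i\<in>I. R i). crossing_tiles I R T = E}
    (PiE I (\<lambda>i. tile_partitions L (R i - \<Union>E)))"
proof (rule bij_betw_byWitness[where f' = "\<lambda>g. E \<union> (\<Union>i\<in>I. g i)"])
  show "\<forall>T\<in>{T \<in> tile_partitions L (\<Union>i\<in>I. R i). crossing_tiles I R T = E}.
       E \<union> (\<Union>i\<in>I. (\<lambda>i\<in>I. {e \<in> T. e \<subseteq> R i}) i) = T"
    using glue_restrict by auto
  show "\<forall>g\<in>PiE I (\<lambda>i. tile_partitions L (R i - \<Union>E)).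
       (\<lambda>i\<in>I. {e \<in> E \<union> (\<Union>i\<in>I. g i). e \<subseteq> R i}) = g"
  proof
    fix g assume g: "g \<in> PiE I (\<lambda>i. tile_partitions L (R i - \<Union>E))"
    then have g': "g i \<in> tile_partitions L (R i - \<Union>E)" if "i \<in> I" for i using that by auto
    show "(\<lambda>i\<in>I. {e \<in> E \<union> (\<Union>i\<in>I. g i). e \<subseteq> R i}) = g"
    proof (rule PiE_ext)
      show "(\<lambda>i\<in>I. {e \<in> E \<union> (\<Union>i\<in>I. g i). e \<subseteq> R i}) \<in> PiE I (\<lambda>i. tile_partitions L (R i - \<Union>E))"
        by (rule restrict_PiE_iff[THEN iffD2], rule ballI)
           (use glue_in_tile_partitions(3)[OF E g'] g' in simp)
    qed (simp_all only: g restrict_apply' glue_in_tile_partitions(3)[OF E g'])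
  qed
  show "(\<lambda>T. \<lambda>i\<in>I. {e \<in> T. e \<subseteq> R i}) `
      {T \<in> tile_partitions L (\<Union>i\<in>I. R i). crossing_tiles I R T = E}
      \<subseteq> PiE I (\<lambda>i. tile_partitions L (R i - \<Union>E))"
    using restrict_in_tile_partitions by auto
  show "(\<lambda>g. E \<union> (\<Union>i\<in>I. g i)) ` PiE I (\<lambda>i. tile_partitions L (R i - \<Union>E))
    \<subseteq> {T \<in> tile_partitions L (\<Union>i\<in>I. R i). crossing_tiles I R T = E}"
  proof
    fix T assume "T \<in> (\<lambda>g. E \<union> (\<Union>i\<in>I. g i)) ` PiE I (\<lambda>i. tile_partitions L (R i - \<Union>E))"
    then obtain g where g: "g \<in> PiE I (\<lambda>i. tile_partitions L (R i - \<Union>E))" and T: "T = E \<union> (\<Union>i\<in>I. g i)"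
      by blast
    from g have g': "g i \<in> tile_partitions L (R i - \<Union>E)" if "i \<in> I" for i using that by auto
    show "T \<in> {T \<in> tile_partitions L (\<Union>i\<in>I. R i). crossing_tiles I R T = E}"
      unfolding T using glue_in_tile_partitions(1,2)[OF E g'] by simp
  qed
qed

lemma card_tile_partitions_split:
  assumes "finite I" and "\<And>i. i \<in> I \<Longrightarrow> finite (R i)"
  shows "card (tile_partitions L (\<Union>i\<in>I. R i))
    = (\<Sum>E\<in>crossing_sets L I R. \<Prod>i\<in>I. card (tile_partitions L (R i - \<Union>E)))"
proof -
  let ?T = "tile_partitions L (\<Union>i\<in>I. R i)"
  have finR: "finite (\<Union>i\<in>I. R i)" using assms by auto
  have fin: "finite (crossing_sets L I R)"
    by (rule finite_subset[of _ "Pow (Pow (\<Union>i\<in>I. R i))"]) (use finR in \<open>auto simp: crossing_sets_def\<close>)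
  have "card ?T = (\<Sum>E\<in>crossing_sets L I R. card {T \<in> ?T. crossing_tiles I R T = E})"
  proof -
    have "?T = (\<Union>E\<in>crossing_sets L I R. {T \<in> ?T. crossing_tiles I R T = E})"
      using crossing_tiles_in_crossing_sets by blast
    then have "card ?T = card (\<Union>E\<in>crossing_sets L I R. {T \<in> ?T. crossing_tiles I R T = E})" by simp
    also have "\<dots> = (\<Sum>E\<in>crossing_sets L I R. card {T \<in> ?T. crossing_tiles I R T = E})"
      by (rule card_UN_disjoint) (use fin finite_tile_partitions[OF finR] in auto)
    finally show ?thesis .
  qed
  also have "\<dots> = (\<Sum>E\<in>crossing_sets L I R. \<Prod>i\<in>I. card (tile_partitions L (R i - \<Union>E)))"
    using bij_betw_same_card[OF bij_betw_tile_partitions_fibre] assms(1)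
    by (intro sum.cong) (auto simp: card_PiE)
  finally show ?thesis .
qed

end

section \<open>Tilings invariant under a symmetry of order three\<close>

text \<open>The conditions on \<open>J\<close> say that it meets each orbit of \<tau> on
  \<open>I\<close> in exactly one index and that each orbit has three elements.\<close>

locale symmetric_split =
  fixes L :: "'a set set" and I J :: "'i set" and R :: "'i \<Rightarrow> 'a set" and \<rho> :: "'a \<Rightarrow> 'a" and \<tau> :: "'i \<Rightarrow> 'i"
  assumes disj: "disjoint_family_on R I"
    and J: "J \<subseteq> I" "\<And>i. i \<in> I \<Longrightarrow> i \<in> J \<or> \<tau> i \<in> J \<or> \<tau> (\<tau> i) \<in> J"
      "\<And>i. i \<in> J \<Longrightarrow> \<tau> i \<notin> J" "\<And>i. i \<in> J \<Longrightarrow> \<tau> (\<tau> i) \<notin> J"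
    and \<tau>: "\<And>i. i \<in> I \<Longrightarrow> \<tau> i \<in> I" "\<And>i. i \<in> I \<Longrightarrow> \<tau> (\<tau> (\<tau> i)) = i"
    and \<rho>: "\<And>s. \<rho> (\<rho> (\<rho> s)) = s"
    and L: "\<And>e. e \<in> L \<longleftrightarrow> \<rho> ` e \<in> L"
    and R: "\<And>i. i \<in> I \<Longrightarrow> \<rho> ` R i = R (\<tau> i)"
begin

abbreviation turn_tiles :: "'a set set \<Rightarrow> 'a set set" where
  "turn_tiles T \<equiv> (`) \<rho> ` T"

lemma inj_\<rho>: "inj \<rho>"
  by (metis \<rho> injI)

lemma turn_tiles_cubed: "turn_tiles (turn_tiles (turn_tiles T)) = T"
  by (simp add: image_image \<rho>)

lemma turn_tile_subset_iff:
  assumes "i \<in> I"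
  shows "\<rho> ` e \<subseteq> R (\<tau> i) \<longleftrightarrow> e \<subseteq> R i"
  unfolding R[OF assms, symmetric] by (rule inj_image_subset_iff[OF inj_\<rho>])

lemma image_\<tau>: "\<tau> ` I = I"
proof
  show "I \<subseteq> \<tau> ` I"
  proof
    fix i assume "i \<in> I"
    then have "i = \<tau> (\<tau> (\<tau> i))" "\<tau> (\<tau> i) \<in> I" using \<tau> by auto
    then show "i \<in> \<tau> ` I" by blast
  qed
qed (use \<tau> in auto)

lemma turn_restrict:
  assumes T: "turn_tiles T = T" and i: "i \<in> I"
  shows "{e \<in> T. e \<subseteq> R (\<tau> i)} = turn_tiles {e \<in> T. e \<subseteq> R i}"
proof -
  have "{e \<in> turn_tiles T. e \<subseteq> R (\<tau> i)} = turn_tiles {e \<in> T. \<rho> ` e \<subseteq> R (\<tau> i)}"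
    by (rule Compr_image_eq)
  then show ?thesis unfolding T turn_tile_subset_iff[OF i] .
qed

lemma turn_crossing_tiles:
  assumes T: "turn_tiles T = T"
  shows "turn_tiles (crossing_tiles I R T) = crossing_tiles I R T"
proof -
  have "(\<forall>i\<in>I. \<not> \<rho> ` e \<subseteq> R i) \<longleftrightarrow> (\<forall>i\<in>I. \<not> e \<subseteq> R i)" for e
  proof -
    have "(\<forall>i\<in>I. \<not> \<rho> ` e \<subseteq> R i) \<longleftrightarrow> (\<forall>i\<in>\<tau> ` I. \<not> \<rho> ` e \<subseteq> R i)" by (simp only: image_\<tau>)
    also have "\<dots> \<longleftrightarrow> (\<forall>i\<in>I. \<not> e \<subseteq> R i)" using turn_tile_subset_iff by simp
    finally show ?thesis .
  qed
  then have "{e \<in> turn_tiles T. \<forall>i\<in>I. \<not> e \<subseteq> R i} = turn_tiles {e \<in> T. \<forall>i\<in>I. \<not> e \<subseteq> R i}"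
    unfolding Compr_image_eq by simp
  then show ?thesis unfolding T crossing_tiles_def by simp
qed

text \<open>Extends a choice on representatives to all pieces. As \<tau> has order three,
  \<open>i\<close> lies one turn after \<open>\<tau> (\<tau> i)\<close> and two turns after
  \<open>\<tau> i\<close>, which explains the number of turns in each branch.\<close>

definition spread :: "('i \<Rightarrow> 'a set set) \<Rightarrow> 'i \<Rightarrow> 'a set set" where
  "spread g i = (if i \<in> J then g i else if \<tau> (\<tau> i) \<in> J then turn_tiles (g (\<tau> (\<tau> i)))
     else turn_tiles (turn_tiles (g (\<tau> i))))"

lemma turn_spread:
  assumes i: "i \<in> I"
  shows "turn_tiles (spread g i) = spread g (\<tau> i)"
proof -
  consider "i \<in> J" | "i \<notin> J" "\<tau> (\<tau> i) \<in> J" | "i \<notin> J" "\<tau> (\<tau> i) \<notin> J" "\<tau> i \<in> J" using J(2)[OF i] by blast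
  then show ?thesis
  proof cases
    case 1
    then show ?thesis using J(3)[of i] \<tau>(2)[OF i] by (simp add: spread_def)
  next
    case 2
    then have "\<tau> i \<notin> J" using J(3)[of "\<tau> i"] by blast
    then show ?thesis using 2 \<tau>(2)[OF i] by (simp add: spread_def)
  next
    case 3
    then show ?thesis by (simp add: spread_def turn_tiles_cubed)
  qed
qed

lemma spread_restrict:
  assumes T: "turn_tiles T = T" and i: "i \<in> I"
  shows "spread (\<lambda>i\<in>J. {e \<in> T. e \<subseteq> R i}) i = {e \<in> T. e \<subseteq> R i}"
proof -
  have r: "turn_tiles {e \<in> T. e \<subseteq> R j} = {e \<in> T. e \<subseteq> R (\<tau> j)}" if "j \<in> I" for j
    using turn_restrict[OF T that] by simp
  have "turn_tiles {e \<in> T. e \<subseteq> R (\<tau> (\<tau> i))} = {e \<in> T. e \<subseteq> R i}"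
    using r[of "\<tau> (\<tau> i)"] \<tau> i by simp
  moreover have "turn_tiles (turn_tiles {e \<in> T. e \<subseteq> R (\<tau> i)}) = {e \<in> T. e \<subseteq> R i}"
    using r[of "\<tau> i"] r[of "\<tau> (\<tau> i)"] \<tau> i by simp
  ultimately show ?thesis using J(2)[OF i]
    by (cases "i \<in> J"; cases "\<tau> (\<tau> i) \<in> J"; simp add: spread_def)
qed

lemma spread_in_tile_partitions:
  assumes E: "turn_tiles E = E" and g: "\<And>i. i \<in> J \<Longrightarrow> g i \<in> tile_partitions L (R i - \<Union>E)" and i: "i \<in> I"
  shows "spread g i \<in> tile_partitions L (R i - \<Union>E)"
proof -
  have r: "turn_tiles T \<in> tile_partitions L (R (\<tau> j) - \<Union>E)"
    if T: "T \<in> tile_partitions L (R j - \<Union>E)" and j: "j \<in> I" for T j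
  proof -
    have "\<rho> ` \<Union>E = \<Union>(turn_tiles E)" by (rule image_Union)
    then have "\<rho> ` \<Union>E = \<Union>E" unfolding E .
    then have "\<rho> ` (R j - \<Union>E) = R (\<tau> j) - \<Union>E"
      using image_set_diff[OF inj_\<rho>, of "R j" "\<Union>E"] R[OF j] by simp
    moreover have "tile_partitions L (\<rho> ` (R j - \<Union>E)) = turn_tiles ` tile_partitions L (R j - \<Union>E)"
      by (rule tile_partitions_image) (use inj_\<rho> L in \<open>auto intro: inj_on_subset\<close>)
    ultimately show ?thesis using T by auto
  qed
  consider "i \<in> J" | "i \<notin> J" "\<tau> (\<tau> i) \<in> J" | "i \<notin> J" "\<tau> (\<tau> i) \<notin> J" "\<tau> i \<in> J" using J(2)[OF i] by blast
  then show ?thesis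
  proof cases
    case 1
    then show ?thesis using g by (simp add: spread_def)
  next
    case 2
    then show ?thesis using r[OF g[OF 2(2)]] \<tau> i by (simp add: spread_def)
  next
    case 3
    then show ?thesis using r[OF r[OF g[OF 3(3)]]] \<tau> i by (simp add: spread_def)
  qed
qed

text \<open>With an invariant set of crossing tiles, an invariant tiling is determined by its
  restriction to the pieces in \<open>J\<close>, and there is no constraint on these.\<close>

lemma bij_betw_sym_fibre:
  assumes E: "E \<in> crossing_sets L I R" and E': "turn_tiles E = E"
  shows "bij_betw (\<lambda>T. \<lambda>i\<in>J. {e \<in> T. e \<subseteq> R i})
    {T \<in> tile_partitions L (\<Union>i\<in>I. R i). crossing_tiles I R T = E \<and> turn_tiles T = T}
    (PiE J (\<lambda>i. tile_partitions L (R i - \<Union>E)))" (is "bij_betw _ ?S ?P")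
proof (rule bij_betw_byWitness[where f' = "\<lambda>g. E \<union> (\<Union>i\<in>I. spread g i)"])
  show "\<forall>T\<in>?S. E \<union> (\<Union>i\<in>I. spread (\<lambda>i\<in>J. {e \<in> T. e \<subseteq> R i}) i) = T"
  proof
    fix T assume T: "T \<in> ?S"
    then have "(\<Union>i\<in>I. spread (\<lambda>i\<in>J. {e \<in> T. e \<subseteq> R i}) i) = (\<Union>i\<in>I. {e \<in> T. e \<subseteq> R i})"
      using spread_restrict[of T] by auto
    then show "E \<union> (\<Union>i\<in>I. spread (\<lambda>i\<in>J. {e \<in> T. e \<subseteq> R i}) i) = T"
      using glue_restrict[OF disj, of T L] T by simp
  qed
  have sp: "spread g i \<in> tile_partitions L (R i - \<Union>E)" if "g \<in> ?P" "i \<in> I" for g i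
    using that by (intro spread_in_tile_partitions E') auto
  show "\<forall>g\<in>?P. (\<lambda>i\<in>J. {e \<in> E \<union> (\<Union>i\<in>I. spread g i). e \<subseteq> R i}) = g"
  proof
    fix g assume g: "g \<in> ?P"
    have eq: "{e \<in> E \<union> (\<Union>i\<in>I. spread g i). e \<subseteq> R i} = g i" if "i \<in> J" for i
    proof -
      have "i \<in> I" and s: "spread g i = g i" using that J(1) by (auto simp: spread_def)
      then show ?thesis using glue_in_tile_partitions(3)[OF disj E sp[OF g], of i] unfolding s by simp
    qed
    show "(\<lambda>i\<in>J. {e \<in> E \<union> (\<Union>i\<in>I. spread g i). e \<subseteq> R i}) = g"
    proof
      fix i show "(\<lambda>i\<in>J. {e \<in> E \<union> (\<Union>i\<in>I. spread g i). e \<subseteq> R i}) i = g i"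
        using eq[of i] PiE_arb[OF g, of i] by (cases "i \<in> J") simp_all
    qed
  qed
  show "(\<lambda>T. \<lambda>i\<in>J. {e \<in> T. e \<subseteq> R i}) ` ?S \<subseteq> ?P"
  proof (rule image_subsetI)
    fix T assume T: "T \<in> ?S"
    then have "{e \<in> T. e \<subseteq> R i} \<in> tile_partitions L (R i - \<Union>E)" if "i \<in> J" for i
      using restrict_in_tile_partitions[OF disj, of T L i] that J(1) by auto
    then show "(\<lambda>i\<in>J. {e \<in> T. e \<subseteq> R i}) \<in> ?P" by (simp only: restrict_PiE_iff) simp
  qed
  show "(\<lambda>g. E \<union> (\<Union>i\<in>I. spread g i)) ` ?P \<subseteq> ?S"
  proof (rule image_subsetI)
    fix g assume g: "g \<in> ?P"
    have "turn_tiles (\<Union>i\<in>I. spread g i) = (\<Union>i\<in>I. turn_tiles (spread g i))" by (rule image_UN)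
    also have "\<dots> = (\<Union>i\<in>I. spread g (\<tau> i))" using turn_spread by simp
    also have "\<dots> = (\<Union>i\<in>\<tau> ` I. spread g i)" by simp
    finally have "turn_tiles (E \<union> (\<Union>i\<in>I. spread g i)) = E \<union> (\<Union>i\<in>I. spread g i)"
      unfolding image_Un E' image_\<tau> by simp
    then show "E \<union> (\<Union>i\<in>I. spread g i) \<in> ?S"
      using glue_in_tile_partitions(1,2)[OF disj E sp[OF g]] by simp
  qed
qed

lemma card_sym_tile_partitions_split:
  assumes "finite I" and "\<And>i. i \<in> I \<Longrightarrow> finite (R i)"
  shows "card {T \<in> tile_partitions L (\<Union>i\<in>I. R i). turn_tiles T = T}
    = (\<Sum>E | E \<in> crossing_sets L I R \<and> turn_tiles E = E. \<Prod>i\<in>J. card (tile_partitions L (R i - \<Union>E)))"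
proof -
  let ?T = "{T \<in> tile_partitions L (\<Union>i\<in>I. R i). turn_tiles T = T}"
  let ?E = "{E. E \<in> crossing_sets L I R \<and> turn_tiles E = E}"
  let ?F = "\<lambda>E. {T \<in> tile_partitions L (\<Union>i\<in>I. R i). crossing_tiles I R T = E \<and> turn_tiles T = T}"
  have finR: "finite (\<Union>i\<in>I. R i)" using assms by auto
  have fin: "finite ?E"
    by (rule finite_subset[of _ "Pow (Pow (\<Union>i\<in>I. R i))"]) (use finR in \<open>auto simp: crossing_sets_def\<close>)
  have "?T = (\<Union>E\<in>?E. ?F E)"
  proof (intro equalityI subsetI)
    fix T assume "T \<in> ?T"
    then have "crossing_tiles I R T \<in> ?E" "T \<in> ?F (crossing_tiles I R T)"
      using crossing_tiles_in_crossing_sets[OF disj, of T L] turn_crossing_tiles[of T] by auto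
    then show "T \<in> (\<Union>E\<in>?E. ?F E)" by (rule UN_I)
  qed auto
  then have "card ?T = card (\<Union>E\<in>?E. ?F E)" by simp
  also have "\<dots> = (\<Sum>E\<in>?E. card (?F E))"
    by (rule card_UN_disjoint) (use fin finite_tile_partitions[OF finR] in auto)
  also have "\<dots> = (\<Sum>E\<in>?E. \<Prod>i\<in>J. card (tile_partitions L (R i - \<Union>E)))"
  proof (rule sum.cong[OF refl])
    fix E assume "E \<in> ?E"
    then show "card (?F E) = (\<Prod>i\<in>J. card (tile_partitions L (R i - \<Union>E)))"
      using bij_betw_same_card[OF bij_betw_sym_fibre[of E]] finite_subset[OF J(1) assms(1)]
      by (simp add: card_PiE)
  qed
  finally show ?thesis .
qed

end

lemma sorted_list_of_set_eqI: "sorted_wrt (<) xs \<Longrightarrow> set xs = S \<Longrightarrow> sorted_list_of_set S = xs"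
  by (metis strict_sorted_iff sorted_list_of_set.idem_if_sorted_distinct)

subsection \<open>Tilings of a dented triangle or trapezoid\<close>

text \<open>
  The unit triangles of the region \<open>a, b \<ge> 0\<close>, \<open>x \<le> a + b \<le> n + x\<close> in oblique coordinates:
  \<open>(True, a, b)\<close> has the vertices \<open>(a, b)\<close>, \<open>(a + 1, b)\<close>, \<open>(a, b + 1)\<close> and \<open>(False, a, b)\<close> has
  the vertices \<open>(a + 1, b)\<close>, \<open>(a, b + 1)\<close>, \<open>(a + 1, b + 1)\<close>.
\<close>

type_synonym mcell = "bool \<times> nat \<times> nat"

definition model_tiles :: "mcell set set" where
  "model_tiles = {{(True, a, b), (False, a, b)} | a b. True}
     \<union> {{(True, Suc a, b), (False, a, b)} | a b. True}
     \<union> {{(True, a, Suc b), (False, a, b)} | a b. True}"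

definition trapezoid :: "nat \<Rightarrow> nat \<Rightarrow> mcell set" where
  "trapezoid n x = {(True, a, b) | a b. x \<le> a + b \<and> a + b < n + x}
     \<union> {(False, a, b) | a b. x \<le> Suc (a + b) \<and> Suc (a + b) < n + x}"

text \<open>Label 1 sits next to the cut-off corner, at coordinate \<open>x\<close>. For
  \<open>x = 0\<close> nothing is cut off and the labels 1 of both sides are the same cell
  \<open>(True, 0, 0)\<close>.\<close>

definition dented_trapezoid :: "nat \<Rightarrow> nat \<Rightarrow> nat set \<Rightarrow> nat set \<Rightarrow> mcell set" where
  "dented_trapezoid n x P Q = trapezoid n x - (\<lambda>k. (True, 0, x + k - 1)) ` P - (\<lambda>k. (True, x + k - 1, 0)) ` Q"

lemma model_tiles_intros:
  "{(True, a, b), (False, a, b)} \<in> model_tiles"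
  "{(True, Suc a, b), (False, a, b)} \<in> model_tiles"
  "{(True, a, Suc b), (False, a, b)} \<in> model_tiles"
  unfolding model_tiles_def by blast+

lemma model_tile_True_iff:
  "e \<in> model_tiles \<and> (True, a, b) \<in> e \<longleftrightarrow>
     e = {(True, a, b), (False, a, b)} \<or> a > 0 \<and> e = {(True, a, b), (False, a - 1, b)}
     \<or> b > 0 \<and> e = {(True, a, b), (False, a, b - 1)}" (is "?l \<longleftrightarrow> ?r")
proof
  assume ?l
  then show ?r unfolding model_tiles_def Un_iff mem_Collect_eq
    by (elim conjE disjE exE) simp_all
next
  assume ?r
  moreover have "{(True, a, b), (False, a - 1, b)} = {(True, Suc (a - 1), b), (False, a - 1, b)}" if "a > 0"
    using that by simp
  moreover have "{(True, a, b), (False, a, b - 1)} = {(True, a, Suc (b - 1)), (False, a, b - 1)}" if "b > 0"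
    using that by simp
  ultimately show ?l by (metis insertI1 model_tiles_intros)
qed

lemma model_tile_False_iff:
  "e \<in> model_tiles \<and> (False, a, b) \<in> e \<longleftrightarrow>
     e = {(True, a, b), (False, a, b)} \<or> e = {(True, Suc a, b), (False, a, b)}
     \<or> e = {(True, a, Suc b), (False, a, b)}"
  unfolding model_tiles_def by auto

text \<open>
  Cutting a tiling into the rows \<open>b = const\<close> turns it into a family of nonintersecting paths,
  each of which moves in a row from \<open>a\<close> to \<open>a\<close> or \<open>a - 1\<close> and leaves through one of the dents
  \<open>(True, 0, x + p - 1)\<close>. In \<open>row_region b X Y\<close> the triangles \<open>(True, a, b)\<close> with \<open>a \<in> X\<close>
  are still to be matched and the triangles \<open>(False, a, b)\<close> with \<open>a \<in> Y\<close> have been used.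
\<close>

context
  fixes n x :: nat and P :: "nat set"
  assumes P: "P \<subseteq> {1..n}"
begin

definition upper_rows :: "nat \<Rightarrow> mcell set" where
  "upper_rows b = {(u, a', b') \<in> trapezoid n x - (\<lambda>k. (True, 0, x + k - 1)) ` P. b \<le> b'}"

definition row_region :: "nat \<Rightarrow> nat set \<Rightarrow> nat set \<Rightarrow> mcell set" where
  "row_region b X Y = (\<lambda>a. (True, a, b)) ` X
     \<union> (\<lambda>a. (False, a, b)) ` ({a. x \<le> Suc (a + b) \<and> Suc (a + b) < n + x} - Y) \<union> upper_rows (Suc b)"

text \<open>The dents not yet passed in row \<open>b\<close>. The bound also keeps the truncated
  subtraction in \<open>path_row\<close> away from passed dents, which would give the spurious value
  \<open>0 choose a\<close>.\<close>

definition exits :: "nat \<Rightarrow> nat list" where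
  "exits b = sorted_list_of_set {p \<in> P. b \<le> x + p - 1}"

text \<open>The number of single paths from column \<open>a\<close> of row \<open>b\<close> to the
  dent \<open>p\<close>: of the \<open>x + p - 1 - b\<close> moves that remain, exactly
  \<open>a\<close> go to the left.\<close>

definition path_row :: "nat \<Rightarrow> nat \<Rightarrow> nat \<Rightarrow> real" where
  "path_row b a = (\<lambda>p. real ((x + p - 1 - b) choose a))"

lemma finite_exits: "finite {p \<in> P. b \<le> x + p - 1}"
  using P by (auto intro: finite_subset)

lemma set_exits [simp]: "set (exits b) = {p \<in> P. b \<le> x + p - 1}"
  using finite_exits by (simp add: exits_def)

lemma finite_trapezoid: "finite (trapezoid n x)"
proof (rule finite_subset)
  show "trapezoid n x \<subseteq> UNIV \<times> {..n + x} \<times> {..n + x}" by (auto simp: trapezoid_def)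
qed auto

lemma finite_row_region: "finite X \<Longrightarrow> finite (row_region b X Y)"
proof -
  have "finite {a. x \<le> Suc (a + b) \<and> Suc (a + b) < n + x}"
    by (rule finite_subset[of _ "{..n + x}"]) auto
  moreover have "finite (upper_rows b')" for b'
    unfolding upper_rows_def by (rule finite_subset[OF _ finite_trapezoid]) auto
  ultimately show "finite X \<Longrightarrow> finite (row_region b X Y)" unfolding row_region_def by auto
qed

lemma path_row_Suc:
  assumes "p \<in> set (exits (Suc b))"
  shows "path_row b a p = (if a = 0 then path_row (Suc b) 0 p
    else path_row (Suc b) a p + path_row (Suc b) (a - 1) p)"
proof -
  have "x + p - 1 - b = Suc (x + p - 1 - Suc b)" using assms by auto
  then show ?thesis by (cases a) (simp_all add: path_row_def)
qed

text \<open>Pascal's rule sorts the paths behind one row by their next move, staying at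
  \<open>a\<close> or going to \<open>a - 1\<close>; linearity in that row lifts this to the
  determinant.\<close>

lemma ldet_path_row_step:
  assumes "a > 0"
  shows "ldet (exits (Suc b)) (us @ path_row b a # vs)
    = ldet (exits (Suc b)) (us @ path_row (Suc b) a # vs)
      + ldet (exits (Suc b)) (us @ path_row (Suc b) (a - 1) # vs)"
proof -
  have "ldet (exits (Suc b)) (us @ path_row b a # vs)
    = ldet (exits (Suc b)) (us @ (\<lambda>p. path_row (Suc b) a p + path_row (Suc b) (a - 1) p) # vs)"
    by (rule ldet_row_cong) (use path_row_Suc[of _ b a] assms in simp)
  then show ?thesis by (simp only: ldet_row_add)
qed

definition exit_level :: "nat \<Rightarrow> bool" where
  "exit_level b \<longleftrightarrow> (\<exists>p\<in>P. b = x + p - 1)"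

text \<open>\<open>Y\<close> holds the columns where paths enter row \<open>b\<close>. A path
  entering at a dent has arrived: its triangle is absent from the region, but 0 remains in
  \<open>Y\<close>, so that the determinant keeps one row per path.\<close>

definition level_region :: "nat \<Rightarrow> nat set \<Rightarrow> mcell set" where
  "level_region b Y = row_region b (Y - (if exit_level b then {0} else {})) {}"

lemma upper_rows_True_iff:
  "(True, a, b') \<in> upper_rows b \<longleftrightarrow> x \<le> a + b' \<and> a + b' < n + x \<and> b \<le> b' \<and> \<not> (a = 0 \<and> exit_level b')"
  by (auto simp: upper_rows_def trapezoid_def exit_level_def)

lemma upper_rows_False_iff:
  "(False, a, b') \<in> upper_rows b \<longleftrightarrow> x \<le> Suc (a + b') \<and> Suc (a + b') < n + x \<and> b \<le> b'"
  by (auto simp: upper_rows_def trapezoid_def)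

lemma row_region_True_iff:
  "(True, a, b') \<in> row_region b X Y \<longleftrightarrow> b' = b \<and> a \<in> X \<or>
     x \<le> a + b' \<and> a + b' < n + x \<and> Suc b \<le> b' \<and> \<not> (a = 0 \<and> exit_level b')"
  by (auto simp: row_region_def upper_rows_True_iff)

lemma row_region_False_iff:
  "(False, a, b') \<in> row_region b X Y \<longleftrightarrow>
     x \<le> Suc (a + b') \<and> Suc (a + b') < n + x \<and> b \<le> b' \<and> \<not> (b' = b \<and> a \<in> Y)"
  by (auto simp: row_region_def upper_rows_False_iff)

lemma mcell_set_eqI:
  assumes "\<And>a b. (True, a, b) \<in> R \<longleftrightarrow> (True, a, b) \<in> S"
    and "\<And>a b. (False, a, b) \<in> R \<longleftrightarrow> (False, a, b) \<in> S"
  shows "R = (S :: mcell set)"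
proof (rule set_eqI)
  fix s :: mcell
  obtain u a b where "s = (u, a, b)" by (cases s)
  then show "s \<in> R \<longleftrightarrow> s \<in> S" using assms by (cases u) auto
qed

text \<open>When the \<open>True\<close> triangles of row \<open>b\<close> are used up, each
  remaining \<open>(False, a, b)\<close> can only pair with \<open>(True, a, Suc b)\<close>. All
  this is forced, and the paths enter the next row exactly at \<open>Y\<close>. The exception is a
  dent in the place of the partner of \<open>(False, 0, b)\<close>, which leaves that triangle
  isolated.\<close>

lemma card_row_region_finished:
  assumes Y: "Y \<subseteq> {a. x \<le> Suc (a + b) \<and> Suc (a + b) < n + x}"
  shows "card (tile_partitions model_tiles (row_region b {} Y))
    = (if exit_level (Suc b) \<and> 0 \<notin> Y then 0
       else card (tile_partitions model_tiles (level_region (Suc b) Y)))"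
proof -
  let ?R = "row_region b {} Y"
  have fin: "finite ?R" by (rule finite_row_region) simp
  have tile: "e = {(True, a, Suc b), (False, a, b)}"
    if "e \<in> model_tiles" "(False, a, b) \<in> e" "e \<subseteq> ?R" for e a
  proof -
    have "(True, a, b) \<notin> ?R" "(True, Suc a, b) \<notin> ?R" by (simp_all add: row_region_True_iff)
    then show ?thesis
      using model_tile_False_iff[THEN iffD1, OF conjI, OF that(1,2)] that(3) by (elim disjE) simp_all
  qed
  show ?thesis
  proof (cases "exit_level (Suc b) \<and> 0 \<notin> Y")
    case True
    then obtain p where p: "p \<in> P" "Suc b = x + p - 1" by (auto simp: exit_level_def)
    moreover have "1 \<le> p" "p \<le> n" using p P by auto
    ultimately have "x \<le> Suc (0 + b)" "Suc (0 + b) < n + x" by linarith+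
    then have "(False, 0, b) \<in> ?R" using True by (simp add: row_region_False_iff)
    moreover have "\<not> e \<subseteq> ?R" if "e \<in> model_tiles" "(False, 0, b) \<in> e" for e
    proof
      assume sub: "e \<subseteq> ?R"
      have "(True, 0, Suc b) \<in> ?R" using sub unfolding tile[OF that sub] by simp
      then show False using True by (simp add: row_region_True_iff)
    qed
    ultimately have "card (tile_partitions model_tiles ?R) = 0"
      by (intro card_tile_partitions_isolated[OF fin])
    then show ?thesis using True by simp
  next
    case False
    let ?Z = "{a. x \<le> Suc (a + b) \<and> Suc (a + b) < n + x} - Y"
    define F where "F = (\<lambda>a. {(True, a, Suc b), (False, a, b)}) ` ?Z"
    have "finite ?Z" by (rule finite_subset[of _ "{..n + x}"]) auto
    then have "card (tile_partitions model_tiles ?R) = card (tile_partitions model_tiles (?R - \<Union>F))"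
    proof (intro card_tile_partitions_forced fin)
      show "disjoint F" by (auto simp: F_def disjoint_def)
      show "\<Union>F \<subseteq> ?R"
        using False by (auto simp: F_def row_region_True_iff row_region_False_iff)
      show "F \<subseteq> model_tiles" by (auto simp: F_def model_tiles_def)
      show "\<exists>s\<in>f. \<forall>e\<in>model_tiles. s \<in> e \<longrightarrow> e \<subseteq> ?R \<longrightarrow> e = f" if "f \<in> F" for f
        using that tile unfolding F_def by blast
    qed (auto simp: F_def)
    also have "?R - \<Union>F = level_region (Suc b) Y"
      unfolding level_region_def
    proof (rule mcell_set_eqI)
      fix a b'
      show "(True, a, b') \<in> ?R - \<Union>F \<longleftrightarrow>
          (True, a, b') \<in> row_region (Suc b) (Y - (if exit_level (Suc b) then {0} else {})) {}"
        using Y by (cases "b' = Suc b") (auto simp: F_def row_region_True_iff)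
      show "(False, a, b') \<in> ?R - \<Union>F \<longleftrightarrow>
          (False, a, b') \<in> row_region (Suc b) (Y - (if exit_level (Suc b) then {0} else {})) {}"
        by (auto simp: F_def row_region_False_iff)
    qed
    finally show ?thesis unfolding if_not_P[OF False] .
  qed
qed

text \<open>The two summands are the two moves of the path at \<open>a\<close>: staying pairs
  \<open>(True, a, b)\<close> with \<open>(False, a, b)\<close>, moving left with
  \<open>(False, a - 1, b)\<close>. The third neighbour lies in row \<open>b - 1\<close>, outside
  the region.\<close>

lemma card_row_region_step:
  assumes a: "x \<le> a + b" "a + b < n + x" "a \<notin> X" "finite X" "a \<notin> Y"
  shows "card (tile_partitions model_tiles (row_region b (insert a X) Y))
    = (if Suc (a + b) < n + x then card (tile_partitions model_tiles (row_region b X (insert a Y))) else 0)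
      + (if a > 0 \<and> a - 1 \<notin> Y then card (tile_partitions model_tiles (row_region b X (insert (a - 1) Y))) else 0)"
proof -
  let ?R = "row_region b (insert a X) Y"
  let ?N = "\<lambda>e. card (tile_partitions model_tiles (?R - e))"
  let ?e = "{(True, a, b), (False, a, b)}" and ?f = "{(True, a, b), (False, a - 1, b)}"
  define e f where "e = ?e" and "f = ?f"
  let ?E = "(if Suc (a + b) < n + x then {e} else {}) \<union> (if a > 0 \<and> a - 1 \<notin> Y then {f} else {})"
  have sub: "e \<subseteq> ?R \<longleftrightarrow> Suc (a + b) < n + x" "a > 0 \<Longrightarrow> f \<subseteq> ?R \<longleftrightarrow> a - 1 \<notin> Y"
    "b > 0 \<Longrightarrow> \<not> {(True, a, b), (False, a, b - 1)} \<subseteq> ?R"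
    using a by (auto simp: e_def f_def row_region_True_iff row_region_False_iff)
  have "g \<in> model_tiles \<and> (True, a, b) \<in> g \<and> g \<subseteq> ?R \<longleftrightarrow> g \<in> ?E" for g
  proof -
    have "g \<in> model_tiles \<and> (True, a, b) \<in> g \<and> g \<subseteq> ?R \<longleftrightarrow>
        (g = e \<or> a > 0 \<and> g = f \<or> b > 0 \<and> g = {(True, a, b), (False, a, b - 1)}) \<and> g \<subseteq> ?R"
      unfolding e_def f_def using model_tile_True_iff[of g a b] by argo
    also have "\<dots> \<longleftrightarrow> g = e \<and> Suc (a + b) < n + x \<or> a > 0 \<and> g = f \<and> a - 1 \<notin> Y"
      using sub by metis
    also have "\<dots> \<longleftrightarrow> g \<in> ?E" by auto
    finally show ?thesis .
  qed
  then have "{g. g \<in> model_tiles \<and> (True, a, b) \<in> g \<and> g \<subseteq> ?R} = ?E"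
    by (simp only: Collect_mem_eq)
  moreover have "(True, a, b) \<in> ?R" by (simp add: row_region_True_iff)
  moreover have "finite ?R" using a by (simp add: finite_row_region)
  ultimately have "card (tile_partitions model_tiles ?R) = (\<Sum>e\<in>?E. ?N e)"
    by (simp only: card_tile_partitions_peel)
  also have "\<dots> = (if Suc (a + b) < n + x then ?N ?e else 0) + (if a > 0 \<and> a - 1 \<notin> Y then ?N ?f else 0)"
  proof -
    have "e \<noteq> f" if "a > 0" using that by (auto simp: e_def f_def doubleton_eq_iff)
    then show ?thesis unfolding e_def[symmetric] f_def[symmetric] by auto
  qed
  also have "?R - ?e = row_region b X (insert a Y)"
    by (rule mcell_set_eqI) (use a in \<open>auto simp: row_region_True_iff row_region_False_iff\<close>)
  also have "?R - ?f = row_region b X (insert (a - 1) Y)"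
    by (rule mcell_set_eqI) (use a in \<open>auto simp: row_region_True_iff row_region_False_iff\<close>)
  finally show ?thesis .
qed

text \<open>One row of the region, processed from left to right: \<open>ys\<close> are columns
  already reached for the next row, \<open>xs\<close> those still to move. Region and determinant
  split in the same way. Where a move is impossible the determinant vanishes too, by a repeated row
  if \<open>a - 1\<close> is taken and by a zero row if staying leaves the region. New positions are
  appended behind \<open>ys\<close>, so no row is ever permuted.\<close>

lemma card_row_region:
  assumes IH: "\<And>Y. Y \<subseteq> {a. x \<le> Suc (a + b) \<and> Suc (a + b) < n + x} \<Longrightarrow> (exit_level (Suc b) \<Longrightarrow> 0 \<in> Y) \<Longrightarrow>
      real (card (tile_partitions model_tiles (level_region (Suc b) Y)))
        = ldet (exits (Suc b)) (map (path_row (Suc b)) (sorted_list_of_set Y))"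
    and "sorted_wrt (<) (ys @ xs)"
    and "set ys \<subseteq> {a. x \<le> Suc (a + b) \<and> Suc (a + b) < n + x}"
    and "set xs \<subseteq> {a. x \<le> a + b \<and> a + b < n + x}"
  shows "real (card (tile_partitions model_tiles (row_region b (set xs) (set ys))))
    = ldet (exits (Suc b)) (map (path_row (Suc b)) ys @ map (path_row b) xs)"
  using assms(2-4)
proof (induction xs arbitrary: ys)
  case Nil
  show ?case
  proof (cases "exit_level (Suc b) \<and> 0 \<notin> set ys")
    case True
    then obtain p where p: "p \<in> P" "Suc b = x + p - 1" by (auto simp: exit_level_def)
    \<comment> \<open>A dent in the next row can be met only by a path in column 0, since the
      entries \<open>0 choose y\<close> vanish for \<open>y > 0\<close>.\<close>
    have "ldet (exits (Suc b)) (map (path_row (Suc b)) ys) = 0"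
    proof (rule ldet_column_zero[of p])
      show "p \<in> set (exits (Suc b))" using p by simp
      fix r assume "r \<in> set (map (path_row (Suc b)) ys)"
      then obtain y where y: "y \<in> set ys" "r = path_row (Suc b) y" by auto
      then have "y > 0" using True by (metis neq0_conv)
      then show "r p = 0" using y p by (simp add: path_row_def)
    qed
    then show ?thesis using True card_row_region_finished[OF Nil(2)] by simp
  next
    case False
    have "sorted_list_of_set (set ys) = ys"
      using Nil(1) by (simp add: strict_sorted_iff sorted_list_of_set.idem_if_sorted_distinct)
    then show ?thesis using False card_row_region_finished[OF Nil(2)] IH[OF Nil(2)] by auto
  qed
next
  case (Cons a xs)
  let ?D = "\<lambda>ys. ldet (exits (Suc b)) (map (path_row (Suc b)) ys @ map (path_row b) xs)"
  let ?M = "\<lambda>Y. real (card (tile_partitions model_tiles (row_region b (set xs) Y)))"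
  have lt: "\<And>y. y \<in> set ys \<Longrightarrow> y < a" "\<And>z. z \<in> set xs \<Longrightarrow> a < z"
    "sorted_wrt (<) ys" "sorted_wrt (<) xs" "\<And>y z. y \<in> set ys \<Longrightarrow> z \<in> set xs \<Longrightarrow> y < z"
    using Cons.prems(1) by (auto simp: sorted_wrt_append)
  have a: "x \<le> a + b" "a + b < n + x" "a \<notin> set xs" "finite (set xs)" "a \<notin> set ys"
    using Cons.prems(3) lt by auto
  have "ldet (exits (Suc b)) (map (path_row (Suc b)) ys @ map (path_row b) (a # xs))
    = ?D (ys @ [a]) + (if a > 0 then ?D (ys @ [a - 1]) else 0)"
  proof (cases "a > 0")
    case True
    then show ?thesis using ldet_path_row_step[OF True, of b "map (path_row (Suc b)) ys" "map (path_row b) xs"]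
      by simp
  next
    case False
    then show ?thesis
      using path_row_Suc[of _ b a] by (auto intro!: ldet_row_cong)
  qed
  also have "?D (ys @ [a]) = (if Suc (a + b) < n + x then ?M (insert a (set ys)) else 0)"
  proof (cases "Suc (a + b) < n + x")
    case True
    have "?M (set (ys @ [a])) = ?D (ys @ [a])"
      using Cons.prems lt True a by (intro Cons.IH) (auto simp: sorted_wrt_append)
    then show ?thesis using True by simp
  next
    case False
    \<comment> \<open>Here \<open>a + b + 1 = n + x\<close> while \<open>p \<le> n\<close>, so fewer
      moves remain than the \<open>a\<close> steps to the left that are needed.\<close>
    have "path_row (Suc b) a p = 0" if "p \<in> set (exits (Suc b))" for p
    proof -
      have "p \<le> n" "Suc b \<le> x + p - 1" using that P by auto
      then have "x + p - 1 - Suc b < a" using False a by linarith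
      then show ?thesis by (simp add: path_row_def binomial_eq_0)
    qed
    then show ?thesis using False ldet_row_zero[of "exits (Suc b)" "path_row (Suc b) a"] by simp
  qed
  also have "(if a > 0 then ?D (ys @ [a - 1]) else 0)
    = (if a > 0 \<and> a - 1 \<notin> set ys then ?M (insert (a - 1) (set ys)) else 0)"
  proof (cases "a > 0")
    case True
    show ?thesis
    proof (cases "a - 1 \<in> set ys")
      case in_ys: True
      then obtain us vs where ys: "ys = us @ (a - 1) # vs" by (meson split_list)
      \<comment> \<open>All of \<open>ys\<close> is below \<open>a\<close>, so \<open>a - 1\<close>
        must be its last entry; the appended row then repeats its neighbour.\<close>
      have "vs = []"
      proof (rule ccontr)
        assume "vs \<noteq> []"
        then have "hd vs \<in> set ys" "a - 1 < hd vs" using lt(3) ys by (auto simp: sorted_wrt_append)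
        then show False using lt(1)[of "hd vs"] by simp
      qed
      then have "?D (ys @ [a - 1]) = 0" using ys ldet_adjacent_rows_equal by simp
      then show ?thesis using in_ys by simp
    next
      case False
      have lt': "y < a - 1" if "y \<in> set ys" for y
      proof -
        have "y < a" "y \<noteq> a - 1" using lt(1) that False by auto
        then show ?thesis by simp
      qed
      have "?M (set (ys @ [a - 1])) = ?D (ys @ [a - 1])"
        using Cons.prems lt lt' True a by (intro Cons.IH) (auto simp: sorted_wrt_append intro: less_trans)
      then show ?thesis using True False by simp
    qed
  qed simp
  finally show ?case using card_row_region_step[OF a] by simp
qed

text \<open>Induction downwards on the row, starting from row \<open>n + x\<close>, which contains
  no triangles and is beyond all dents.\<close>

lemma card_level_region:
  assumes "b \<le> n + x" and "Y \<subseteq> {a. x \<le> a + b \<and> a + b < n + x}" and "exit_level b \<Longrightarrow> 0 \<in> Y"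
  shows "real (card (tile_partitions model_tiles (level_region b Y)))
    = ldet (exits b) (map (path_row b) (sorted_list_of_set Y))"
  using assms
proof (induction b arbitrary: Y rule: inc_induct)
  case base
  have Y: "Y = {}" using base by auto
  have "row_region (n + x) {} {} = {}"
    by (rule mcell_set_eqI) (auto simp: row_region_True_iff row_region_False_iff)
  moreover have "\<not> exit_level (n + x)" using base(2) Y by auto
  moreover have "exits (n + x) = []"
  proof -
    have empty: "{p \<in> P. n + x \<le> x + p - 1} = {}" using P by fastforce
    show ?thesis unfolding exits_def empty by simp
  qed
  ultimately show ?case by (simp add: level_region_def Y)
next
  case (step b)
  have fin: "finite Y" using step.prems(1) by (rule finite_subset) (rule finite_subset[of _ "{..n + x}"], auto)
  let ?X = "Y - (if exit_level b then {0} else {})"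
  have "real (card (tile_partitions model_tiles (row_region b (set (sorted_list_of_set ?X)) (set []))))
    = ldet (exits (Suc b)) (map (path_row (Suc b)) [] @ map (path_row b) (sorted_list_of_set ?X))"
  proof (rule card_row_region)
    fix Y assume "Y \<subseteq> {a. x \<le> Suc (a + b) \<and> Suc (a + b) < n + x}" "exit_level (Suc b) \<Longrightarrow> 0 \<in> Y"
    then show "real (card (tile_partitions model_tiles (level_region (Suc b) Y)))
        = ldet (exits (Suc b)) (map (path_row (Suc b)) (sorted_list_of_set Y))"
      by (intro step.IH) auto
  qed (use fin step.prems in auto)
  then have "real (card (tile_partitions model_tiles (level_region b Y)))
    = ldet (exits (Suc b)) (map (path_row b) (sorted_list_of_set ?X))"
    using fin by (simp add: level_region_def)
  also have "\<dots> = ldet (exits b) (map (path_row b) (sorted_list_of_set Y))"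
  proof (cases "exit_level b")
    case True
    then obtain p where p: "p \<in> P" "b = x + p - 1" by (auto simp: exit_level_def)
    have "q \<in> {q \<in> P. b \<le> x + q - 1} \<longleftrightarrow> q \<in> insert p {q \<in> P. Suc b \<le> x + q - 1}" for q
    proof (cases "q \<in> P")
      case True
      then have "1 \<le> q" "1 \<le> p" using P p by auto
      then show ?thesis using True p by auto
    qed (use p in auto)
    then have "{q \<in> P. b \<le> x + q - 1} = insert p {q \<in> P. Suc b \<le> x + q - 1}" by (rule set_eqI)
    moreover have "\<forall>q\<in>{q \<in> P. Suc b \<le> x + q - 1}. p < q" using p P by auto
    ultimately have ex: "exits b = p # exits (Suc b)"
      unfolding exits_def using finite_exits[of "Suc b"]
      by (intro sorted_list_of_set_eqI) simp_all
    have Y: "sorted_list_of_set Y = 0 # sorted_list_of_set ?X"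
      using step.prems(2)[OF True] True fin
      by (intro sorted_list_of_set_eqI) auto
    \<comment> \<open>The dent in row \<open>b\<close> is the smallest remaining one, hence the
      first column, with entries \<open>0 choose a\<close>. The path entering at column 0 ends
      there, and its row and this column split off with value 1.\<close>
    show ?thesis unfolding ex Y list.map
      using p True fin by (intro ldet_unit_column[symmetric]) (auto simp: path_row_def)
  next
    case False
    have "{q \<in> P. b \<le> x + q - 1} = {q \<in> P. Suc b \<le> x + q - 1}" using False
      by (auto simp: exit_level_def not_less_eq_eq[symmetric] le_less)
    then show ?thesis using False by (simp add: exits_def)
  qed
  finally show ?case .
qed

text \<open>The paths start at the undented cells of the side \<open>b = 0\<close>. If
  \<open>x = 0\<close> and 1 is in \<open>P\<close>, the corner cell carries a path that ends where
  it starts, so it has to be one of the starting points and may not be in \<open>Q\<close>.\<close>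

lemma card_dented_trapezoid:
  assumes Q: "Q \<subseteq> {1..n}" and "x = 0 \<Longrightarrow> 1 \<in> P \<Longrightarrow> 1 \<notin> Q"
  shows "real (card (tile_partitions model_tiles (dented_trapezoid n x P Q))) = binom_minor n x P Q"
proof -
  let ?Y = "{x..<n + x} - (\<lambda>k. x + k - 1) ` Q"
  have ex0: "exit_level 0 \<longleftrightarrow> x = 0 \<and> 1 \<in> P"
  proof
    assume "exit_level 0"
    then obtain p where "p \<in> P" "0 = x + p - 1" by (auto simp: exit_level_def)
    moreover from this have "p \<ge> 1" using P by auto
    ultimately have "x = 0" "p = 1" by linarith+
    then show "x = 0 \<and> 1 \<in> P" using \<open>p \<in> P\<close> by simp
  next
    assume "x = 0 \<and> 1 \<in> P"
    then show "exit_level 0" unfolding exit_level_def by (intro bexI[of _ 1]) simp_all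
  qed
  have "dented_trapezoid n x P Q = level_region 0 ?Y"
    unfolding level_region_def
  proof (rule mcell_set_eqI)
    fix a b
    have "(True, a, b) \<in> dented_trapezoid n x P Q \<longleftrightarrow> x \<le> a + b \<and> a + b < n + x
        \<and> \<not> (a = 0 \<and> exit_level b) \<and> \<not> (b = 0 \<and> a \<in> (\<lambda>k. x + k - 1) ` Q)"
      by (auto simp: dented_trapezoid_def trapezoid_def exit_level_def image_iff)
    then show "(True, a, b) \<in> dented_trapezoid n x P Q \<longleftrightarrow>
        (True, a, b) \<in> row_region 0 (?Y - (if exit_level 0 then {0} else {})) {}"
      unfolding row_region_True_iff by (cases b) auto
    show "(False, a, b) \<in> dented_trapezoid n x P Q \<longleftrightarrow>
        (False, a, b) \<in> row_region 0 (?Y - (if exit_level 0 then {0} else {})) {}"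
      by (auto simp: row_region_False_iff dented_trapezoid_def trapezoid_def)
  qed
  moreover have "real (card (tile_partitions model_tiles (level_region 0 ?Y)))
    = ldet (exits 0) (map (path_row 0) (sorted_list_of_set ?Y))"
  proof (rule card_level_region)
    show "0 \<in> ?Y" if "exit_level 0"
      using assms that P Q unfolding ex0 by force
  qed auto
  moreover have "sorted_list_of_set ?Y = map (\<lambda>i. x + i - 1) (sorted_list_of_set ({1..n} - Q))"
  proof -
    have "?Y = (\<lambda>i. x + i - 1) ` ({1..n} - Q)"
    proof (intro equalityI subsetI)
      fix a assume "a \<in> ?Y"
      then have "a = x + (a - x + 1) - 1" "a - x + 1 \<in> {1..n} - Q" by force+
      then show "a \<in> (\<lambda>i. x + i - 1) ` ({1..n} - Q)" by blast
    next
      fix a assume "a \<in> (\<lambda>i. x + i - 1) ` ({1..n} - Q)"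
      then obtain i where i: "a = x + i - 1" "i \<in> {1..n} - Q" by blast
      have "x + i - 1 \<noteq> x + k - 1" if "k \<in> Q" for k
      proof -
        have "1 \<le> k" "k \<noteq> i" "1 \<le> i" using that Q i by auto
        then show ?thesis by linarith
      qed
      then show "a \<in> ?Y" using i by auto
    qed
    moreover have "sorted_wrt (<) (map (\<lambda>i. x + i - 1) (sorted_list_of_set ({1..n} - Q)))"
      unfolding sorted_wrt_map
      by (rule sorted_wrt_mono_rel[OF _ strict_sorted_list_of_set]) (auto simp: diff_less_mono)
    ultimately show ?thesis
      by (intro sorted_list_of_set_eqI) simp_all
  qed
  moreover have "exits 0 = sorted_list_of_set P" by (simp add: exits_def)
  ultimately show ?thesis
    by (simp add: binom_minor_def path_row_def comp_def)
qed

end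

subsection \<open>Cutting the snowflake into six sectors\<close>

text \<open>
  Lattice points have barycentric coordinates \<open>(\<alpha>, \<beta>, \<gamma>)\<close> of sum \<open>x\<close> with respect to the central
  triangle. A unit triangle is represented by the integer parts \<open>(a, b, c)\<close> of the coordinates of
  its interior points: \<open>a + b + c\<close> is \<open>x - 1\<close> if it points up and \<open>x - 2\<close> if it points down, and
  crossing an edge changes a single coordinate by one. The six sectors are given by the signs.
\<close>

type_synonym cell = "int \<times> int \<times> int"

definition cell_adj :: "cell \<Rightarrow> cell \<Rightarrow> bool" where
  "cell_adj = (\<lambda>(a, b, c) (a', b', c').
     \<bar>a' - a\<bar> = 1 \<and> b' = b \<and> c' = c \<or> a' = a \<and> \<bar>b' - b\<bar> = 1 \<and> c' = c \<or> a' = a \<and> b' = b \<and> \<bar>c' - c\<bar> = 1)"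

text \<open>Model tiles, cell tiles and lozenges all have this form, so that changing coordinates
  only requires comparing adjacency.\<close>

definition pair_tiles :: "('a \<Rightarrow> 'a \<Rightarrow> bool) \<Rightarrow> 'a set set" where
  "pair_tiles adj = {{s, t} | s t. adj s t}"

lemma pair_tiles_image_iff:
  assumes "inj_on f R" "e \<subseteq> R" "\<And>s t. s \<in> R \<Longrightarrow> t \<in> R \<Longrightarrow> adj' (f s) (f t) \<longleftrightarrow> adj s t"
  shows "e \<in> pair_tiles adj \<longleftrightarrow> f ` e \<in> pair_tiles adj'"
proof
  assume "e \<in> pair_tiles adj"
  then obtain s t where e: "e = {s, t}" "adj s t" by (auto simp: pair_tiles_def)
  then have "adj' (f s) (f t)" using assms by auto
  moreover have "f ` e = {f s, f t}" using e by simp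
  ultimately show "f ` e \<in> pair_tiles adj'" by (auto simp: pair_tiles_def)
next
  assume "f ` e \<in> pair_tiles adj'"
  then obtain p q where pq: "f ` e = {p, q}" "adj' p q" by (auto simp: pair_tiles_def)
  obtain s t where st: "s \<in> e" "t \<in> e" "p = f s" "q = f t" using pq(1) by (metis imageE insertCI)
  have "f ` e = f ` {s, t}" using pq st by simp
  then have "e = {s, t}" using assms(1,2) st by (subst (asm) inj_on_image_eq_iff[of f R]) auto
  moreover have "adj s t" using assms(2) assms(3)[of s t] pq st by auto
  ultimately show "e \<in> pair_tiles adj" by (auto simp: pair_tiles_def)
qed

definition model_adj :: "mcell \<Rightarrow> mcell \<Rightarrow> bool" where
  "model_adj = (\<lambda>(u, a, b) (u', a', b'). u \<noteq> u' \<and>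
     (if u then (a = a' \<or> a = Suc a') \<and> b = b' \<or> a = a' \<and> b = Suc b'
      else (a' = a \<or> a' = Suc a) \<and> b = b' \<or> a = a' \<and> b' = Suc b))"

lemma model_tiles_eq: "model_tiles = pair_tiles model_adj"
proof (intro equalityI subsetI)
  fix e assume "e \<in> model_tiles"
  then show "e \<in> pair_tiles model_adj"
    unfolding model_tiles_def pair_tiles_def Un_iff mem_Collect_eq
    by (elim disjE exE conjE) (rule exI, rule exI, rule conjI, assumption, simp add: model_adj_def)+
next
  fix e assume "e \<in> pair_tiles model_adj"
  then obtain s t where e: "e = {s, t}" "model_adj s t" by (auto simp: pair_tiles_def)
  obtain u a b u' a' b' where st: "s = (u, a, b)" "t = (u', a', b')" by (metis prod_cases3)
  show "e \<in> model_tiles"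
  proof (cases u)
    case True
    then show ?thesis using e(2) unfolding st e(1)
      by (auto simp: model_adj_def intro: model_tiles_intros)
  next
    case False
    then show ?thesis using e(2) unfolding st e(1) insert_commute[of "(u, a, b)"]
      by (auto simp: model_adj_def intro: model_tiles_intros)
  qed
qed

text \<open>A rotation by 120 degrees about the centre, as it acts on barycentric
  coordinates.\<close>

definition turn :: "cell \<Rightarrow> cell" where
  "turn = (\<lambda>(a, b, c). (b, c, a))"

text \<open>The size of the cut-off corner: odd sectors are triangles, even ones trapezoids.\<close>

definition trunc :: "nat \<Rightarrow> nat \<Rightarrow> nat" where
  "trunc x i = (if odd i then 0 else x)"

text \<open>Places the model in sector 1, where the first and third coordinates are negative. The
  \<open>True\<close> cells, which can carry dents, become down-pointing here, with coordinate sum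
  \<open>x - 2\<close>; in \<open>emb_even\<close>, made for sector 2, they point up. The other
  sectors arise by turning these two.\<close>

definition emb_odd :: "nat \<Rightarrow> mcell \<Rightarrow> cell" where
  "emb_odd x = (\<lambda>(u, a, b). (- 1 - int b, int x + int a + int b + (if u then 0 else 1), - 1 - int a))"

definition emb_even :: "nat \<Rightarrow> mcell \<Rightarrow> cell" where
  "emb_even x = (\<lambda>(u, a, b). (int a, int b, int x - (if u then 1 else 2) - int a - int b))"

definition emb :: "nat \<Rightarrow> nat \<Rightarrow> mcell \<Rightarrow> cell" where
  "emb x i s = (let p = (if odd i then emb_odd x s else emb_even x s)
     in if i \<le> 2 then p else if i \<le> 4 then turn p else turn (turn p))"

definition next_sector :: "nat \<Rightarrow> nat" where
  "next_sector i = (if i = 6 then 1 else Suc i)"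

definition prev_sector :: "nat \<Rightarrow> nat" where
  "prev_sector i = (if i = 1 then 6 else i - 1)"

definition turn_sector :: "nat \<Rightarrow> nat" where
  "turn_sector i = next_sector (next_sector i)"

text \<open>The last condition removes the central triangle.\<close>

definition hex_cells :: "nat \<Rightarrow> nat \<Rightarrow> cell set" where
  "hex_cells n x = {(a, b, c). (a + b + c = int x - 1 \<or> a + b + c = int x - 2) \<and>
     - int n \<le> a \<and> a < int n + int x \<and> - int n \<le> b \<and> b < int n + int x \<and> - int n \<le> c \<and> c < int n + int x \<and>
     \<not> (0 \<le> a \<and> 0 \<le> b \<and> 0 \<le> c)}"

text \<open>Total, though meant for \<open>hex_cells\<close> only: a central cell would be assigned
  to sector 2.\<close>

definition sector_of :: "cell \<Rightarrow> nat" where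
  "sector_of = (\<lambda>(a, b, c). if 0 \<le> a then (if 0 \<le> b then 2 else if 0 \<le> c then 4 else 3)
     else if 0 \<le> b then (if 0 \<le> c then 6 else 1) else 5)"

text \<open>The cell of sector \<open>i\<close> on the unit segment \<open>k\<close> of its first
  bounding segment; \<open>bcell\<close> is its counterpart on the second one.\<close>

definition acell :: "nat \<Rightarrow> nat \<Rightarrow> nat \<Rightarrow> cell" where
  "acell x i k = emb x i (True, 0, trunc x i + k - 1)"

definition bcell :: "nat \<Rightarrow> nat \<Rightarrow> nat \<Rightarrow> cell" where
  "bcell x i k = emb x i (True, trunc x i + k - 1, 0)"

lemma one_to_six: "{1..6::nat} = {1, 2, 3, 4, 5, 6}"
  by auto

lemma sector_cases:
  assumes "i \<in> {1..6::nat}"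
  obtains "i = 1" | "i = 2" | "i = 3" | "i = 4" | "i = 5" | "i = 6"
  using assms unfolding one_to_six by blast

lemma emb_simps:
  "emb x 1 s = emb_odd x s" "emb x 2 s = emb_even x s" "emb x 3 s = turn (emb_odd x s)"
  "emb x 4 s = turn (emb_even x s)" "emb x 5 s = turn (turn (emb_odd x s))"
  "emb x 6 s = turn (turn (emb_even x s))"
  by (simp_all add: emb_def)

lemma next_sector_simps:
  "next_sector 1 = 2" "next_sector 2 = 3" "next_sector 3 = 4" "next_sector 4 = 5" "next_sector 5 = 6"
  "next_sector 6 = 1"
  by (simp_all add: next_sector_def)

lemma prev_sector_simps:
  "prev_sector 1 = 6" "prev_sector 2 = 1" "prev_sector 3 = 2" "prev_sector 4 = 3" "prev_sector 5 = 4"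
  "prev_sector 6 = 5"
  by (simp_all add: prev_sector_def)

lemma turn_turn_turn [simp]: "turn (turn (turn p)) = p"
  by (simp add: turn_def split: prod.splits)

lemma inj_turn: "inj turn"
  by (metis injI turn_turn_turn)

lemma cell_adj_turn: "cell_adj (turn p) (turn q) \<longleftrightarrow> cell_adj p q"
  by (auto simp: cell_adj_def turn_def split: prod.splits)

lemma inj_emb: "inj (emb x i)"
proof -
  have "inj (emb_odd x)" "inj (emb_even x)"
    by (auto simp: inj_def emb_odd_def emb_even_def split: if_splits)
  moreover have "turn p = turn q \<longleftrightarrow> p = q" for p q
    by (rule inj_eq[OF inj_turn])
  ultimately show ?thesis
    by (simp add: emb_def Let_def inj_def)
qed

lemma cell_adj_emb: "cell_adj (emb x i s) (emb x i t) \<longleftrightarrow> model_adj s t"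
proof -
  have "cell_adj (emb_odd x s) (emb_odd x t) \<longleftrightarrow> model_adj s t"
    by (auto simp: cell_adj_def emb_odd_def model_adj_def split: prod.splits if_splits)
  moreover have "cell_adj (emb_even x s) (emb_even x t) \<longleftrightarrow> model_adj s t"
    by (auto simp: cell_adj_def emb_even_def model_adj_def split: prod.splits if_splits)
  ultimately show ?thesis by (simp add: emb_def Let_def cell_adj_turn)
qed

lemma turn_emb:
  assumes "i \<in> {1..6}"
  shows "turn (emb x i s) = emb x (turn_sector i) s"
  using assms by (cases rule: sector_cases) (simp_all add: turn_sector_def next_sector_simps emb_simps del: One_nat_def)

lemma emb_trapezoid:
  assumes "i \<in> {1..6}"
  shows "emb x i ` trapezoid n (trunc x i) = {p \<in> hex_cells n x. sector_of p = i}"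
proof -
  have odd: "emb_odd x ` trapezoid n 0 = {(a, b, c). (a + b + c = int x - 1 \<or> a + b + c = int x - 2)
      \<and> a < 0 \<and> c < 0 \<and> b < int n + int x}" (is "_ = ?O")
  proof (intro equalityI subsetI)
    fix p assume "p \<in> ?O"
    then obtain a b c where p: "p = (a, b, c)" "a + b + c = int x - 1 \<or> a + b + c = int x - 2"
      "a < 0" "c < 0" "b < int n + int x" by auto
    \<comment> \<open>The preimage is read off from the two negative coordinates; the coordinate sum
      tells the orientation.\<close>
    let ?s = "(a + b + c = int x - 2, nat (- 1 - c), nat (- 1 - a))"
    have "emb_odd x ?s = p" using p by (auto simp: emb_odd_def)
    moreover have "?s \<in> trapezoid n 0" using p by (auto simp: trapezoid_def)
    ultimately show "p \<in> emb_odd x ` trapezoid n 0" by (metis imageI)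
  qed (auto simp: emb_odd_def trapezoid_def)
  have even: "emb_even x ` trapezoid n x = {(a, b, c). (a + b + c = int x - 1 \<or> a + b + c = int x - 2)
      \<and> 0 \<le> a \<and> 0 \<le> b \<and> - int n \<le> c \<and> c < 0}" (is "_ = ?E")
  proof (intro equalityI subsetI)
    fix p assume "p \<in> ?E"
    then obtain a b c where p: "p = (a, b, c)" "a + b + c = int x - 1 \<or> a + b + c = int x - 2"
      "0 \<le> a" "0 \<le> b" "- int n \<le> c" "c < 0" by auto
    let ?s = "(a + b + c = int x - 1, nat a, nat b)"
    have "emb_even x ?s = p" using p by (auto simp: emb_even_def)
    moreover have "?s \<in> trapezoid n x" using p by (auto simp: trapezoid_def)
    ultimately show "p \<in> emb_even x ` trapezoid n x" by (metis imageI)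
  qed (auto simp: emb_even_def trapezoid_def)
  have turn_img: "turn ` S = {(a, b, c). (c, a, b) \<in> S}" for S
    by (force simp: turn_def image_iff split: prod.splits)
  have img: "emb x 1 ` S = emb_odd x ` S" "emb x 2 ` S = emb_even x ` S"
    "emb x 3 ` S = turn ` (emb_odd x ` S)" "emb x 4 ` S = turn ` (emb_even x ` S)"
    "emb x 5 ` S = turn ` (turn ` (emb_odd x ` S))" "emb x 6 ` S = turn ` (turn ` (emb_even x ` S))" for S
    using emb_simps(1-6)[of x] by (auto simp: image_iff)
  have tr: "trunc x 1 = 0" "trunc x 2 = x" "trunc x 3 = 0" "trunc x 4 = x" "trunc x 5 = 0" "trunc x 6 = x"
    by (simp_all add: trunc_def)
  have "(a, b, c) \<in> emb x i ` trapezoid n (trunc x i) \<longleftrightarrow>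
      (a, b, c) \<in> hex_cells n x \<and> sector_of (a, b, c) = i" for a b c
    using assms
    by (cases rule: sector_cases)
       (simp_all only: tr img odd even turn_img mem_Collect_eq prod.case hex_cells_def sector_of_def,
        (cases "0 \<le> a"; cases "0 \<le> b"; cases "0 \<le> c"; simp; linarith?)+)
  then show ?thesis by auto
qed

lemma acell_simps:
  assumes "k \<ge> 1"
  shows "acell x 1 k = (- int k, int x + int k - 1, - 1)"
    "acell x 2 k = (0, int x + int k - 1, - int k)"
    "acell x 3 k = (int x + int k - 1, - 1, - int k)"
    "acell x 4 k = (int x + int k - 1, - int k, 0)"
    "acell x 5 k = (- 1, - int k, int x + int k - 1)"
    "acell x 6 k = (- int k, 0, int x + int k - 1)"
  using assms by (simp_all only: acell_def emb_simps) (simp_all add: emb_odd_def emb_even_def turn_def trunc_def)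

lemma bcell_simps:
  assumes "k \<ge> 1"
  shows "bcell x 1 k = (- 1, int x + int k - 1, - int k)"
    "bcell x 2 k = (int x + int k - 1, 0, - int k)"
    "bcell x 3 k = (int x + int k - 1, - int k, - 1)"
    "bcell x 4 k = (0, - int k, int x + int k - 1)"
    "bcell x 5 k = (- int k, - 1, int x + int k - 1)"
    "bcell x 6 k = (- int k, int x + int k - 1, 0)"
  using assms by (simp_all only: bcell_def emb_simps) (simp_all add: emb_odd_def emb_even_def turn_def trunc_def)

text \<open>The lozenge crossing segment \<open>i\<close> at label \<open>k\<close>, with one half
  in each of the sectors that meet there.\<close>

definition gate :: "nat \<Rightarrow> nat \<times> nat \<Rightarrow> cell set" where
  "gate x = (\<lambda>(i, k). {acell x i k, bcell x (prev_sector i) k})"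

lemma cell_in_sector:
  assumes "i \<in> {1..6}" "k \<in> {1..n}"
  shows "acell x i k \<in> hex_cells n x" "sector_of (acell x i k) = i"
    "bcell x i k \<in> hex_cells n x" "sector_of (bcell x i k) = i"
proof -
  have k: "1 \<le> k" "k \<le> n" using assms(2) by auto
  have "acell x i k \<in> hex_cells n x \<and> sector_of (acell x i k) = i \<and>
      bcell x i k \<in> hex_cells n x \<and> sector_of (bcell x i k) = i"
    using assms(1)
    by (cases rule: sector_cases)
       (use k in \<open>simp_all only: acell_simps[OF k(1)] bcell_simps[OF k(1)],
         auto simp: hex_cells_def sector_of_def\<close>)
  then show "acell x i k \<in> hex_cells n x" "sector_of (acell x i k) = i"
    "bcell x i k \<in> hex_cells n x" "sector_of (bcell x i k) = i" by auto
qed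

lemma crossing_gate:
  assumes "p \<in> hex_cells n x" "q \<in> hex_cells n x" "cell_adj p q" "sector_of p \<noteq> sector_of q"
  shows "\<exists>i\<in>{1..6}. \<exists>k\<in>{1..n}. {p, q} = gate x (i, k)"
proof -
  \<comment> \<open>By symmetry in \<open>p\<close> and \<open>q\<close>, the coordinate that
    changes may be assumed to increase.\<close>
  have *: "\<exists>i\<in>{1..6}. \<exists>k\<in>{1..n}. {p, q} = gate x (i, k)"
    if p: "p = (a, b, c)" and q: "q = (a', b', c')"
      and pq: "p \<in> hex_cells n x" "q \<in> hex_cells n x" "sector_of p \<noteq> sector_of q"
      and adj: "a' = a + 1 \<and> b' = b \<and> c' = c \<or> a' = a \<and> b' = b + 1 \<and> c' = c \<or> a' = a \<and> b' = b \<and> c' = c + 1"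
    for p q a b c a' b' c'
  proof -
    have gate_eq: "i \<in> {1..6} \<Longrightarrow> k \<in> {1..n} \<Longrightarrow>
        p = acell x i k \<and> q = bcell x (prev_sector i) k \<or> q = acell x i k \<and> p = bcell x (prev_sector i) k \<Longrightarrow>
        \<exists>i\<in>{1..6}. \<exists>k\<in>{1..n}. {p, q} = gate x (i, k)" for i k
      by (intro bexI[of _ i] bexI[of _ k]) (auto simp: gate_def)
    from adj consider "a' = a + 1" "b' = b" "c' = c" | "a' = a" "b' = b + 1" "c' = c" | "a' = a" "b' = b" "c' = c + 1"
      by blast
    then show ?thesis
    proof cases
      case 1
      \<comment> \<open>Changing the sector requires a sign change. The signs of the other two
        coordinates then single out the segment, and the negative one of them is minus the label.
        The other two cases are alike.\<close>
      then have a: "a = -1" using pq(3) p q by (auto simp: sector_of_def split: if_splits)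
      show ?thesis
      proof (cases "b \<ge> 0")
        case True
        with pq p q 1 a have "c < 0" "- int n \<le> c" "b = int x - c - 1" by (auto simp: hex_cells_def)
        then show ?thesis using p q 1 a
          by (intro gate_eq[of 2 "nat (- c)"]) (auto simp: acell_simps bcell_simps prev_sector_simps simp del: One_nat_def)
      next
        case False
        with pq p q 1 a have "c \<ge> 0" "- int n \<le> b" "c = int x - b - 1" by (auto simp: hex_cells_def)
        then show ?thesis using p q 1 a False
          by (intro gate_eq[of 5 "nat (- b)"]) (auto simp: acell_simps bcell_simps prev_sector_simps simp del: One_nat_def)
      qed
    next
      case 2
      then have b: "b = -1" using pq(3) p q by (auto simp: sector_of_def split: if_splits)
      show ?thesis
      proof (cases "a \<ge> 0")
        case True
        with pq p q 2 b have "c < 0" "- int n \<le> c" "a = int x - c - 1" by (auto simp: hex_cells_def)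
        then show ?thesis using p q 2 b
          by (intro gate_eq[of 3 "nat (- c)"]) (auto simp: acell_simps bcell_simps prev_sector_simps simp del: One_nat_def)
      next
        case False
        with pq p q 2 b have "c \<ge> 0" "- int n \<le> a" "c = int x - a - 1" by (auto simp: hex_cells_def)
        then show ?thesis using p q 2 b False
          by (intro gate_eq[of 6 "nat (- a)"]) (auto simp: acell_simps bcell_simps prev_sector_simps simp del: One_nat_def)
      qed
    next
      case 3
      then have c: "c = -1" using pq p q by (auto simp: sector_of_def hex_cells_def split: if_splits)
      show ?thesis
      proof (cases "a \<ge> 0")
        case True
        with pq p q 3 c have "b < 0" "- int n \<le> b" "a = int x - b - 1" by (auto simp: hex_cells_def)
        then show ?thesis using p q 3 c
          by (intro gate_eq[of 4 "nat (- b)"]) (auto simp: acell_simps bcell_simps prev_sector_simps simp del: One_nat_def)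
      next
        case False
        with pq p q 3 c have "b \<ge> 0" "- int n \<le> a" "b = int x - a - 1" by (auto simp: hex_cells_def)
        then show ?thesis using p q 3 c False
          by (intro gate_eq[of 1 "nat (- a)"]) (auto simp: acell_simps bcell_simps prev_sector_simps simp del: One_nat_def)
      qed
    qed
  qed
  obtain a b c a' b' c' where pq: "p = (a, b, c)" "q = (a', b', c')" by (metis prod_cases3)
  then consider "a' = a + 1 \<and> b' = b \<and> c' = c \<or> a' = a \<and> b' = b + 1 \<and> c' = c \<or> a' = a \<and> b' = b \<and> c' = c + 1"
    | "a = a' + 1 \<and> b = b' \<and> c = c' \<or> a = a' \<and> b = b' + 1 \<and> c = c' \<or> a = a' \<and> b = b' \<and> c = c' + 1"
    using assms(3) by (auto simp: cell_adj_def abs_if split: if_splits)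
  then show ?thesis
  proof cases
    case 1
    then show ?thesis using *[OF pq assms(1,2,4)] by blast
  next
    case 2
    then show ?thesis using *[OF pq(2,1) assms(2,1) assms(4)[symmetric]] by (simp add: insert_commute)
  qed
qed

lemma sector_indices:
  assumes "i \<in> {1..6}"
  shows "next_sector i \<in> {1..6}" "prev_sector i \<in> {1..6}" "turn_sector i \<in> {1..6}"
    "prev_sector (next_sector i) = i" "next_sector (prev_sector i) = i"
    "next_sector i \<noteq> i" "prev_sector i \<noteq> i" "turn_sector i \<noteq> i"
    "prev_sector (prev_sector i) \<noteq> i"
    "turn_sector (turn_sector (turn_sector i)) = i" "turn_sector (turn_sector i) \<noteq> i"
    "prev_sector (turn_sector i) = turn_sector (prev_sector i)"
    "next_sector (turn_sector i) = turn_sector (next_sector i)"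
    "odd (turn_sector i) \<longleftrightarrow> odd i" "odd (next_sector i) \<longleftrightarrow> even i" "odd (prev_sector i) \<longleftrightarrow> even i"
  using assms by (auto simp: next_sector_def prev_sector_def turn_sector_def split: if_splits)

lemma acell_eq_iff: "1 \<le> k \<Longrightarrow> 1 \<le> k' \<Longrightarrow> acell x i k = acell x i k' \<longleftrightarrow> k = k'"
  unfolding acell_def inj_eq[OF inj_emb] by auto

lemma bcell_eq_iff: "1 \<le> k \<Longrightarrow> 1 \<le> k' \<Longrightarrow> bcell x i k = bcell x i k' \<longleftrightarrow> k = k'"
  unfolding bcell_def inj_eq[OF inj_emb] by auto

lemma acell_eq_bcell_iff:
  "1 \<le> k \<Longrightarrow> 1 \<le> k' \<Longrightarrow> acell x i k = bcell x i k' \<longleftrightarrow> trunc x i = 0 \<and> k = 1 \<and> k' = 1"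
  unfolding acell_def bcell_def inj_eq[OF inj_emb] by auto

lemma gate_in_pair_tiles:
  assumes "i \<in> {1..6}" "1 \<le> k"
  shows "gate x (i, k) \<in> pair_tiles cell_adj"
proof -
  have "cell_adj (acell x i k) (bcell x (prev_sector i) k)"
    using assms(1)
    by (cases rule: sector_cases)
       (simp_all only: prev_sector_simps acell_simps[OF assms(2)] bcell_simps[OF assms(2)],
        auto simp: cell_adj_def)
  then show ?thesis unfolding gate_def pair_tiles_def prod.case by blast
qed

section \<open>The snowflake as six sectors with holes\<close>

locale snowflake_cells =
  fixes n x :: nat and A B :: "nat \<Rightarrow> nat set"
  assumes A: "\<And>i. i \<in> {1..6} \<Longrightarrow> A i \<subseteq> {1..n}"
    and B: "\<And>i. i \<in> {1..6} \<Longrightarrow> B i \<subseteq> {1..n}"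
    and AB: "\<And>i. i \<in> {1..6} \<Longrightarrow> 1 \<notin> A i \<inter> B i"
begin

definition part :: "nat \<Rightarrow> cell set" where
  "part i = {p \<in> hex_cells n x. sector_of p = i} - acell x i ` A i - bcell x i ` B i"

definition gates :: "(nat \<times> nat) set" where
  "gates = {(i, k). i \<in> {1..6} \<and> k \<in> {1..n} \<and> k \<notin> A i \<and> k \<notin> B (prev_sector i)}"

text \<open>In an untruncated sector the label 1 on both sides denotes one corner cell, which can be
  taken only once, be it by a hole or by a crossing lozenge.\<close>

definition compatible :: "(nat \<times> nat) set \<Rightarrow> bool" where
  "compatible C \<longleftrightarrow> (\<forall>i\<in>{1..6}. trunc x i = 0 \<longrightarrow>
     \<not> (1 \<in> A i \<union> C `` {i} \<and> 1 \<in> B i \<union> C `` {next_sector i}))"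

lemma finite_gates: "finite gates"
  by (rule finite_subset[of _ "{1..6} \<times> {1..n}"]) (auto simp: gates_def)

text \<open>The second condition concerns the corner cell of an untruncated sector, which may be
  missing because of a hole on the other side.\<close>

lemma acell_in_part_iff:
  assumes "i \<in> {1..6}" "k \<in> {1..n}"
  shows "acell x i k \<in> part i \<longleftrightarrow> k \<notin> A i \<and> \<not> (trunc x i = 0 \<and> k = 1 \<and> 1 \<in> B i)"
proof -
  have "acell x i k \<in> acell x i ` A i \<longleftrightarrow> k \<in> A i"
    using A[OF assms(1)] assms(2) acell_eq_iff by (auto simp: image_iff)
  moreover have "acell x i k \<in> bcell x i ` B i \<longleftrightarrow> trunc x i = 0 \<and> k = 1 \<and> 1 \<in> B i"
  proof -
    have "acell x i k = bcell x i b \<longleftrightarrow> trunc x i = 0 \<and> k = 1 \<and> b = 1" if "b \<in> B i" for b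
      using B[OF assms(1)] that assms(2) by (intro acell_eq_bcell_iff) auto
    then show ?thesis by (auto simp: image_iff)
  qed
  ultimately show ?thesis using cell_in_sector[OF assms] by (simp add: part_def)
qed

lemma bcell_in_part_iff:
  assumes "i \<in> {1..6}" "k \<in> {1..n}"
  shows "bcell x i k \<in> part i \<longleftrightarrow> k \<notin> B i \<and> \<not> (trunc x i = 0 \<and> k = 1 \<and> 1 \<in> A i)"
proof -
  have "bcell x i k \<in> bcell x i ` B i \<longleftrightarrow> k \<in> B i"
    using B[OF assms(1)] assms(2) bcell_eq_iff by (auto simp: image_iff)
  moreover have "bcell x i k \<in> acell x i ` A i \<longleftrightarrow> trunc x i = 0 \<and> k = 1 \<and> 1 \<in> A i"
  proof -
    have "acell x i a = bcell x i k \<longleftrightarrow> trunc x i = 0 \<and> a = 1 \<and> k = 1" if "a \<in> A i" for a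
      using A[OF assms(1)] that assms(2) by (intro acell_eq_bcell_iff) auto
    then show ?thesis by (auto simp: image_iff dest: sym)
  qed
  ultimately show ?thesis using cell_in_sector[OF assms] by (auto simp: part_def)
qed

lemma sector_of_part: "p \<in> part i \<Longrightarrow> sector_of p = i"
  by (simp add: part_def)

lemma disjoint_parts: "disjoint_family_on part I"
  unfolding disjoint_family_on_def using sector_of_part by (metis Int_emptyI)

lemma in_parts_iff:
  assumes "p \<in> (\<Union>i\<in>{1..6}. part i)" "sector_of p = i"
  shows "p \<in> part i"
  using assms sector_of_part by (metis UN_E)

lemma gate_sectors:
  assumes "i \<in> {1..6}" "k \<in> {1..n}"
  shows "sector_of (acell x i k) = i" "sector_of (bcell x (prev_sector i) k) = prev_sector i"
  using cell_in_sector assms sector_indices(2) by auto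

lemma inj_on_gate: "inj_on (gate x) ({1..6} \<times> {1..n})"
proof (rule inj_onI, clarify)
  fix i k i' k' assume i: "i \<in> {1..6}" "i' \<in> {1..6}" and k: "k \<in> {1..n}" "k' \<in> {1..n}"
    and eq: "gate x (i, k) = gate x (i', k')"
  note s = gate_sectors[OF i(1) k(1)] gate_sectors[OF i(2) k(2)]
  have "acell x i k = acell x i' k' \<or>
      acell x i k = bcell x (prev_sector i') k' \<and> bcell x (prev_sector i) k = acell x i' k'"
    using eq unfolding gate_def by (auto simp: doubleton_eq_iff)
  then have "acell x i k = acell x i' k' \<and> i = i'"
  proof
    assume "acell x i k = bcell x (prev_sector i') k' \<and> bcell x (prev_sector i) k = acell x i' k'"
    then have "i = prev_sector i'" "i' = prev_sector i" using s by metis+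
    then show ?thesis using sector_indices(9)[OF i(1)] by metis
  qed (use s in metis)
  then show "i = i' \<and> k = k'" using acell_eq_iff[of k k' x i] k by auto
qed

lemma gate_eq_iff:
  assumes "c \<in> gates" "c' \<in> gates"
  shows "gate x c = gate x c' \<longleftrightarrow> c = c'"
  by (rule inj_on_eq_iff[OF inj_on_gate]) (use assms in \<open>auto simp: gates_def\<close>)

lemma crossing_set_gate:
  assumes E: "E \<in> crossing_sets (pair_tiles cell_adj) {1..6} part" and e: "e \<in> E"
  shows "\<exists>c\<in>gates. e = gate x c"
proof -
  from E e have e': "e \<in> pair_tiles cell_adj" "e \<subseteq> (\<Union>i\<in>{1..6}. part i)" "\<And>i. i \<in> {1..6} \<Longrightarrow> \<not> e \<subseteq> part i"
    by (auto simp: crossing_sets_def)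
  then obtain p q where pq: "e = {p, q}" "cell_adj p q" by (auto simp: pair_tiles_def)
  obtain i j where ij: "i \<in> {1..6}" "j \<in> {1..6}" "p \<in> part i" "q \<in> part j" using e'(2) pq(1) by auto
  then have "i \<noteq> j" using e'(3)[of i] pq(1) by auto
  then have "sector_of p \<noteq> sector_of q" using sector_of_part ij by auto
  moreover have "p \<in> hex_cells n x" "q \<in> hex_cells n x" using ij by (auto simp: part_def)
  ultimately obtain i k where ik: "i \<in> {1..6}" "k \<in> {1..n}" "e = gate x (i, k)"
    using crossing_gate pq by metis
  have "acell x i k \<in> part i" "bcell x (prev_sector i) k \<in> part (prev_sector i)"
    using e'(2) ik(3) gate_sectors[OF ik(1,2)] in_parts_iff by (auto simp: gate_def)
  then have "(i, k) \<in> gates"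
    using acell_in_part_iff[OF ik(1,2)] bcell_in_part_iff[OF sector_indices(2)[OF ik(1)] ik(2)] ik
    by (auto simp: gates_def)
  then show ?thesis using ik(3) by blast
qed

text \<open>Only gates cross between sectors. Two different gates can overlap only in the corner
  cell of an untruncated sector, and a gate can hit a hole of the segment on its other side only
  there; both are what compatibility forbids.\<close>

lemma crossing_sets_eq:
  "crossing_sets (pair_tiles cell_adj) {1..6} part = (`) (gate x) ` {C. C \<subseteq> gates \<and> compatible C}"
proof (intro equalityI subsetI)
  fix E assume E: "E \<in> crossing_sets (pair_tiles cell_adj) {1..6} part"
  define C where "C = {c \<in> gates. gate x c \<in> E}"
  have EC: "E = gate x ` C" using crossing_set_gate[OF E] unfolding C_def by fastforce
  have sub: "gate x c \<subseteq> (\<Union>i\<in>{1..6}. part i)" if "c \<in> C" for c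
    using E that unfolding C_def crossing_sets_def by blast
  have "compatible C" unfolding compatible_def
  proof (intro ballI impI notI, elim conjE)
    fix i assume i: "i \<in> {1..6}" and tr: "trunc x i = 0"
      and a: "1 \<in> A i \<union> C `` {i}" and b: "1 \<in> B i \<union> C `` {next_sector i}"
    have n: "1 \<in> {1..n}" using a A[OF i] by (auto simp: C_def gates_def)
    have acell: "1 \<notin> A i \<and> 1 \<notin> B i" if "(i, 1) \<in> C"
    proof -
      have "acell x i 1 \<in> part i"
        using sub[OF that] gate_sectors[OF i n] in_parts_iff by (auto simp: gate_def)
      then show ?thesis using acell_in_part_iff[OF i n] tr by auto
    qed
    have bcell: "1 \<notin> A i \<and> 1 \<notin> B i" if "(next_sector i, 1) \<in> C"
    proof -
      have "bcell x i 1 \<in> part i"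
        using sub[OF that] gate_sectors(2)[OF sector_indices(1)[OF i] n] in_parts_iff sector_indices(4)[OF i]
        by (auto simp: gate_def)
      then show ?thesis using bcell_in_part_iff[OF i n] tr by auto
    qed
    \<comment> \<open>Not both sides of the corner can be holes, by \<open>AB\<close>; and a gate
      may not use a corner that is a hole. So both uses of the corner come from gates, and these
      would overlap.\<close>
    have "(i, 1) \<in> C" "(next_sector i, 1) \<in> C"
      using a b acell bcell AB[OF i] by auto
    then have "gate x (i, 1) \<in> E" "gate x (next_sector i, 1) \<in> E" "(i, 1) \<in> gates" "(next_sector i, 1) \<in> gates"
      by (auto simp: C_def)
    moreover have "(i, 1) \<noteq> (next_sector i, 1)" using sector_indices(6)[OF i] by auto
    ultimately have "gate x (i, 1) \<inter> gate x (next_sector i, 1) = {}"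
      using disjointD[of E] E gate_eq_iff[of "(i, 1)" "(next_sector i, 1)"]
      unfolding crossing_sets_def by (metis (no_types, lifting) mem_Collect_eq)
    moreover have "acell x i 1 = bcell x i 1" using acell_eq_bcell_iff[of 1 1 x i] tr by simp
    ultimately show False using sector_indices(4)[OF i] by (auto simp: gate_def)
  qed
  moreover have "C \<subseteq> gates" by (auto simp: C_def)
  ultimately show "E \<in> (`) (gate x) ` {C. C \<subseteq> gates \<and> compatible C}" using EC by blast
next
  fix E assume "E \<in> (`) (gate x) ` {C. C \<subseteq> gates \<and> compatible C}"
  then obtain C where C: "C \<subseteq> gates" "compatible C" "E = gate x ` C" by blast
  have Cd: "i \<in> {1..6}" "k \<in> {1..n}" "k \<notin> A i" "k \<notin> B (prev_sector i)" if "(i, k) \<in> C" for i k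
    using C(1) that by (auto simp: gates_def)
  have comp: "\<not> (1 \<in> A i \<union> C `` {i} \<and> 1 \<in> B i \<union> C `` {next_sector i})" if "i \<in> {1..6}" "trunc x i = 0" for i
    using C(2) that by (auto simp: compatible_def)
  have mem: "acell x i k \<in> part i" "bcell x (prev_sector i) k \<in> part (prev_sector i)" if "(i, k) \<in> C" for i k
  proof -
    note d = Cd[OF that]
    show "acell x i k \<in> part i"
      using acell_in_part_iff[OF d(1,2)] comp[OF d(1)] d that by auto
    show "bcell x (prev_sector i) k \<in> part (prev_sector i)"
      using bcell_in_part_iff[OF sector_indices(2)[OF d(1)] d(2)] comp[OF sector_indices(2)[OF d(1)]] d that
        sector_indices(5)[OF d(1)] by auto
  qed
  have "E \<subseteq> pair_tiles cell_adj"
    using gate_in_pair_tiles Cd unfolding C(3) by (auto simp: image_subset_iff)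
  moreover have "disjoint E"
    unfolding disjoint_def C(3)
  proof (intro ballI impI, elim imageE)
    fix e f c c' assume ef: "e = gate x c" "c \<in> C" "f = gate x c'" "c' \<in> C" "e \<noteq> f"
    obtain i k i' k' where c: "c = (i, k)" "c' = (i', k')" by (metis prod.exhaust)
    note d = Cd[of i k] Cd[of i' k']
    have ik: "i \<in> {1..6}" "i' \<in> {1..6}" "k \<in> {1..n}" "k' \<in> {1..n}" using d ef c by auto
    note s = gate_sectors[OF ik(1,3)] gate_sectors[OF ik(2,4)]
    have ne: "\<not> (i = i' \<and> k = k')" using ef c by auto
    \<comment> \<open>A first half equals a second half only at a corner cell, which would then be
      used by the gates of both adjacent segments.\<close>
    have no: False if "acell x j m = bcell x (prev_sector j') m'" "(j, m) \<in> C" "(j', m') \<in> C" for j m j' m'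
    proof -
      note dd = Cd[OF that(2)] Cd[OF that(3)]
      have j: "j = prev_sector j'"
        using gate_sectors(1)[OF dd(1,2)] gate_sectors(2)[OF dd(5,6)] that(1) by simp
      then have "trunc x j = 0" "m = 1" "m' = 1"
        using acell_eq_bcell_iff[of m m' x j] that(1) dd by auto
      moreover have "j' = next_sector j" using j sector_indices(5)[OF dd(5)] by simp
      ultimately show False using comp[OF dd(1)] that by auto
    qed
    have "acell x i k \<noteq> acell x i' k'" using s ne acell_eq_iff[of k k' x i] ik by auto
    moreover have "bcell x (prev_sector i) k \<noteq> bcell x (prev_sector i') k'"
    proof
      assume eq: "bcell x (prev_sector i) k = bcell x (prev_sector i') k'"
      then have "prev_sector i = prev_sector i'" using s by metis
      then show False using eq ne bcell_eq_iff[of k k' x "prev_sector i"] ik sector_indices(5) by (metis atLeastAtMost_iff)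
    qed
    moreover have "acell x i k \<noteq> bcell x (prev_sector i') k'" "acell x i' k' \<noteq> bcell x (prev_sector i) k"
      using no ef(2,4) c by blast+
    ultimately show "e \<inter> f = {}" unfolding ef c gate_def by auto
  qed
  moreover have "\<Union>E \<subseteq> (\<Union>i\<in>{1..6}. part i)"
  proof
    fix p assume "p \<in> \<Union>E"
    then obtain i k where ik: "(i, k) \<in> C" "p = acell x i k \<or> p = bcell x (prev_sector i) k"
      unfolding C(3) by (auto simp: gate_def)
    then show "p \<in> (\<Union>i\<in>{1..6}. part i)"
      using mem[OF ik(1)] Cd(1)[OF ik(1)] sector_indices(2)[OF Cd(1)[OF ik(1)]] by blast
  qed
  moreover have "{} \<notin> E" unfolding C(3) by (auto simp: gate_def)
  moreover have "\<not> e \<subseteq> part j" if e: "e \<in> E" for e j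
  proof -
    obtain i k where ik: "(i, k) \<in> C" "e = gate x (i, k)" using e C(3) by auto
    note d = Cd[OF ik(1)]
    show ?thesis
    proof
      assume "e \<subseteq> part j"
      then have "acell x i k \<in> part j" "bcell x (prev_sector i) k \<in> part j"
        unfolding ik(2) gate_def by auto
      then show False
        using sector_of_part[of _ j] sector_indices(7)[OF d(1)] gate_sectors[OF d(1,2)] by metis
    qed
  qed
  ultimately show "E \<in> crossing_sets (pair_tiles cell_adj) {1..6} part"
    unfolding crossing_sets_def by blast
qed

text \<open>Seen from sector \<open>i\<close>, a gate on segment \<open>i\<close> or on the next one
  removes the same cell as a hole with that label would. Holes and gates merge into one dent set for
  each side.\<close>

lemma part_minus_gates:
  assumes "C \<subseteq> gates" "i \<in> {1..6}"
  shows "part i - \<Union>(gate x ` C)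
    = emb x i ` dented_trapezoid n (trunc x i) (A i \<union> C `` {i}) (B i \<union> C `` {next_sector i})"
proof -
  have Cd: "j \<in> {1..6}" "k \<in> {1..n}" if "(j, k) \<in> C" for j k
    using assms(1) that by (auto simp: gates_def)
  have "emb x i ` dented_trapezoid n (trunc x i) P Q
      = {p \<in> hex_cells n x. sector_of p = i} - acell x i ` P - bcell x i ` Q" for P Q
    unfolding dented_trapezoid_def image_set_diff[OF inj_emb] emb_trapezoid[OF assms(2)]
    by (simp add: image_image acell_def bcell_def)
  moreover have "p \<in> \<Union>(gate x ` C) \<longleftrightarrow> p \<in> acell x i ` (C `` {i}) \<or> p \<in> bcell x i ` (C `` {next_sector i})"
    if p: "sector_of p = i" for p
  proof
    assume "p \<in> \<Union>(gate x ` C)"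
    then obtain j k where jk: "(j, k) \<in> C" "p = acell x j k \<or> p = bcell x (prev_sector j) k"
      by (auto simp: gate_def)
    then have "p = acell x j k \<and> j = i \<or> p = bcell x (prev_sector j) k \<and> prev_sector j = i"
      using gate_sectors[OF Cd[OF jk(1)]] p by metis
    then show "p \<in> acell x i ` (C `` {i}) \<or> p \<in> bcell x i ` (C `` {next_sector i})"
      using jk(1) sector_indices(5)[OF Cd(1)[OF jk(1)]] by auto
  next
    assume "p \<in> acell x i ` (C `` {i}) \<or> p \<in> bcell x i ` (C `` {next_sector i})"
    then obtain k where "(i, k) \<in> C \<and> p = acell x i k \<or> (next_sector i, k) \<in> C \<and> p = bcell x i k" by blast
    then have "p \<in> gate x (i, k) \<and> (i, k) \<in> C \<or> p \<in> gate x (next_sector i, k) \<and> (next_sector i, k) \<in> C"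
      using sector_indices(4)[OF assms(2)] by (auto simp: gate_def)
    then show "p \<in> \<Union>(gate x ` C)" by blast
  qed
  ultimately have "p \<in> part i - \<Union>(gate x ` C) \<longleftrightarrow>
      p \<in> emb x i ` dented_trapezoid n (trunc x i) (A i \<union> C `` {i}) (B i \<union> C `` {next_sector i})" for p
    unfolding part_def by (cases "sector_of p = i") (simp_all add: image_Un, blast)
  then show ?thesis by (rule set_eqI)
qed

lemma finite_hex_cells: "finite (hex_cells n x)"
proof (rule finite_subset)
  let ?I = "{- int n..<int n + int x}"
  show "hex_cells n x \<subseteq> ?I \<times> ?I \<times> ?I" by (auto simp: hex_cells_def)
qed auto

lemma finite_part: "finite (part i)"
  unfolding part_def using finite_hex_cells by auto

definition sector_weight :: "(nat \<times> nat) set \<Rightarrow> nat \<Rightarrow> real" where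
  "sector_weight C i = binom_minor n (trunc x i) (A i \<union> C `` {i}) (B i \<union> C `` {next_sector i})"

lemma gates_Image:
  assumes "C \<subseteq> gates" "i \<in> {1..6}"
  shows "A i \<union> C `` {i} \<subseteq> {1..n}" "B i \<union> C `` {next_sector i} \<subseteq> {1..n}"
  using A[OF assms(2)] B[OF assms(2)] assms(1) by (auto simp: gates_def)

lemma card_part_minus_gates:
  assumes C: "C \<subseteq> gates" "compatible C" and i: "i \<in> {1..6}"
  shows "real (card (tile_partitions (pair_tiles cell_adj) (part i - \<Union>(gate x ` C)))) = sector_weight C i"
proof -
  have "card (tile_partitions (pair_tiles cell_adj) (part i - \<Union>(gate x ` C)))
      = card (tile_partitions model_tiles
          (dented_trapezoid n (trunc x i) (A i \<union> C `` {i}) (B i \<union> C `` {next_sector i})))"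
    unfolding part_minus_gates[OF C(1) i] model_tiles_eq
    by (intro card_tile_partitions_image pair_tiles_image_iff[of _ UNIV])
       (simp_all add: cell_adj_emb inj_emb inj_on_subset[OF inj_emb])
  moreover have "1 \<notin> B i \<union> C `` {next_sector i}" if "trunc x i = 0" "1 \<in> A i \<union> C `` {i}"
    using C(2) i that unfolding compatible_def by blast
  ultimately show ?thesis unfolding sector_weight_def
    using card_dented_trapezoid[OF gates_Image[OF C(1) i], of "trunc x i"] by presburger
qed

lemma sector_weight_incompatible:
  assumes "C \<subseteq> gates" "\<not> compatible C"
  shows "\<exists>i\<in>{1..6}. trunc x i = 0 \<and> sector_weight C i = 0"
proof -
  obtain i where i: "i \<in> {1..6}" "trunc x i = 0" "1 \<in> A i \<union> C `` {i}" "1 \<in> B i \<union> C `` {next_sector i}"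
    using assms(2) by (auto simp: compatible_def)
  have "finite (A i \<union> C `` {i})" using gates_Image(1)[OF assms(1) i(1)] by (rule finite_subset) simp
  then have "sector_weight C i = 0" unfolding sector_weight_def using i(3,4) by (intro binom_minor_eq_0)
  then show ?thesis using i(1,2) by blast
qed

lemma inj_on_image_gate: "inj_on ((`) (gate x)) {C. C \<subseteq> gates \<and> P C}"
proof (rule inj_on_subset[of _ "Pow gates"])
  show "inj_on ((`) (gate x)) (Pow gates)"
    by (rule inj_on_image_Pow) (use gate_eq_iff in \<open>auto intro: inj_onI\<close>)
qed auto

text \<open>The sum is extended from compatible sets to all sets of gates, because an incompatible
  one makes the determinant of an untruncated sector vanish. The index set no longer depends on
  which sectors are truncated.\<close>

theorem card_tile_partitions_parts:
  "real (card (tile_partitions (pair_tiles cell_adj) (\<Union>i\<in>{1..6}. part i)))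
    = (\<Sum>C\<in>Pow gates. \<Prod>i=1..6. sector_weight C i)"
proof -
  have "card (tile_partitions (pair_tiles cell_adj) (\<Union>i\<in>{1..6}. part i))
      = (\<Sum>C | C \<subseteq> gates \<and> compatible C.
          \<Prod>i=1..6. card (tile_partitions (pair_tiles cell_adj) (part i - \<Union>(gate x ` C))))"
    unfolding card_tile_partitions_split[OF disjoint_parts finite_atLeastAtMost finite_part]
      crossing_sets_eq sum.reindex[OF inj_on_image_gate] by simp
  then have "real (card (tile_partitions (pair_tiles cell_adj) (\<Union>i\<in>{1..6}. part i)))
      = (\<Sum>C | C \<subseteq> gates \<and> compatible C. \<Prod>i=1..6. sector_weight C i)"
    using card_part_minus_gates by simp
  also have "\<dots> = (\<Sum>C\<in>Pow gates. \<Prod>i=1..6. sector_weight C i)"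
  proof (rule sum.mono_neutral_left)
    show "\<forall>C\<in>Pow gates - {C. C \<subseteq> gates \<and> compatible C}. (\<Prod>i=1..6. sector_weight C i) = 0"
      using sector_weight_incompatible by (auto simp: prod_zero_iff)
  qed (auto simp: finite_gates)
  finally show ?thesis .
qed

end

section \<open>Cyclically symmetric snowflakes\<close>

locale symmetric_snowflake_cells = snowflake_cells +
  assumes A_turn: "\<And>i. i \<in> {1..6} \<Longrightarrow> A (turn_sector i) = A i"
    and B_turn: "\<And>i. i \<in> {1..6} \<Longrightarrow> B (turn_sector i) = B i"
begin

lemma turn_acell: "i \<in> {1..6} \<Longrightarrow> turn (acell x i k) = acell x (turn_sector i) k"
  using sector_indices(14)[of i] by (simp add: acell_def turn_emb trunc_def)

lemma turn_bcell: "i \<in> {1..6} \<Longrightarrow> turn (bcell x i k) = bcell x (turn_sector i) k"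
  using sector_indices(14)[of i] by (simp add: bcell_def turn_emb trunc_def)

lemma turn_gate: "i \<in> {1..6} \<Longrightarrow> turn ` gate x (i, k) = gate x (turn_sector i, k)"
  using sector_indices(2,12)[of i] by (simp add: gate_def turn_acell turn_bcell)

lemma turn_part:
  assumes i: "i \<in> {1..6}"
  shows "turn ` part i = part (turn_sector i)"
proof -
  have "turn ` {p \<in> hex_cells n x. sector_of p = i} = {p \<in> hex_cells n x. sector_of p = turn_sector i}"
    unfolding emb_trapezoid[OF i, symmetric] emb_trapezoid[OF sector_indices(3)[OF i], symmetric]
    using sector_indices(14)[OF i] by (simp add: image_image turn_emb[OF i] trunc_def)
  then show ?thesis
    unfolding part_def image_set_diff[OF inj_turn] A_turn[OF i] B_turn[OF i]
    by (simp add: image_image turn_acell[OF i] turn_bcell[OF i])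
qed

text \<open>A turn advances the sector by two, so one triangle and one trapezoid represent all
  six.\<close>

sublocale symmetric_split "pair_tiles cell_adj" "{1..6}" "{1, 2}" part turn turn_sector
proof
  show "e \<in> pair_tiles cell_adj \<longleftrightarrow> turn ` e \<in> pair_tiles cell_adj" for e
    by (rule pair_tiles_image_iff[of _ UNIV]) (use inj_turn cell_adj_turn in auto)
  show "i \<in> {1, 2} \<or> turn_sector i \<in> {1, 2} \<or> turn_sector (turn_sector i) \<in> {1, 2}" if "i \<in> {1..6}" for i
    using that by (cases rule: sector_cases) (simp_all add: turn_sector_def next_sector_def)
qed (use disjoint_parts sector_indices turn_part in \<open>auto simp: turn_sector_def next_sector_def\<close>)

text \<open>The invariant sets of gates: one label set repeated on the odd segments and another on
  the even ones, chosen independently.\<close>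

definition sym_gates :: "nat set \<Rightarrow> nat set \<Rightarrow> (nat \<times> nat) set" where
  "sym_gates C D = {(i, k). i \<in> {1..6} \<and> k \<in> (if odd i then C else D)}"

lemma sym_gates_Image:
  "i \<in> {1..6} \<Longrightarrow> sym_gates C D `` {i} = (if odd i then C else D)"
  by (auto simp: sym_gates_def)

lemma AB_cyclic:
  "A 3 = A 1" "A 5 = A 1" "A 4 = A 2" "A 6 = A 2" "B 3 = B 1" "B 5 = B 1" "B 4 = B 2" "B 6 = B 2"
  using A_turn[of 1] A_turn[of 3] A_turn[of 2] A_turn[of 4] B_turn[of 1] B_turn[of 3] B_turn[of 2] B_turn[of 4]
  by (simp_all add: turn_sector_def next_sector_def eval_nat_numeral)

lemma gates_iff:
  assumes "i \<in> {1..6}"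
  shows "(i, k) \<in> gates \<longleftrightarrow> k \<in> (if odd i then {1..n} - A 1 - B 2 else {1..n} - A 2 - B 1)"
proof -
  have g: "(i, k) \<in> gates \<longleftrightarrow> k \<in> {1..n} - A i - B (prev_sector i)" using assms by (auto simp: gates_def)
  show ?thesis unfolding g using assms
    by (cases i rule: sector_cases) (simp_all add: prev_sector_simps AB_cyclic del: One_nat_def)
qed

lemma sym_gates_subset_iff:
  "sym_gates C D \<subseteq> gates \<longleftrightarrow> C \<subseteq> {1..n} - A 1 - B 2 \<and> D \<subseteq> {1..n} - A 2 - B 1"
proof
  assume sub: "sym_gates C D \<subseteq> gates"
  have "(1, k) \<in> gates" if "k \<in> C" for k using sub that by (auto simp: sym_gates_def)
  moreover have "(2, k) \<in> gates" if "k \<in> D" for k using sub that by (auto simp: sym_gates_def)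
  ultimately show "C \<subseteq> {1..n} - A 1 - B 2 \<and> D \<subseteq> {1..n} - A 2 - B 1"
    using gates_iff[of 1] gates_iff[of 2] by auto
next
  assume sub: "C \<subseteq> {1..n} - A 1 - B 2 \<and> D \<subseteq> {1..n} - A 2 - B 1"
  show "sym_gates C D \<subseteq> gates"
  proof
    fix c assume "c \<in> sym_gates C D"
    then obtain i k where c: "c = (i, k)" "i \<in> {1..6}" "k \<in> (if odd i then C else D)"
      by (auto simp: sym_gates_def)
    then show "c \<in> gates" using gates_iff[of i k] sub by (auto split: if_splits)
  qed
qed

definition turn_gates :: "(nat \<times> nat) set \<Rightarrow> (nat \<times> nat) set" where
  "turn_gates C = (\<lambda>(i, k). (turn_sector i, k)) ` C"

lemma turn_gates_subset: "C \<subseteq> gates \<Longrightarrow> turn_gates C \<subseteq> gates"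
proof
  fix c assume "C \<subseteq> gates" "c \<in> turn_gates C"
  then obtain i k where ik: "(i, k) \<in> gates" "c = (turn_sector i, k)" by (auto simp: turn_gates_def)
  then have "i \<in> {1..6}" by (auto simp: gates_def)
  then show "c \<in> gates" using ik gates_iff[of i k] gates_iff[of "turn_sector i" k] sector_indices(3,14)[of i] by simp
qed

lemma turn_gates_eq_iff:
  assumes "C \<subseteq> gates"
  shows "turn_gates C = C \<longleftrightarrow> (\<exists>C1 C2. C = sym_gates C1 C2)"
proof
  assume eq: "turn_gates C = C"
  have step: "(turn_sector i, k) \<in> C" if "(i, k) \<in> C" for i k
    using that eq unfolding turn_gates_def by force
  have iff: "(turn_sector i, k) \<in> C \<longleftrightarrow> (i, k) \<in> C" if "i \<in> {1..6}" for i k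
    using step[of i k] step[of "turn_sector i" k] step[of "turn_sector (turn_sector i)" k] sector_indices(10)[OF that]
    by auto
  have C_eq: "(3, k) \<in> C \<longleftrightarrow> (1, k) \<in> C" "(5, k) \<in> C \<longleftrightarrow> (3, k) \<in> C"
    "(4, k) \<in> C \<longleftrightarrow> (2, k) \<in> C" "(6, k) \<in> C \<longleftrightarrow> (4, k) \<in> C" for k
    using iff[of 1 k] iff[of 3 k] iff[of 2 k] iff[of 4 k]
    by (simp_all add: turn_sector_def next_sector_def eval_nat_numeral)
  have "(i, k) \<in> C \<longleftrightarrow> k \<in> (if odd i then C `` {1} else C `` {2})" if "i \<in> {1..6}" for i k
    using that by (cases rule: sector_cases) (simp_all add: C_eq del: One_nat_def)
  moreover have "i \<in> {1..6}" if "(i, k) \<in> C" for i k using assms that by (auto simp: gates_def)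
  ultimately have "C = sym_gates (C `` {1}) (C `` {2})" unfolding sym_gates_def by blast
  then show "\<exists>C1 C2. C = sym_gates C1 C2" by blast
next
  assume "\<exists>C1 C2. C = sym_gates C1 C2"
  then obtain C1 C2 where C: "C = sym_gates C1 C2" by blast
  show "turn_gates C = C"
  proof (intro equalityI subsetI)
    fix c assume "c \<in> turn_gates C"
    then show "c \<in> C" using sector_indices(3,14) unfolding C turn_gates_def sym_gates_def by auto
  next
    fix c assume c: "c \<in> C"
    obtain i k where ik: "c = (i, k)" by (cases c)
    then have i: "i \<in> {1..6}" using c C by (auto simp: sym_gates_def)
    have "(turn_sector (turn_sector i), k) \<in> C"
      using c sector_indices(3,14)[OF i] sector_indices(3,14)[of "turn_sector i"] unfolding ik C sym_gates_def by auto
    then show "c \<in> turn_gates C" unfolding turn_gates_def ik using sector_indices(10)[OF i] by force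
  qed
qed

lemma turn_gate_image:
  assumes "C \<subseteq> gates"
  shows "(`) turn ` (gate x ` C) = gate x ` turn_gates C"
  unfolding turn_gates_def image_image[of "(`) turn" "gate x"] image_image[of "gate x"]
proof (rule image_cong[OF refl])
  fix c assume "c \<in> C"
  then obtain i k where "c = (i, k)" "i \<in> {1..6}" using assms by (auto simp: gates_def)
  then show "turn ` gate x c = gate x (case c of (i, k) \<Rightarrow> (turn_sector i, k))" using turn_gate by simp
qed

lemma sector_weight_sym_gates:
  "sector_weight (sym_gates C D) 1 = binom_minor n 0 (A 1 \<union> C) (B 1 \<union> D)"
  "sector_weight (sym_gates C D) 2 = binom_minor n x (A 2 \<union> D) (B 2 \<union> C)"
  unfolding sector_weight_def next_sector_simps by (simp_all add: sym_gates_Image trunc_def)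

lemma sector_weight_turn:
  assumes "i \<in> {1..6}"
  shows "sector_weight (sym_gates C D) (turn_sector i) = sector_weight (sym_gates C D) i"
  unfolding sector_weight_def A_turn[OF assms] B_turn[OF assms]
  using assms sector_indices(1,3,13-15)[OF assms] sector_indices(1,3,14,15)[of "next_sector i"]
    sector_indices(1,3,15)[of "turn_sector i"]
  by (simp add: sym_gates_Image trunc_def)

text \<open>An invariant set of crossing lozenges is a pair \<open>C\<close>, \<open>D\<close>, and
  sectors 1 and 2 represent the rest, so only two determinants remain per term.\<close>

theorem card_sym_tile_partitions_parts:
  "real (card {T \<in> tile_partitions (pair_tiles cell_adj) (\<Union>i\<in>{1..6}. part i). (`) turn ` T = T})
    = (\<Sum>C\<in>Pow ({1..n} - A 1 - B 2). \<Sum>D\<in>Pow ({1..n} - A 2 - B 1).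
        binom_minor n 0 (A 1 \<union> C) (B 1 \<union> D) * binom_minor n x (A 2 \<union> D) (B 2 \<union> C))"
proof -
  let ?N = "\<lambda>C i. card (tile_partitions (pair_tiles cell_adj) (part i - \<Union>(gate x ` C)))"
  let ?U = "Pow ({1..n} - A 1 - B 2)" and ?V = "Pow ({1..n} - A 2 - B 1)"
  have "{E. E \<in> crossing_sets (pair_tiles cell_adj) {1..6} part \<and> (`) turn ` E = E}
      = (`) (gate x) ` {C. C \<subseteq> gates \<and> (compatible C \<and> turn_gates C = C)}"
  proof -
    have "(`) turn ` (gate x ` C) = gate x ` C \<longleftrightarrow> turn_gates C = C" if "C \<subseteq> gates" for C
      unfolding turn_gate_image[OF that]
      by (rule inj_on_eq_iff[OF inj_on_image_gate[where P = "\<lambda>_. True"]]) (use that turn_gates_subset in auto)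
    then have "{C \<in> {C. C \<subseteq> gates \<and> compatible C}. (`) turn ` (gate x ` C) = gate x ` C}
        = {C. C \<subseteq> gates \<and> (compatible C \<and> turn_gates C = C)}"
      unfolding mem_Collect_eq conj_assoc by (intro Collect_cong conj_cong refl)
    then show ?thesis unfolding crossing_sets_eq Compr_image_eq by simp
  qed
  then have "card {T \<in> tile_partitions (pair_tiles cell_adj) (\<Union>i\<in>{1..6}. part i). (`) turn ` T = T}
      = (\<Sum>C | C \<subseteq> gates \<and> (compatible C \<and> turn_gates C = C). \<Prod>i\<in>{1, 2}. ?N C i)"
    by (simp only: card_sym_tile_partitions_split[OF finite_atLeastAtMost finite_part]
        sum.reindex[OF inj_on_image_gate] comp_def)
  then have "real (card {T \<in> tile_partitions (pair_tiles cell_adj) (\<Union>i\<in>{1..6}. part i). (`) turn ` T = T})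
      = (\<Sum>C | C \<subseteq> gates \<and> (compatible C \<and> turn_gates C = C). sector_weight C 1 * sector_weight C 2)"
    using card_part_minus_gates[of _ 1] card_part_minus_gates[of _ 2] by simp
  also have "\<dots> = (\<Sum>C | C \<subseteq> gates \<and> turn_gates C = C. sector_weight C 1 * sector_weight C 2)"
  proof (rule sum.mono_neutral_left)
    show "finite {C. C \<subseteq> gates \<and> turn_gates C = C}"
      by (rule finite_subset[of _ "Pow gates"]) (auto simp: finite_gates)
    show "\<forall>C\<in>{C. C \<subseteq> gates \<and> turn_gates C = C} - {C. C \<subseteq> gates \<and> (compatible C \<and> turn_gates C = C)}.
        sector_weight C 1 * sector_weight C 2 = 0"
    proof
      fix C assume "C \<in> {C. C \<subseteq> gates \<and> turn_gates C = C} - {C. C \<subseteq> gates \<and> (compatible C \<and> turn_gates C = C)}"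
      then have C: "C \<subseteq> gates" "turn_gates C = C" "\<not> compatible C" by auto
      obtain C1 C2 where CC: "C = sym_gates C1 C2" using turn_gates_eq_iff[OF C(1)] C(2) by auto
      obtain i where i: "i \<in> {1..6}" "sector_weight C i = 0" using sector_weight_incompatible[OF C(1,3)] by auto
      \<comment> \<open>An incompatible set spoils some sector, perhaps neither 1 nor 2; by
        invariance the weight of sector 1 or 2 equals that of the spoiled one.\<close>
      have w: "sector_weight C 3 = sector_weight C 1" "sector_weight C 5 = sector_weight C 3"
        "sector_weight C 4 = sector_weight C 2" "sector_weight C 6 = sector_weight C 4"
        using sector_weight_turn[of 1 C1 C2] sector_weight_turn[of 3 C1 C2]
          sector_weight_turn[of 2 C1 C2] sector_weight_turn[of 4 C1 C2] unfolding CC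
        by (simp_all add: turn_sector_def next_sector_def eval_nat_numeral)
      from i(1) show "sector_weight C 1 * sector_weight C 2 = 0"
        by (cases rule: sector_cases) (use w i(2) in auto)
    qed
  qed auto
  also have "{C. C \<subseteq> gates \<and> turn_gates C = C} = (\<lambda>(C, D). sym_gates C D) ` (?U \<times> ?V)"
  proof (intro equalityI subsetI)
    fix C assume C: "C \<in> {C. C \<subseteq> gates \<and> turn_gates C = C}"
    then obtain C1 C2 where "C = sym_gates C1 C2" using turn_gates_eq_iff[of C] by auto
    then show "C \<in> (\<lambda>(C, D). sym_gates C D) ` (?U \<times> ?V)" using C sym_gates_subset_iff by auto
  next
    fix C assume "C \<in> (\<lambda>(C, D). sym_gates C D) ` (?U \<times> ?V)"
    then obtain C1 C2 where "C = sym_gates C1 C2" "C1 \<in> ?U" "C2 \<in> ?V" by auto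
    then show "C \<in> {C. C \<subseteq> gates \<and> turn_gates C = C}"
      using sym_gates_subset_iff[of C1 C2] turn_gates_eq_iff[of C] by auto
  qed
  also have "(\<Sum>C\<in>(\<lambda>(C, D). sym_gates C D) ` (?U \<times> ?V). sector_weight C 1 * sector_weight C 2)
      = (\<Sum>(C, D)\<in>?U \<times> ?V. binom_minor n 0 (A 1 \<union> C) (B 1 \<union> D) * binom_minor n x (A 2 \<union> D) (B 2 \<union> C))"
  proof (subst sum.reindex)
    have "C = sym_gates C D `` {1}" "D = sym_gates C D `` {2}" for C D
      by (simp_all add: sym_gates_Image)
    then show "inj_on (\<lambda>(C, D). sym_gates C D) (?U \<times> ?V)" by (intro inj_onI) (clarify, metis)
  qed (simp add: case_prod_unfold sector_weight_sym_gates del: One_nat_def)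
  finally show ?thesis by (simp add: sum.cartesian_product)
qed

end

subsection \<open>Lattice coordinates in the plane\<close>

text \<open>Oblique coordinates with the central triangle's bottom-left corner as origin: the first
  two barycentric coordinates of the point, the third being \<open>x - a - b\<close>.\<close>

definition rp :: "real \<Rightarrow> real \<Rightarrow> complex" where
  "rp a b = of_real a + of_real b * cis (pi / 3)"

lemma cis_60: "cis (pi / 3) = Complex (1 / 2) (sqrt 3 / 2)"
  by (simp add: complex_eq_iff cos_60 sin_60)

lemma Re_rp: "Re (rp a b) = a + b / 2"
  by (simp add: rp_def cis_60)

lemma Im_rp: "Im (rp a b) = b * (sqrt 3 / 2)"
  by (simp add: rp_def cis_60)

lemma rp_eq_iff [simp]: "rp a b = rp a' b' \<longleftrightarrow> a = a' \<and> b = b'"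
  by (auto simp: complex_eq_iff Re_rp Im_rp)

lemma rp_surj: "\<exists>a b. z = rp a b"
  by (rule exI[of _ "Re z - Im z / sqrt 3"], rule exI[of _ "2 * Im z / sqrt 3"])
     (simp add: complex_eq_iff Re_rp Im_rp)

lemma rp_add: "rp a b + rp a' b' = rp (a + a') (b + b')"
  by (simp add: rp_def algebra_simps)

lemma rp_scale_nat: "of_nat m * rp a b = rp (m * a) (m * b)"
  by (simp add: rp_def algebra_simps)

lemma rp_scaleR: "r *\<^sub>R rp a b = rp (r * a) (r * b)"
  by (simp add: rp_def algebra_simps scaleR_conv_of_real)

lemma cis_rp:
  "cis (2 * pi / 3) = rp (- 1) 1" "cis (pi / 3) = rp 0 1" "cis (- pi / 3) = rp 1 (- 1)"
  "cis (- 2 * pi / 3) = rp 0 (- 1)" "cis (- pi) = rp (- 1) 0" "cis 0 = rp 1 0"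
  "1 = rp 1 0" "0 = rp 0 0"
  by (simp_all add: complex_eq_iff Re_rp Im_rp cos_60 sin_60 cos_120 sin_120)

lemma cis_60_mult_rp: "cis (pi / 3) * rp a b = rp (- b) (a + b)"
  by (simp add: complex_eq_iff Re_rp Im_rp cis_60) (simp add: field_simps)

lemma cis_minus_240: "cis (- (4 * pi / 3)) = cis (2 * pi / 3)"
  using cis_mult[of "- (4 * pi / 3)" "2 * pi"] by simp

lemma seg_dir_rp:
  "seg_dir 1 = rp (- 1) 1" "seg_dir 2 = rp 0 1" "seg_dir 3 = rp 1 0" "seg_dir 4 = rp 1 (- 1)"
  "seg_dir 5 = rp 0 (- 1)" "seg_dir 6 = rp (- 1) 0" "seg_dir 7 = rp (- 1) 1"
  using cis_rp cis_minus_240 by (simp_all add: seg_dir_def)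

lemma corner_rp:
  "corner x 1 = rp 0 x" "corner x 2 = rp 0 x" "corner x 3 = rp x 0" "corner x 4 = rp x 0"
  "corner x 5 = rp 0 0" "corner x 6 = rp 0 0" "corner x 7 = rp 0 x"
  by (simp_all add: corner_def top_corner_def right_corner_def left_corner_def rp_def)

lemma central_corner_rp: "top_corner x = rp 0 x" "right_corner x = rp x 0" "left_corner x = rp 0 0"
  by (simp_all add: top_corner_def right_corner_def left_corner_def rp_def)

lemma hex_vertex_rp:
  "hex_vertex n x 1 = rp (- real n) (x + n)" "hex_vertex n x 2 = rp 0 (x + n)"
  "hex_vertex n x 3 = rp (x + n) 0" "hex_vertex n x 4 = rp (x + n) (- real n)"
  "hex_vertex n x 5 = rp 0 (- real n)" "hex_vertex n x 6 = rp (- real n) 0"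
  "hex_vertex n x 7 = rp (- real n) (x + n)"
  unfolding hex_vertex_def seg_dir_rp corner_rp rp_scale_nat rp_add by simp_all

lemma hex_vertices: "hex_vertex n x ` {1..6}
    = {rp (- real n) (x + n), rp 0 (x + n), rp (x + n) 0, rp (x + n) (- real n), rp 0 (- real n), rp (- real n) 0}"
  unfolding one_to_six image_insert image_empty hex_vertex_rp ..

text \<open>A box in barycentric coordinates. The hexagon, the central triangle and all six sectors
  are of this kind, so containment of a unit triangle can be tested coordinate by
  coordinate.\<close>

definition region :: "real \<Rightarrow> real \<times> real \<Rightarrow> real \<times> real \<Rightarrow> real \<times> real \<Rightarrow> complex set" where
  "region x = (\<lambda>(la, ha) (lb, hb) (lc, hc). {rp a b | a b.
     la \<le> a \<and> a \<le> ha \<and> lb \<le> b \<and> b \<le> hb \<and> lc \<le> x - a - b \<and> x - a - b \<le> hc})"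

lemma rp_in_region [simp]:
  "rp a b \<in> region x (la, ha) (lb, hb) (lc, hc) \<longleftrightarrow>
     la \<le> a \<and> a \<le> ha \<and> lb \<le> b \<and> b \<le> hb \<and> lc \<le> x - a - b \<and> x - a - b \<le> hc"
  by (auto simp: region_def)

lemma convex_region: "convex (region x (la, ha) (lb, hb) (lc, hc))"
proof (rule convexI)
  fix p q :: complex and u v :: real
  assume p: "p \<in> region x (la, ha) (lb, hb) (lc, hc)" and q: "q \<in> region x (la, ha) (lb, hb) (lc, hc)"
    and uv: "0 \<le> u" "0 \<le> v" "u + v = 1"
  have between: "l \<le> u * s + v * t \<and> u * s + v * t \<le> h" if "l \<le> s" "s \<le> h" "l \<le> t" "t \<le> h" for l h s t :: real
  proof -
    have "u * l + v * l \<le> u * s + v * t" "u * s + v * t \<le> u * h + v * h"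
      using that uv by (intro add_mono mult_left_mono; simp)+
    then show ?thesis using uv(3) by (simp add: distrib_right[symmetric])
  qed
  obtain a b where ab: "p = rp a b" using rp_surj by blast
  obtain a' b' where ab': "q = rp a' b'" using rp_surj by blast
  have "u * (x - a - b) + v * (x - a' - b') = (u + v) * x - (u * a + v * a') - (u * b + v * b')"
    by (simp add: algebra_simps)
  then have "x - (u * a + v * a') - (u * b + v * b') = u * (x - a - b) + v * (x - a' - b')"
    using uv(3) by simp
  then show "u *\<^sub>R p + v *\<^sub>R q \<in> region x (la, ha) (lb, hb) (lc, hc)"
    using p q between[of la a ha a'] between[of lb b hb b'] between[of lc "x - a - b" hc "x - a' - b'"]
    unfolding ab ab' by (simp add: rp_scaleR rp_add)
qed

text \<open>A trapezoid lies between two rays from \<open>(pa, pb)\<close>, at distances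
  \<open>m\<close> to \<open>m + l\<close> along them. The point with ray coordinates
  \<open>s\<close>, \<open>t\<close> lies on the chord \<open>s + t = r\<close>: interpolate first
  along both rays to distance \<open>r\<close>, then along this chord. With \<open>m = 0\<close> it
  is a triangle.\<close>

lemma rp_in_convex_trapezoid:
  assumes K: "convex K" and pos: "0 \<le> m" "0 \<le> l" "0 \<le> s" "0 \<le> t" "m \<le> s + t" "s + t \<le> m + l"
    and pts: "rp (pa + m * da) (pb + m * db) \<in> K" "rp (pa + (m + l) * da) (pb + (m + l) * db) \<in> K"
      "rp (pa + m * ea) (pb + m * eb) \<in> K" "rp (pa + (m + l) * ea) (pb + (m + l) * eb) \<in> K"
  shows "rp (pa + s * da + t * ea) (pb + s * db + t * eb) \<in> K"
proof -
  define r where "r = s + t"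
  have on_ray: "rp (pa + r * va) (pb + r * vb) \<in> K"
    if "rp (pa + m * va) (pb + m * vb) \<in> K" "rp (pa + (m + l) * va) (pb + (m + l) * vb) \<in> K" for va vb
  proof (cases "l = 0")
    case True
    then have "r = m" using pos by (simp add: r_def)
    then show ?thesis using that by simp
  next
    case False
    define u where "u = (r - m) / l"
    have u: "0 \<le> u" "u \<le> 1" using pos False by (auto simp: u_def r_def field_simps)
    have "r = m + u * l" using False by (simp add: u_def)
    then have "rp (pa + r * va) (pb + r * vb)
        = (1 - u) *\<^sub>R rp (pa + m * va) (pb + m * vb) + u *\<^sub>R rp (pa + (m + l) * va) (pb + (m + l) * vb)"
      by (simp add: rp_scaleR rp_add algebra_simps)
    then show ?thesis using convexD_alt[OF K that u] by simp
  qed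
  show ?thesis
  proof (cases "r = 0")
    case True
    then have "s = 0" "t = 0" "m = 0" using pos by (auto simp: r_def)
    then show ?thesis using pts by simp
  next
    case False
    then have "r > 0" using pos by (simp add: r_def)
    define u where "u = t / r"
    have u: "0 \<le> u" "u \<le> 1" using pos \<open>r > 0\<close> by (auto simp: u_def r_def field_simps)
    have t: "t = u * r" using \<open>r > 0\<close> by (simp add: u_def)
    then have s: "s = r - u * r" by (simp add: r_def)
    have "rp (pa + s * da + t * ea) (pb + s * db + t * eb)
        = (1 - u) *\<^sub>R rp (pa + r * da) (pb + r * db) + u *\<^sub>R rp (pa + r * ea) (pb + r * eb)"
      unfolding s t by (simp add: rp_scaleR rp_add algebra_simps)
    then show ?thesis using convexD_alt[OF K on_ray[OF pts(1,2)] on_ray[OF pts(3,4)] u] by simp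
  qed
qed

text \<open>Testing against an arbitrary convex \<open>K\<close> allows the points already known to
  lie in \<open>K\<close> to be used like further vertices.\<close>

lemma hull_eqI:
  assumes "P \<subseteq> S" "convex S" "\<And>a b K. rp a b \<in> S \<Longrightarrow> convex K \<Longrightarrow> P \<subseteq> K \<Longrightarrow> rp a b \<in> K"
  shows "convex hull P = S"
proof
  show "convex hull P \<subseteq> S" using assms(1,2) by (rule hull_minimal)
  show "S \<subseteq> convex hull P"
  proof
    fix z assume "z \<in> S"
    then show "z \<in> convex hull P"
      using assms(3)[of _ _ "convex hull P"] rp_surj[of z] by (metis convex_convex_hull hull_subset)
  qed
qed

lemma central_hull:
  "convex hull {rp 0 x, rp 0 0, rp x 0} = region x (0, x) (0, x) (0, x)" if "x \<ge> 0"
proof (rule hull_eqI)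
  fix a b K assume "rp a b \<in> region x (0, x) (0, x) (0, x)" "convex K" "{rp 0 x, rp 0 0, rp x 0} \<subseteq> K"
  then show "rp a b \<in> K"
    using rp_in_convex_trapezoid[of K 0 x b a 0 0 0 1 1 0] that by simp
qed (use that in \<open>auto simp: convex_region\<close>)

context
  fixes n x :: real
  assumes nx: "n \<ge> 0" "x \<ge> 0"
begin

lemma sector_hull:
  "convex hull {rp 0 x, rp (- n) (x + n), rp 0 (x + n), rp 0 x} = region x (- n, 0) (0, n + x) (- n, 0)"
  "convex hull {rp 0 x, rp 0 (x + n), rp (x + n) 0, rp x 0} = region x (0, n + x) (0, n + x) (- n, 0)"
  "convex hull {rp x 0, rp (x + n) 0, rp (x + n) (- n), rp x 0} = region x (0, n + x) (- n, 0) (- n, 0)"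
  "convex hull {rp x 0, rp (x + n) (- n), rp 0 (- n), rp 0 0} = region x (0, n + x) (- n, 0) (0, n + x)"
  "convex hull {rp 0 0, rp 0 (- n), rp (- n) 0, rp 0 0} = region x (- n, 0) (- n, 0) (0, n + x)"
  "convex hull {rp 0 0, rp (- n) 0, rp (- n) (x + n), rp 0 x} = region x (- n, 0) (0, n + x) (0, n + x)"
proof -
  show "convex hull {rp 0 x, rp (- n) (x + n), rp 0 (x + n), rp 0 x} = region x (- n, 0) (0, n + x) (- n, 0)"
  proof (rule hull_eqI)
    fix a b K assume "rp a b \<in> region x (- n, 0) (0, n + x) (- n, 0)" "convex K"
      "{rp 0 x, rp (- n) (x + n), rp 0 (x + n), rp 0 x} \<subseteq> K"
    then show "rp a b \<in> K"
      using rp_in_convex_trapezoid[of K 0 n "- a" "a + b - x" 0 "- 1" x 1 0 1] nx by simp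
  qed (use nx in \<open>auto simp: convex_region\<close>)
  show "convex hull {rp 0 x, rp 0 (x + n), rp (x + n) 0, rp x 0} = region x (0, n + x) (0, n + x) (- n, 0)"
  proof (rule hull_eqI)
    fix a b K assume "rp a b \<in> region x (0, n + x) (0, n + x) (- n, 0)" "convex K"
      "{rp 0 x, rp 0 (x + n), rp (x + n) 0, rp x 0} \<subseteq> K"
    then show "rp a b \<in> K"
      using rp_in_convex_trapezoid[of K x n b a 0 0 0 1 1 0] nx by simp
  qed (use nx in \<open>auto simp: convex_region\<close>)
  show "convex hull {rp x 0, rp (x + n) 0, rp (x + n) (- n), rp x 0} = region x (0, n + x) (- n, 0) (- n, 0)"
  proof (rule hull_eqI)
    fix a b K assume "rp a b \<in> region x (0, n + x) (- n, 0) (- n, 0)" "convex K"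
      "{rp x 0, rp (x + n) 0, rp (x + n) (- n), rp x 0} \<subseteq> K"
    then show "rp a b \<in> K"
      using rp_in_convex_trapezoid[of K 0 n "a + b - x" "- b" x 1 0 0 1 "- 1"] nx by simp
  qed (use nx in \<open>auto simp: convex_region\<close>)
  show "convex hull {rp x 0, rp (x + n) (- n), rp 0 (- n), rp 0 0} = region x (0, n + x) (- n, 0) (0, n + x)"
  proof (rule hull_eqI)
    fix a b K assume "rp a b \<in> region x (0, n + x) (- n, 0) (0, n + x)" "convex K"
      "{rp x 0, rp (x + n) (- n), rp 0 (- n), rp 0 0} \<subseteq> K"
    then show "rp a b \<in> K"
      using rp_in_convex_trapezoid[of K x n a "x - a - b" 0 1 x "- 1" 0 "- 1"] nx by simp
  qed (use nx in \<open>auto simp: convex_region\<close>)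
  show "convex hull {rp 0 0, rp 0 (- n), rp (- n) 0, rp 0 0} = region x (- n, 0) (- n, 0) (0, n + x)"
  proof (rule hull_eqI)
    fix a b K assume "rp a b \<in> region x (- n, 0) (- n, 0) (0, n + x)" "convex K"
      "{rp 0 0, rp 0 (- n), rp (- n) 0, rp 0 0} \<subseteq> K"
    then show "rp a b \<in> K"
      using rp_in_convex_trapezoid[of K 0 n "- b" "- a" 0 0 0 "- 1" "- 1" 0] nx by simp
  qed (use nx in \<open>auto simp: convex_region\<close>)
  show "convex hull {rp 0 0, rp (- n) 0, rp (- n) (x + n), rp 0 x} = region x (- n, 0) (0, n + x) (0, n + x)"
  proof (rule hull_eqI)
    fix a b K assume "rp a b \<in> region x (- n, 0) (0, n + x) (0, n + x)" "convex K"
      "{rp 0 0, rp (- n) 0, rp (- n) (x + n), rp 0 x} \<subseteq> K"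
    then show "rp a b \<in> K"
      using rp_in_convex_trapezoid[of K x n "x - a - b" b x "- 1" 0 0 "- 1" 1] nx by simp
  qed (use nx in \<open>auto simp: convex_region\<close>)
qed

lemma hexagon_hull:
  "convex hull {rp (- n) (x + n), rp 0 (x + n), rp (x + n) 0, rp (x + n) (- n), rp 0 (- n), rp (- n) 0}
    = region x (- n, n + x) (- n, n + x) (- n, n + x)"
proof (rule hull_eqI)
  fix a b K assume ab: "rp a b \<in> region x (- n, n + x) (- n, n + x) (- n, n + x)" and K: "convex K"
    and P: "{rp (- n) (x + n), rp 0 (x + n), rp (x + n) 0, rp (x + n) (- n), rp 0 (- n), rp (- n) 0} \<subseteq> K"
  have on_diagonal: "rp (u * a1 + (1 - u) * a2) (u * b1 + (1 - u) * b2) \<in> K"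
    if "rp a1 b1 \<in> K" "rp a2 b2 \<in> K" "0 \<le> u" "u \<le> 1" for u a1 b1 a2 b2
    using convexD_alt[OF K that(2,1,3,4)] by (simp add: rp_scaleR rp_add algebra_simps)
  have corners: "rp 0 x \<in> K" "rp x 0 \<in> K" "rp 0 0 \<in> K"
  proof -
    have "rp 0 x \<in> K \<and> rp x 0 \<in> K \<and> rp 0 0 \<in> K"
    proof (cases "x + 2 * n = 0")
      case True
      then have "x = 0" "n = 0" using nx by auto
      then show ?thesis using P by auto
    next
      case False
      \<comment> \<open>The corners of the central triangle lie on the long diagonals, which have
        length \<open>x + 2 * n\<close>; \<open>u\<close> and \<open>1 - u\<close> are their
        positions there. In the excluded case the hexagon is a single point.\<close>
      define u where "u = (x + n) / (x + 2 * n)"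
      have pos: "x + 2 * n > 0" using False nx by simp
      have u: "0 \<le> u" "u \<le> 1" using nx pos by (auto simp: u_def field_simps)
      have "u * (x + 2 * n) = x + n" using pos by (simp add: u_def)
      then have e: "u * (x + n) + (1 - u) * (- n) = x" by (simp add: algebra_simps)
      have e': "(1 - u) * (x + n) + u * (- n) = 0"
        using \<open>u * (x + 2 * n) = x + n\<close> by (simp add: algebra_simps)
      have "rp 0 x \<in> K"
        using on_diagonal[of 0 "x + n" 0 "- n" u] P u e by simp
      moreover have "rp x 0 \<in> K"
        using on_diagonal[of "x + n" 0 "- n" 0 u] P u e by simp
      moreover have "rp 0 0 \<in> K"
        using on_diagonal[of 0 "- n" 0 "x + n" u] P u e' by (simp add: add.commute)
      ultimately show ?thesis by blast
    qed
    then show "rp 0 x \<in> K" "rp x 0 \<in> K" "rp 0 0 \<in> K" by auto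
  qed
  have inK: "rp a b \<in> K" if "rp a b \<in> region x A B C" "convex hull Q = region x A B C" "Q \<subseteq> K" for Q A B C
    using that hull_minimal[of Q K convex] K by blast
  \<comment> \<open>The signs of the coordinates put the point in the central triangle or in one of
    the six sectors, whose corners are now all known to be in \<open>K\<close>.\<close>
  consider "0 \<le> a" "0 \<le> b" "0 \<le> x - a - b" | "0 \<le> a" "0 \<le> b" "x - a - b \<le> 0"
    | "0 \<le> a" "b \<le> 0" "0 \<le> x - a - b" | "0 \<le> a" "b \<le> 0" "x - a - b \<le> 0"
    | "a \<le> 0" "0 \<le> b" "0 \<le> x - a - b" | "a \<le> 0" "0 \<le> b" "x - a - b \<le> 0" | "a \<le> 0" "b \<le> 0"
    by linarith
  then show "rp a b \<in> K"
  proof cases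
    case 1
    then show ?thesis using corners central_hull[OF nx(2)] by (intro inK) auto
  next
    case 2
    then show ?thesis using corners P ab by (intro inK[OF _ sector_hull(2)]) auto
  next
    case 3
    then show ?thesis using corners P ab by (intro inK[OF _ sector_hull(4)]) auto
  next
    case 4
    then show ?thesis using corners P ab by (intro inK[OF _ sector_hull(3)]) auto
  next
    case 5
    then show ?thesis using corners P ab by (intro inK[OF _ sector_hull(6)]) auto
  next
    case 6
    then show ?thesis using corners P ab by (intro inK[OF _ sector_hull(1)]) auto
  next
    case 7
    then show ?thesis using corners P ab nx by (intro inK[OF _ sector_hull(5)]) auto
  qed
qed (use nx in \<open>auto simp: convex_region\<close>)

end

subsection \<open>Unit triangles as cells\<close>

definition cells :: "nat \<Rightarrow> cell set" where
  "cells x = {(a, b, c). a + b + c = int x - 1 \<or> a + b + c = int x - 2}"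

text \<open>The first branch is the up-pointing triangle with bottom-left vertex
  \<open>(a, b)\<close>, the second the down-pointing one with top-left vertex
  \<open>(a, b + 1)\<close>.\<close>

definition tri :: "nat \<Rightarrow> cell \<Rightarrow> complex set" where
  "tri x = (\<lambda>(a, b, c). if a + b + c = int x - 1 then {rp a b, rp (a + 1) b, rp a (b + 1)}
     else {rp a (b + 1), rp (a + 1) (b + 1), rp (a + 1) b})"

lemma cells_sum: "(a, b, c) \<in> cells x \<Longrightarrow> a + b + c = int x - 1 \<or> a + b + c = int x - 2"
  by (simp add: cells_def)

text \<open>The vertices of either kind of triangle are the lattice points of the closed unit box of
  the cell, which makes both orientations accessible to linear arithmetic at once.\<close>

lemma rp_in_tri_iff:
  assumes "(a, b, c) \<in> cells x"
  shows "rp (of_int u) (of_int v) \<in> tri x (a, b, c) \<longleftrightarrow>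
    a \<le> u \<and> u \<le> a + 1 \<and> b \<le> v \<and> v \<le> b + 1 \<and> c \<le> int x - u - v \<and> int x - u - v \<le> c + 1"
proof -
  have eq: "rp (of_int u) (of_int v) = rp (of_int p) (of_int q) \<longleftrightarrow> u = p \<and> v = q" for p q :: int by simp
  have "rp (of_int u) (of_int v) \<in> tri x (a, b, c) \<longleftrightarrow>
      (if a + b + c = int x - 1 then u = a \<and> v = b \<or> u = a + 1 \<and> v = b \<or> u = a \<and> v = b + 1
       else u = a \<and> v = b + 1 \<or> u = a + 1 \<and> v = b + 1 \<or> u = a + 1 \<and> v = b)"
    using eq[of a b] eq[of "a + 1" b] eq[of a "b + 1"] eq[of "a + 1" "b + 1"] by (simp add: tri_def)
  also have "\<dots> \<longleftrightarrow>
      a \<le> u \<and> u \<le> a + 1 \<and> b \<le> v \<and> v \<le> b + 1 \<and> c \<le> int x - u - v \<and> int x - u - v \<le> c + 1"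
    using assms by (auto simp: cells_def)
  finally show ?thesis .
qed

lemma tri_lattice_points:
  assumes "z \<in> tri x p"
  obtains u v :: int where "z = rp (of_int u) (of_int v)"
proof -
  obtain a b c where p: "p = (a, b, c)" by (metis prod_cases3)
  from assms have "z \<in> {rp (of_int a) (of_int b), rp (of_int (a + 1)) (of_int b),
      rp (of_int a) (of_int (b + 1)), rp (of_int (a + 1)) (of_int (b + 1))}"
    unfolding p tri_def by (auto split: if_splits)
  then show thesis using that by blast
qed

text \<open>Each of the six bounds is attained at a vertex; hence a triangle determines its cell,
  and it lies in a box exactly when its cell's intervals do.\<close>

lemma tri_vertices:
  assumes "(a, b, c) \<in> cells x"
  shows "\<exists>u v. rp (of_int u) (of_int v) \<in> tri x (a, b, c) \<and> u = a"
    and "\<exists>u v. rp (of_int u) (of_int v) \<in> tri x (a, b, c) \<and> u = a + 1"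
    and "\<exists>u v. rp (of_int u) (of_int v) \<in> tri x (a, b, c) \<and> v = b"
    and "\<exists>u v. rp (of_int u) (of_int v) \<in> tri x (a, b, c) \<and> v = b + 1"
    and "\<exists>u v. rp (of_int u) (of_int v) \<in> tri x (a, b, c) \<and> int x - u - v = c"
    and "\<exists>u v. rp (of_int u) (of_int v) \<in> tri x (a, b, c) \<and> int x - u - v = c + 1"
  using cells_sum[OF assms] unfolding rp_in_tri_iff[OF assms] by presburger+

lemma tri_subset_region_iff:
  fixes la ha lb hb lc hc :: int
  assumes "(a, b, c) \<in> cells x"
  shows "tri x (a, b, c) \<subseteq> region x (of_int la, of_int ha) (of_int lb, of_int hb) (of_int lc, of_int hc) \<longleftrightarrow>
    la \<le> a \<and> a + 1 \<le> ha \<and> lb \<le> b \<and> b + 1 \<le> hb \<and> lc \<le> c \<and> c + 1 \<le> hc"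
proof -
  have mem: "rp (of_int u) (of_int v) \<in> region x (of_int la, of_int ha) (of_int lb, of_int hb) (of_int lc, of_int hc) \<longleftrightarrow>
      la \<le> u \<and> u \<le> ha \<and> lb \<le> v \<and> v \<le> hb \<and> lc \<le> int x - u - v \<and> int x - u - v \<le> hc" for u v :: int
  proof -
    have "real x - of_int u - of_int v = of_int (int x - u - v)" by simp
    then show ?thesis by (simp only: rp_in_region of_int_le_iff)
  qed
  show ?thesis
  proof
    assume sub: "tri x (a, b, c) \<subseteq> region x (of_int la, of_int ha) (of_int lb, of_int hb) (of_int lc, of_int hc)"
    have bounds: "la \<le> u \<and> u \<le> ha \<and> lb \<le> v \<and> v \<le> hb \<and> lc \<le> int x - u - v \<and> int x - u - v \<le> hc"
      if "rp (of_int u) (of_int v) \<in> tri x (a, b, c)" for u v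
      using mem[of u v] subsetD[OF sub that] by simp
    have "la \<le> a" using tri_vertices(1)[OF assms] bounds by auto
    moreover have "a + 1 \<le> ha" using tri_vertices(2)[OF assms] bounds by auto
    moreover have "lb \<le> b" using tri_vertices(3)[OF assms] bounds by auto
    moreover have "b + 1 \<le> hb" using tri_vertices(4)[OF assms] bounds by auto
    moreover have "lc \<le> c" using tri_vertices(5)[OF assms] bounds by auto
    moreover have "c + 1 \<le> hc" using tri_vertices(6)[OF assms] bounds by metis
    ultimately show "la \<le> a \<and> a + 1 \<le> ha \<and> lb \<le> b \<and> b + 1 \<le> hb \<and> lc \<le> c \<and> c + 1 \<le> hc" by blast
  next
    assume b: "la \<le> a \<and> a + 1 \<le> ha \<and> lb \<le> b \<and> b + 1 \<le> hb \<and> lc \<le> c \<and> c + 1 \<le> hc"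
    show "tri x (a, b, c) \<subseteq> region x (of_int la, of_int ha) (of_int lb, of_int hb) (of_int lc, of_int hc)"
    proof
      fix z assume z: "z \<in> tri x (a, b, c)"
      then obtain u v :: int where uv: "z = rp (of_int u) (of_int v)" by (rule tri_lattice_points)
      then show "z \<in> region x (of_int la, of_int ha) (of_int lb, of_int hb) (of_int lc, of_int hc)"
        using z rp_in_tri_iff[OF assms, of u v] mem[of u v] b unfolding uv by linarith
    qed
  qed
qed

lemma inj_on_tri: "inj_on (tri x) (cells x)"
proof (rule inj_onI)
  fix p q assume pq: "p \<in> cells x" "q \<in> cells x" "tri x p = tri x q"
  obtain a b c a' b' c' where abc: "p = (a, b, c)" "q = (a', b', c')" by (metis prod_cases3)
  have "a' \<le> a \<and> a + 1 \<le> a' + 1 \<and> b' \<le> b \<and> b + 1 \<le> b' + 1 \<and> c' \<le> c \<and> c + 1 \<le> c' + 1"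
    using tri_vertices[of a b c x] rp_in_tri_iff[of a' b' c' x] pq unfolding abc by metis
  then show "p = q" unfolding abc by simp
qed

lemma unit_triangles_eq: "unit_triangles = tri x ` cells x"
proof -
  have up: "up_triangle (rp a b) = {rp a b, rp (a + 1) b, rp a (b + 1)}" for a b
    by (simp add: up_triangle_def rp_def algebra_simps)
  have down: "down_triangle (rp a b) = {rp a b, rp (a + 1) b, rp (a + 1) (b - 1)}" for a b
  proof -
    have "rp a b + cis (- pi / 3) = rp (a + 1) (b - 1)" unfolding cis_rp rp_add by simp
    moreover have "rp a b + 1 = rp (a + 1) b" by (simp add: rp_def)
    ultimately show ?thesis by (simp add: down_triangle_def)
  qed
  have lat: "tri_lattice = {rp (of_int a) (of_int b) | a b. True}"
    by (simp add: tri_lattice_def rp_def)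
  show ?thesis
  proof (intro equalityI subsetI)
    fix t assume "t \<in> unit_triangles"
    then consider (u) a b where "t = up_triangle (rp (of_int a) (of_int b))"
      | (d) a b where "t = down_triangle (rp (of_int a) (of_int b))"
      unfolding unit_triangles_def lat by blast
    then show "t \<in> tri x ` cells x"
    proof cases
      case u
      have "t = tri x (a, b, int x - 1 - a - b)" unfolding u up by (simp add: tri_def)
      moreover have "(a, b, int x - 1 - a - b) \<in> cells x" by (simp add: cells_def)
      ultimately show ?thesis by blast
    next
      case d
      \<comment> \<open>A down-pointing triangle is given by its top-left vertex, whose second
        coordinate is the upper end of the cell's interval.\<close>
      have "t = tri x (a, b - 1, int x - 1 - a - b)" unfolding d down by (simp add: tri_def)
      moreover have "(a, b - 1, int x - 1 - a - b) \<in> cells x" by (simp add: cells_def)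
      ultimately show ?thesis by blast
    qed
  next
    fix t assume "t \<in> tri x ` cells x"
    then obtain a b c where abc: "(a, b, c) \<in> cells x" "t = tri x (a, b, c)" by auto
    show "t \<in> unit_triangles"
    proof (cases "a + b + c = int x - 1")
      case True
      then have "t = up_triangle (rp (of_int a) (of_int b))" unfolding up abc(2) tri_def by simp
      moreover have "rp (of_int a) (of_int b) \<in> tri_lattice" unfolding lat by blast
      ultimately show ?thesis unfolding unit_triangles_def by blast
    next
      case False
      then have "t = down_triangle (rp (of_int a) (of_int (b + 1)))" unfolding down abc(2) tri_def by simp
      moreover have "rp (of_int a) (of_int (b + 1)) \<in> tri_lattice" unfolding lat by blast
      ultimately show ?thesis unfolding unit_triangles_def by blast
    qed
  qed
qed

lemma lattice_polygon_eq:
  fixes la ha lb hb lc hc :: int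
  assumes "convex hull P = region x (of_int la, of_int ha) (of_int lb, of_int hb) (of_int lc, of_int hc)"
  shows "lattice_polygon P = tri x ` {(a, b, c) \<in> cells x.
    la \<le> a \<and> a + 1 \<le> ha \<and> lb \<le> b \<and> b + 1 \<le> hb \<and> lc \<le> c \<and> c + 1 \<le> hc}"
proof -
  have "lattice_polygon P = tri x ` {p \<in> cells x. tri x p \<subseteq> region x (of_int la, of_int ha) (of_int lb, of_int hb) (of_int lc, of_int hc)}"
    unfolding lattice_polygon_def assms unit_triangles_eq[of x] by (rule Compr_image_eq)
  also have "{p \<in> cells x. tri x p \<subseteq> region x (of_int la, of_int ha) (of_int lb, of_int hb) (of_int lc, of_int hc)} = {(a, b, c) \<in> cells x.
    la \<le> a \<and> a + 1 \<le> ha \<and> lb \<le> b \<and> b + 1 \<le> hb \<and> lc \<le> c \<and> c + 1 \<le> hc}"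
  proof (rule Collect_cong)
    fix p :: cell
    obtain a b c where p: "p = (a, b, c)" by (metis prod_cases3)
    show "p \<in> cells x \<and> tri x p \<subseteq> region x (of_int la, of_int ha) (of_int lb, of_int hb) (of_int lc, of_int hc) \<longleftrightarrow>
        (case p of (a, b, c) \<Rightarrow> (a, b, c) \<in> cells x \<and>
          la \<le> a \<and> a + 1 \<le> ha \<and> lb \<le> b \<and> b + 1 \<le> hb \<and> lc \<le> c \<and> c + 1 \<le> hc)"
      unfolding p prod.case using tri_subset_region_iff[of a b c x la ha lb hb lc hc]
      by (cases "(a, b, c) \<in> cells x") simp_all
  qed
  finally show ?thesis .
qed

lemma card_tri: "card (tri x p) = 3"
  by (simp add: tri_def split: prod.splits)

text \<open>Two common vertices differ in at least two barycentric coordinates, and in each of these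
  the two cells must agree. The sums of the cells differ by at most one, so the last coordinate
  changes by one step.\<close>

lemma card_tri_Int_iff:
  assumes "p \<in> cells x" "q \<in> cells x"
  shows "card (tri x p \<inter> tri x q) = 2 \<longleftrightarrow> cell_adj p q"
proof -
  obtain a b c a' b' c' where abc: "p = (a, b, c)" "q = (a', b', c')" by (metis prod_cases3)
  note iff = rp_in_tri_iff[OF assms(1)[unfolded abc]] rp_in_tri_iff[OF assms(2)[unfolded abc]]
  have sums: "a + b + c = int x - 1 \<or> a + b + c = int x - 2" "a' + b' + c' = int x - 1 \<or> a' + b' + c' = int x - 2"
    using assms unfolding abc by (auto simp: cells_def)
  show ?thesis
  proof
    assume card: "card (tri x p \<inter> tri x q) = 2"
    then obtain y z where yz: "y \<noteq> z" "y \<in> tri x p" "y \<in> tri x q" "z \<in> tri x p" "z \<in> tri x q"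
      by (metis IntD1 IntD2 card_2_iff' )
    obtain u v :: int where y: "y = rp (of_int u) (of_int v)" using yz(2) by (rule tri_lattice_points)
    obtain u' v' :: int where z: "z = rp (of_int u') (of_int v')" using yz(4) by (rule tri_lattice_points)
    have ne: "u \<noteq> u' \<or> v \<noteq> v'" using yz(1) y z by auto
    have "p \<noteq> q" using card card_tri[of x p] by auto
    then have ne': "a \<noteq> a' \<or> b \<noteq> b' \<or> c \<noteq> c'" unfolding abc by auto
    have bds: "a \<le> u \<and> u \<le> a + 1 \<and> b \<le> v \<and> v \<le> b + 1 \<and> c \<le> int x - u - v \<and> int x - u - v \<le> c + 1"
      "a' \<le> u \<and> u \<le> a' + 1 \<and> b' \<le> v \<and> v \<le> b' + 1 \<and> c' \<le> int x - u - v \<and> int x - u - v \<le> c' + 1"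
      "a \<le> u' \<and> u' \<le> a + 1 \<and> b \<le> v' \<and> v' \<le> b + 1 \<and> c \<le> int x - u' - v' \<and> int x - u' - v' \<le> c + 1"
      "a' \<le> u' \<and> u' \<le> a' + 1 \<and> b' \<le> v' \<and> v' \<le> b' + 1 \<and> c' \<le> int x - u' - v' \<and> int x - u' - v' \<le> c' + 1"
      using yz iff unfolding abc y z by blast+
    \<comment> \<open>Unit intervals with integer ends that share two integers coincide.\<close>
    have uniq: "l = m" if "l \<le> s" "s \<le> l + 1" "m \<le> s" "s \<le> m + 1" "l \<le> t" "t \<le> l + 1" "m \<le> t" "t \<le> m + 1"
      "s \<noteq> t" for l m s t :: int
      using that by linarith
    have "u \<noteq> u' \<Longrightarrow> a = a'"
      by (rule uniq[of a u a' u']) (use bds in blast)+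
    moreover have "v \<noteq> v' \<Longrightarrow> b = b'"
      by (rule uniq[of b v b' v']) (use bds in blast)+
    moreover have "int x - u - v \<noteq> int x - u' - v' \<Longrightarrow> c = c'"
      by (rule uniq[of c "int x - u - v" c' "int x - u' - v'"]) (use bds in blast)+
    \<comment> \<open>The coordinates of a point sum to \<open>x\<close>, so distinct points cannot
      agree in two of them.\<close>
    ultimately have two_eq: "a = a' \<and> b = b' \<or> a = a' \<and> c = c' \<or> b = b' \<and> c = c'" using ne by (cases "u = u'"; cases "v = v'") auto
    have abs1: "\<bar>d\<bar> = 1" if "d \<noteq> 0" "d \<le> 1" "- 1 \<le> d" for d :: int using that by linarith
    have diff: "a' + b' + c' - (a + b + c) \<le> 1" "- 1 \<le> a' + b' + c' - (a + b + c)" using sums by linarith+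
    from two_eq have "\<bar>a' - a\<bar> = 1 \<and> b' = b \<and> c' = c \<or> a' = a \<and> \<bar>b' - b\<bar> = 1 \<and> c' = c \<or> a' = a \<and> b' = b \<and> \<bar>c' - c\<bar> = 1"
    proof (elim disjE conjE)
      assume "a = a'" "b = b'"
      then show ?thesis using abs1[of "c' - c"] diff ne' by simp
    next
      assume "a = a'" "c = c'"
      then show ?thesis using abs1[of "b' - b"] diff ne' by simp
    next
      assume "b = b'" "c = c'"
      then show ?thesis using abs1[of "a' - a"] diff ne' by simp
    qed
    then show "cell_adj p q" unfolding abc cell_adj_def by simp
  next
    assume "cell_adj p q"
    then have adj: "\<bar>a' - a\<bar> = 1 \<and> b' = b \<and> c' = c \<or> a' = a \<and> \<bar>b' - b\<bar> = 1 \<and> c' = c \<or> a' = a \<and> b' = b \<and> \<bar>c' - c\<bar> = 1"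
      unfolding abc cell_adj_def by simp
    have mem: "rp (of_int u) (of_int v) \<in> tri x p \<inter> tri x q \<longleftrightarrow>
        (a \<le> u \<and> u \<le> a + 1 \<and> b \<le> v \<and> v \<le> b + 1 \<and> c \<le> int x - u - v \<and> int x - u - v \<le> c + 1) \<and>
        (a' \<le> u \<and> u \<le> a' + 1 \<and> b' \<le> v \<and> v \<le> b' + 1 \<and> c' \<le> int x - u - v \<and> int x - u - v \<le> c' + 1)"
      for u v :: int
      unfolding abc Int_iff iff ..
    have two: "card (tri x p \<inter> tri x q) = 2"
      if "\<And>u v. rp (of_int u) (of_int v) \<in> tri x p \<inter> tri x q \<longleftrightarrow> u = u1 \<and> v = v1 \<or> u = u2 \<and> v = v2"
        "(u1, v1) \<noteq> (u2, v2)" for u1 v1 u2 v2 :: int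
    proof -
      have "tri x p \<inter> tri x q = {rp (of_int u1) (of_int v1), rp (of_int u2) (of_int v2)}"
      proof (rule set_eqI)
        fix z
        show "z \<in> tri x p \<inter> tri x q \<longleftrightarrow> z \<in> {rp (of_int u1) (of_int v1), rp (of_int u2) (of_int v2)}"
        proof
          assume z: "z \<in> tri x p \<inter> tri x q"
          then obtain u v :: int where uv: "z = rp (of_int u) (of_int v)" using tri_lattice_points by blast
          then show "z \<in> {rp (of_int u1) (of_int v1), rp (of_int u2) (of_int v2)}"
            using that(1)[of u v] z by auto
        qed (use that(1)[of u1 v1] that(1)[of u2 v2] in auto)
      qed
      then show ?thesis using that(2) by simp
    qed
    consider "a' = a + 1" "b' = b" "c' = c" "a + b + c = int x - 2" | "a = a' + 1" "b' = b" "c' = c" "a + b + c = int x - 1"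
      | "a' = a" "b' = b + 1" "c' = c" "a + b + c = int x - 2" | "a' = a" "b = b' + 1" "c' = c" "a + b + c = int x - 1"
      | "a' = a" "b' = b" "c' = c + 1" "a + b + c = int x - 2" | "a' = a" "b' = b" "c = c' + 1" "a + b + c = int x - 1"
      using adj sums by (auto simp: abs_if split: if_splits)
    then show "card (tri x p \<inter> tri x q) = 2"
    proof cases
      case 1
      show ?thesis by (rule two[of "a + 1" b "a + 1" "b + 1"], unfold mem) (use 1 in auto)
    next
      case 2
      show ?thesis by (rule two[of a b a "b + 1"], unfold mem) (use 2 in auto)
    next
      case 3
      show ?thesis by (rule two[of a "b + 1" "a + 1" "b + 1"], unfold mem) (use 3 in auto)
    next
      case 4
      show ?thesis by (rule two[of a b "a + 1" b], unfold mem) (use 4 in auto)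
    next
      case 5
      show ?thesis by (rule two[of a "b + 1" "a + 1" b], unfold mem) (use 5 in auto)
    next
      case 6
      show ?thesis by (rule two[of a "b + 1" "a + 1" b], unfold mem) (use 6 in auto)
    qed
  qed
qed

subsection \<open>The snowflake regions as sets of cells\<close>

lemma hex_cells_subset: "hex_cells n x \<subseteq> cells x"
  by (auto simp: hex_cells_def cells_def)

lemma subregion_eq:
  assumes "i \<in> {1..6}"
  shows "subregion n x i = tri x ` {p \<in> hex_cells n x. sector_of p = i}"
proof -
  define lo hi where "lo = - int n" and "hi = int n + int x"
  have poly: "lattice_polygon P = tri x ` {p \<in> hex_cells n x. sector_of p = i}"
    if hull: "convex hull P = region (real x) (of_int la, of_int ha) (of_int lb, of_int hb) (of_int lc, of_int hc)"
      and iff: "\<And>a b c. (a, b, c) \<in> cells x \<Longrightarrow>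
        la \<le> a \<and> a + 1 \<le> ha \<and> lb \<le> b \<and> b + 1 \<le> hb \<and> lc \<le> c \<and> c + 1 \<le> hc \<longleftrightarrow>
        (a, b, c) \<in> hex_cells n x \<and> sector_of (a, b, c) = i"
    for P la ha lb hb lc hc i
  proof -
    have "{(a, b, c) \<in> cells x. la \<le> a \<and> a + 1 \<le> ha \<and> lb \<le> b \<and> b + 1 \<le> hb \<and> lc \<le> c \<and> c + 1 \<le> hc}
        = {p \<in> hex_cells n x. sector_of p = i}"
      using iff hex_cells_subset[of n x] by auto
    then show ?thesis unfolding lattice_polygon_eq[OF hull] by simp
  qed
  have hull: "convex hull P = region (real x) (of_int la, of_int ha) (of_int lb, of_int hb) (of_int lc, of_int hc)"
    if "convex hull P = region (real x) (la', ha') (lb', hb') (lc', hc')" "la' = of_int la" "ha' = of_int ha"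
      "lb' = of_int lb" "hb' = of_int hb" "lc' = of_int lc" "hc' = of_int hc"
    for P la ha lb hb lc hc la' ha' lb' hb' lc' hc'
    using that by simp
  \<comment> \<open>The index lists given to \<open>bd\<close> below name the lower and upper bounds
    of the three coordinates in turn: 1 stands for \<open>- n\<close>, 2 for \<open>n + x\<close>
    and 3 for 0.\<close>
  have bd: "- real n = of_int lo" "real n + real x = of_int hi" "(0 :: real) = of_int 0" by (simp_all add: lo_def hi_def)
  have nx: "0 \<le> real n" "0 \<le> real x" by auto
  note S = sector_hull[OF nx]
  have suc: "(1::nat) + 1 = 2" "(2::nat) + 1 = 3" "(3::nat) + 1 = 4" "(4::nat) + 1 = 5" "(5::nat) + 1 = 6" "(6::nat) + 1 = 7"
    by simp_all
  show ?thesis using assms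
  proof (cases rule: sector_cases)
    case 1
    show ?thesis unfolding 1 subregion_def suc corner_rp hex_vertex_rp of_nat_add
      by (rule poly[OF hull[OF S(1) bd(1,3,3,2,1,3)]])
         (auto simp: lo_def hi_def cells_def hex_cells_def sector_of_def split: if_splits)
  next
    case 2
    show ?thesis unfolding 2 subregion_def suc corner_rp hex_vertex_rp of_nat_add
      by (rule poly[OF hull[OF S(2) bd(3,2,3,2,1,3)]])
         (auto simp: lo_def hi_def cells_def hex_cells_def sector_of_def split: if_splits)
  next
    case 3
    show ?thesis unfolding 3 subregion_def suc corner_rp hex_vertex_rp of_nat_add
      by (rule poly[OF hull[OF S(3) bd(3,2,1,3,1,3)]])
         (auto simp: lo_def hi_def cells_def hex_cells_def sector_of_def split: if_splits)
  next
    case 4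
    show ?thesis unfolding 4 subregion_def suc corner_rp hex_vertex_rp of_nat_add
      by (rule poly[OF hull[OF S(4) bd(3,2,1,3,3,2)]])
         (auto simp: lo_def hi_def cells_def hex_cells_def sector_of_def split: if_splits)
  next
    case 5
    show ?thesis unfolding 5 subregion_def suc corner_rp hex_vertex_rp of_nat_add
      by (rule poly[OF hull[OF S(5) bd(1,3,1,3,3,2)]])
         (auto simp: lo_def hi_def cells_def hex_cells_def sector_of_def split: if_splits)
  next
    case 6
    show ?thesis unfolding 6 subregion_def suc corner_rp hex_vertex_rp of_nat_add
      by (rule poly[OF hull[OF S(6) bd(1,3,3,2,3,2)]])
         (auto simp: lo_def hi_def cells_def hex_cells_def sector_of_def split: if_splits)
  qed
qed

lemma hexagon_minus_centre:
  "lattice_polygon (hex_vertex n x ` {1..6}) - lattice_polygon {top_corner x, left_corner x, right_corner x}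
    = tri x ` hex_cells n x"
proof -
  define lo hi where "lo = - int n" and "hi = int n + int x"
  have nx: "0 \<le> real n" "0 \<le> real x" by auto
  have bd: "- real n = of_int lo" "real n + real x = of_int hi" by (simp_all add: lo_def hi_def)
  have hex: "convex hull (hex_vertex n x ` {1..6})
      = region (real x) (of_int lo, of_int hi) (of_int lo, of_int hi) (of_int lo, of_int hi)"
    unfolding hex_vertices of_nat_add hexagon_hull[OF nx] unfolding bd ..
  have cen: "convex hull {top_corner x, left_corner x, right_corner x}
      = region (real x) (of_int 0, of_int (int x)) (of_int 0, of_int (int x)) (of_int 0, of_int (int x))"
    unfolding central_corner_rp using central_hull[OF nx(2)] by simp
  show ?thesis
    unfolding lattice_polygon_eq[OF hex] lattice_polygon_eq[OF cen]
    by (subst inj_on_image_set_diff[OF inj_on_tri, symmetric])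
       (auto simp: lo_def hi_def cells_def hex_cells_def intro!: image_cong)
qed

lemma of_nat_pred: "k \<ge> 1 \<Longrightarrow> (of_nat k - 1 :: complex) = of_nat (k - 1)"
  by (simp add: of_nat_diff)

lemma seg_unit_rp:
  assumes "k \<ge> 1"
  shows "seg_unit x 1 k = {rp (of_int (1 - int k)) (of_int (int x + int k - 1)), rp (of_int (- int k)) (of_int (int x + int k))}"
    "seg_unit x 2 k = {rp (of_int 0) (of_int (int x + int k - 1)), rp (of_int 0) (of_int (int x + int k))}"
    "seg_unit x 3 k = {rp (of_int (int x + int k - 1)) (of_int 0), rp (of_int (int x + int k)) (of_int 0)}"
    "seg_unit x 4 k = {rp (of_int (int x + int k - 1)) (of_int (1 - int k)), rp (of_int (int x + int k)) (of_int (- int k))}"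
    "seg_unit x 5 k = {rp (of_int 0) (of_int (1 - int k)), rp (of_int 0) (of_int (- int k))}"
    "seg_unit x 6 k = {rp (of_int (1 - int k)) (of_int 0), rp (of_int (- int k)) (of_int 0)}"
    "seg_unit x 7 k = {rp (of_int (1 - int k)) (of_int (int x + int k - 1)), rp (of_int (- int k)) (of_int (int x + int k))}"
  using assms unfolding seg_unit_def seg_dir_rp corner_rp of_nat_pred[OF assms] rp_scale_nat rp_add
  by (simp_all add: of_nat_diff algebra_simps)

text \<open>One coordinate of the test whether a unit segment is an edge of a cell. If the
  coordinate changes along the segment, it determines \<open>l\<close>; if it is constant, two
  values of \<open>l\<close> remain, one for each side of the segment.\<close>

definition pin :: "int \<Rightarrow> int \<Rightarrow> int \<Rightarrow> bool" where
  "pin l u v \<longleftrightarrow> l \<le> u \<and> u \<le> l + 1 \<and> l \<le> v \<and> v \<le> l + 1"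

lemma pin_iff:
  "v = u - 1 \<Longrightarrow> pin l u v \<longleftrightarrow> l = v"
  "v = u + 1 \<Longrightarrow> pin l u v \<longleftrightarrow> l = u"
  "v = u \<Longrightarrow> pin l u v \<longleftrightarrow> l = u \<or> l = u - 1"
  unfolding pin_def by linarith+

lemma rp_pair_subset_tri_iff:
  assumes "(a, b, c) \<in> cells x" "w = int x - u - v" "w' = int x - u' - v'"
  shows "{rp (of_int u) (of_int v), rp (of_int u') (of_int v')} \<subseteq> tri x (a, b, c) \<longleftrightarrow>
    pin a u u' \<and> pin b v v' \<and> pin c w w'"
  unfolding insert_subset rp_in_tri_iff[OF assms(1)] pin_def assms(2,3) by auto

lemma seg_unit_subset_tri:
  assumes cell: "(a, b, c) \<in> cells x" and k: "k \<ge> 1"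
  shows "seg_unit x 1 k \<subseteq> tri x (a, b, c) \<longleftrightarrow> a = - int k \<and> b = int x + int k - 1 \<and> (c = 0 \<or> c = - 1)"
    "seg_unit x 2 k \<subseteq> tri x (a, b, c) \<longleftrightarrow> (a = 0 \<or> a = - 1) \<and> b = int x + int k - 1 \<and> c = - int k"
    "seg_unit x 3 k \<subseteq> tri x (a, b, c) \<longleftrightarrow> a = int x + int k - 1 \<and> (b = 0 \<or> b = - 1) \<and> c = - int k"
    "seg_unit x 4 k \<subseteq> tri x (a, b, c) \<longleftrightarrow> a = int x + int k - 1 \<and> b = - int k \<and> (c = 0 \<or> c = - 1)"
    "seg_unit x 5 k \<subseteq> tri x (a, b, c) \<longleftrightarrow> (a = 0 \<or> a = - 1) \<and> b = - int k \<and> c = int x + int k - 1"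
    "seg_unit x 6 k \<subseteq> tri x (a, b, c) \<longleftrightarrow> a = - int k \<and> (b = 0 \<or> b = - 1) \<and> c = int x + int k - 1"
    "seg_unit x 7 k \<subseteq> tri x (a, b, c) \<longleftrightarrow> a = - int k \<and> b = int x + int k - 1 \<and> (c = 0 \<or> c = - 1)"
  unfolding seg_unit_rp[OF k] rp_pair_subset_tri_iff[OF cell refl refl] by (simp_all add: pin_iff) auto

text \<open>A unit segment is an edge of two cells, which differ in one coordinate being 0 or -1.
  The signs in sector \<open>i\<close> select one of them.\<close>

lemma seg_unit_subset_tri_iff:
  assumes i: "i \<in> {1..6}" and p: "p \<in> hex_cells n x" "sector_of p = i" and k: "k \<ge> 1"
  shows "seg_unit x i k \<subseteq> tri x p \<longleftrightarrow> p = acell x i k"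
    and "seg_unit x (i + 1) k \<subseteq> tri x p \<longleftrightarrow> p = bcell x i k"
proof -
  obtain a b c where abc: "p = (a, b, c)" by (metis prod_cases3)
  have cell: "(a, b, c) \<in> cells x" using p hex_cells_subset unfolding abc by blast
  have suc: "(1::nat) + 1 = 2" "(2::nat) + 1 = 3" "(3::nat) + 1 = 4" "(4::nat) + 1 = 5" "(5::nat) + 1 = 6" "(6::nat) + 1 = 7"
    by simp_all
  note simps = seg_unit_subset_tri[OF cell k] acell_simps[OF k] bcell_simps[OF k] prod.inject
  have "(seg_unit x i k \<subseteq> tri x p \<longleftrightarrow> p = acell x i k) \<and> (seg_unit x (i + 1) k \<subseteq> tri x p \<longleftrightarrow> p = bcell x i k)"
    using i
  proof (cases rule: sector_cases)
    case 1
    have "sector_of (a, b, c) = 1" using p(2) unfolding abc 1 .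
    then have "a < 0 \<and> c < 0" by (auto simp: sector_of_def split: if_splits)
    then show ?thesis unfolding abc 1 suc simps using k by auto
  next
    case 2
    have "sector_of (a, b, c) = 2" using p(2) unfolding abc 2 .
    then have "0 \<le> a \<and> 0 \<le> b" by (auto simp: sector_of_def split: if_splits)
    then show ?thesis unfolding abc 2 suc simps using k by auto
  next
    case 3
    have "sector_of (a, b, c) = 3" using p(2) unfolding abc 3 .
    then have "b < 0 \<and> c < 0" by (auto simp: sector_of_def split: if_splits)
    then show ?thesis unfolding abc 3 suc simps using k by auto
  next
    case 4
    have "sector_of (a, b, c) = 4" using p(2) unfolding abc 4 .
    then have "0 \<le> a \<and> 0 \<le> c" by (auto simp: sector_of_def split: if_splits)
    then show ?thesis unfolding abc 4 suc simps using k by auto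
  next
    case 5
    have "sector_of (a, b, c) = 5" using p(2) unfolding abc 5 .
    then have "a < 0 \<and> b < 0" by (auto simp: sector_of_def split: if_splits)
    then show ?thesis unfolding abc 5 suc simps using k by auto
  next
    case 6
    have "sector_of (a, b, c) = 6" using p(2) unfolding abc 6 .
    then have "0 \<le> b \<and> 0 \<le> c" by (auto simp: sector_of_def split: if_splits)
    then show ?thesis unfolding abc 6 suc simps using k by auto
  qed
  then show "seg_unit x i k \<subseteq> tri x p \<longleftrightarrow> p = acell x i k" "seg_unit x (i + 1) k \<subseteq> tri x p \<longleftrightarrow> p = bcell x i k"
    by auto
qed

lemma unit_holes_eq:
  assumes i: "i \<in> {1..6}" and K: "K \<subseteq> {1..n}"
  shows "unit_holes n x i i K = tri x ` acell x i ` K" "unit_holes n x i (i + 1) K = tri x ` bcell x i ` K"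
proof -
  let ?S = "{p \<in> hex_cells n x. sector_of p = i}"
  have holes: "{p \<in> ?S. \<exists>k\<in>K. Q k p} = f ` K"
    if Q: "\<And>p k. p \<in> hex_cells n x \<Longrightarrow> sector_of p = i \<Longrightarrow> k \<ge> 1 \<Longrightarrow> Q k p \<longleftrightarrow> p = f k"
      and f: "\<And>k. k \<in> {1..n} \<Longrightarrow> f k \<in> hex_cells n x \<and> sector_of (f k) = i" for Q f
  proof (intro equalityI subsetI)
    fix p assume "p \<in> {p \<in> ?S. \<exists>k\<in>K. Q k p}"
    then obtain k where "p \<in> hex_cells n x" "sector_of p = i" "k \<in> K" "Q k p" by blast
    then show "p \<in> f ` K" using Q[of p k] K by auto
  next
    fix p assume "p \<in> f ` K"
    then obtain k where k: "k \<in> K" "p = f k" by blast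
    then have "p \<in> hex_cells n x" "sector_of p = i" "k \<ge> 1" using f[of k] K by auto
    then show "p \<in> {p \<in> ?S. \<exists>k\<in>K. Q k p}" using Q[of p k] k by blast
  qed
  show "unit_holes n x i i K = tri x ` acell x i ` K"
    unfolding unit_holes_def subregion_eq[OF i] Compr_image_eq
    by (subst holes[of _ "acell x i"]) (use seg_unit_subset_tri_iff(1)[OF i] cell_in_sector[OF i] in blast)+
  show "unit_holes n x i (i + 1) K = tri x ` bcell x i ` K"
    unfolding unit_holes_def subregion_eq[OF i] Compr_image_eq
    by (subst holes[of _ "bcell x i"]) (use seg_unit_subset_tri_iff(2)[OF i] cell_in_sector[OF i] in blast)+
qed

context snowflake_cells
begin

lemma Union_parts:
  "(\<Union>i\<in>{1..6}. part i) = hex_cells n x - (\<Union>i\<in>{1..6}. acell x i ` A i \<union> bcell x i ` B i)"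
proof (rule set_eqI)
  fix p
  have sec: "sector_of p \<in> {1..6}" by (auto simp: sector_of_def split: prod.splits)
  let ?H = "\<lambda>i. acell x i ` A i \<union> bcell x i ` B i"
  have only: "p \<in> (\<Union>i\<in>{1..6}. F i) \<longleftrightarrow> p \<in> F (sector_of p)"
    if F: "\<And>i. i \<in> {1..6} \<Longrightarrow> p \<in> F i \<Longrightarrow> sector_of p = i" for F
  proof
    assume "p \<in> (\<Union>i\<in>{1..6}. F i)"
    then obtain i where "i \<in> {1..6}" "p \<in> F i" by (rule UN_E)
    then show "p \<in> F (sector_of p)" using F[of i] by simp
  next
    assume "p \<in> F (sector_of p)"
    with sec show "p \<in> (\<Union>i\<in>{1..6}. F i)" by (rule UN_I)
  qed
  have "sector_of p = j" if j: "j \<in> {1..6}" and "p \<in> ?H j" for j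
  proof -
    from \<open>p \<in> ?H j\<close> obtain k where "k \<in> {1..n}" "p = acell x j k \<or> p = bcell x j k"
      using A[OF j] B[OF j] by blast
    then show ?thesis using cell_in_sector(2,4)[OF j] by metis
  qed
  then have "p \<in> (\<Union>i\<in>{1..6}. ?H i) \<longleftrightarrow> p \<in> ?H (sector_of p)" by (rule only)
  moreover have "p \<in> (\<Union>i\<in>{1..6}. part i) \<longleftrightarrow> p \<in> part (sector_of p)"
    by (rule only) (rule sector_of_part)
  moreover have "p \<in> part (sector_of p) \<longleftrightarrow> p \<in> hex_cells n x \<and> p \<notin> ?H (sector_of p)"
    by (simp add: part_def)
  ultimately show "p \<in> (\<Union>i\<in>{1..6}. part i) \<longleftrightarrow> p \<in> hex_cells n x - (\<Union>i\<in>{1..6}. ?H i)"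
    by (simp only: Diff_iff)
qed

lemma parts_subset_cells: "(\<Union>i\<in>{1..6}. part i) \<subseteq> cells x"
  using hex_cells_subset unfolding part_def by blast

lemma snowflake_eq: "snowflake n x A B = tri x ` (\<Union>i\<in>{1..6}. part i)"
proof -
  let ?H = "\<lambda>i. acell x i ` A i \<union> bcell x i ` B i"
  have holes: "unit_holes n x i i (A i) \<union> unit_holes n x i (i + 1) (B i) = tri x ` ?H i" if "i \<in> {1..6}" for i
    using unit_holes_eq[OF that A[OF that]] unit_holes_eq[OF that B[OF that]] by (simp add: image_Un)
  have sub: "(\<Union>i\<in>{1..6}. ?H i) \<subseteq> cells x"
  proof (rule UN_least)
    fix i :: nat assume i: "i \<in> {1..6}"
    have "acell x i k \<in> hex_cells n x" if "k \<in> A i" for k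
      using cell_in_sector(1)[OF i] A[OF i] that by blast
    moreover have "bcell x i k \<in> hex_cells n x" if "k \<in> B i" for k
      using cell_in_sector(3)[OF i] B[OF i] that by blast
    ultimately show "?H i \<subseteq> cells x" using hex_cells_subset[of n x] by auto
  qed
  have "tri x ` (hex_cells n x - (\<Union>i\<in>{1..6}. ?H i))
      = tri x ` hex_cells n x - tri x ` (\<Union>i\<in>{1..6}. ?H i)"
    by (rule inj_on_image_set_diff[OF inj_on_tri _ sub]) (rule subset_trans[OF Diff_subset hex_cells_subset])
  then show ?thesis
    unfolding snowflake_def hexagon_minus_centre Union_parts using holes by (simp add: image_UN)
qed

end

lemma lozenges_eq: "lozenges = pair_tiles (\<lambda>s t. s \<in> unit_triangles \<and> t \<in> unit_triangles \<and> card (s \<inter> t) = 2)"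
  unfolding lozenges_def pair_tiles_def ..

text \<open>The map \<mu> will be the identity for the snowflake and the rotation
  \<open>flip x\<close> for the flipped one.\<close>

lemma lozenge_image_iff:
  assumes "inj \<mu>" "\<And>t. t \<in> unit_triangles \<Longrightarrow> \<mu> ` t \<in> unit_triangles" "e \<subseteq> cells x"
  shows "e \<in> pair_tiles cell_adj \<longleftrightarrow> (\<lambda>p. \<mu> ` tri x p) ` e \<in> lozenges"
  unfolding lozenges_eq
proof (rule pair_tiles_image_iff[OF _ assms(3)])
  show "inj_on (\<lambda>p. \<mu> ` tri x p) (cells x)"
    using inj_on_tri[of x] assms(1) by (auto simp: inj_on_def inj_image_eq_iff)
  fix p q assume pq: "p \<in> cells x" "q \<in> cells x"
  then have "tri x p \<in> unit_triangles" "tri x q \<in> unit_triangles" using unit_triangles_eq[of x] by auto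
  moreover have "card (\<mu> ` tri x p \<inter> \<mu> ` tri x q) = card (tri x p \<inter> tri x q)"
    unfolding image_Int[OF assms(1), symmetric] by (rule card_image) (rule inj_on_subset[OF assms(1)], simp)
  ultimately show "\<mu> ` tri x p \<in> unit_triangles \<and> \<mu> ` tri x q \<in> unit_triangles
      \<and> card (\<mu> ` tri x p \<inter> \<mu> ` tri x q) = 2 \<longleftrightarrow> cell_adj p q"
    using assms(2) card_tri_Int_iff[OF pq] by auto
qed

lemma num_tilings_image:
  assumes "inj \<mu>" "\<And>t. t \<in> unit_triangles \<Longrightarrow> \<mu> ` t \<in> unit_triangles" "R \<subseteq> cells x"
  shows "num_tilings ((\<lambda>p. \<mu> ` tri x p) ` R) = card (tile_partitions (pair_tiles cell_adj) R)"
  unfolding num_tilings_def tilings_eq_tile_partitions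
proof (rule card_tile_partitions_image)
  show "inj_on (\<lambda>p. \<mu> ` tri x p) R"
    using inj_on_subset[OF inj_on_tri[of x] assms(3)] assms(1) by (auto simp: inj_on_def inj_image_eq_iff)
  show "e \<in> pair_tiles cell_adj \<longleftrightarrow> (\<lambda>p. \<mu> ` tri x p) ` e \<in> lozenges" if "e \<subseteq> R" for e
    using assms that by (intro lozenge_image_iff) auto
qed

definition rotate_centre :: "nat \<Rightarrow> complex \<Rightarrow> complex" where
  "rotate_centre x = rotation (rp (x / 3) (x / 3))"

text \<open>The rotation permutes the barycentric coordinates cyclically; on cells this is
  \<open>turn\<close> applied twice.\<close>

lemma rotate_centre_rp: "rotate_centre x (rp a b) = rp (x - a - b) a"
proof -
  have "rotate_centre x (rp a b) = rp (x / 3) (x / 3) + rp (- 1) 1 * rp (a - x / 3) (b - x / 3)"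
    unfolding rotate_centre_def rotation_def cis_rp(1)[symmetric] by (simp add: rp_def algebra_simps)
  also have "rp (- 1) 1 * rp (a - x / 3) (b - x / 3) = rp (- (a - x / 3) - (b - x / 3)) (a - x / 3)"
    by (simp add: complex_eq_iff Re_rp Im_rp algebra_simps) (simp add: field_simps)
  finally show ?thesis unfolding rp_add by (simp add: field_simps)
qed

lemma rotate_centre_tri:
  assumes "p \<in> cells x"
  shows "rotate_centre x ` tri x p = tri x (turn (turn p))"
proof -
  obtain a b c where abc: "p = (a, b, c)" by (metis prod_cases3)
  show ?thesis
  proof (cases "a + b + c = int x - 1")
    case True
    then have c: "real_of_int c = real x - 1 - of_int a - of_int b" by linarith
    have "c + a + b = int x - 1" using True by simp
    then show ?thesis using True unfolding abc
      by (simp add: tri_def turn_def rotate_centre_rp c insert_commute algebra_simps)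
  next
    case False
    then have s: "a + b + c = int x - 2" using assms unfolding abc by (auto simp: cells_def)
    then have c: "real_of_int c = real x - 2 - of_int a - of_int b" by linarith
    have "c + a + b \<noteq> int x - 1" using s by simp
    then show ?thesis using False unfolding abc
      by (simp add: tri_def turn_def rotate_centre_rp c insert_commute algebra_simps)
  qed
qed

text \<open>\<open>turn\<close> has order three, so it and its inverse
  \<open>turn \<circ> turn\<close> leave the same tilings invariant.\<close>

lemma turn_turn_invariant_iff: "(`) (turn \<circ> turn) ` T = T \<longleftrightarrow> (`) turn ` T = T"
proof -
  have t3: "(`) turn ` (`) turn ` (`) turn ` T = T" for T by (simp add: image_image)
  have t2: "(`) (turn \<circ> turn) ` T = (`) turn ` (`) turn ` T" for T by (simp add: image_image image_comp)
  show ?thesis unfolding t2 by (metis t3)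
qed

lemma num_sym_tilings_image:
  assumes "inj \<mu>" "\<And>t. t \<in> unit_triangles \<Longrightarrow> \<mu> ` t \<in> unit_triangles" "R \<subseteq> cells x" "turn ` R = R"
    and "\<And>z. rotation c (\<mu> z) = \<mu> (rotate_centre x z)"
  shows "num_sym_tilings c ((\<lambda>p. \<mu> ` tri x p) ` R)
    = card {T \<in> tile_partitions (pair_tiles cell_adj) R. (`) turn ` T = T}"
proof -
  have "rotate_region c = (`) ((`) (rotation c))" by (simp add: rotate_region_def fun_eq_iff)
  then have "num_sym_tilings c ((\<lambda>p. \<mu> ` tri x p) ` R)
      = card {T \<in> tile_partitions lozenges ((\<lambda>p. \<mu> ` tri x p) ` R). (`) ((`) (rotation c)) ` T = T}"
    unfolding num_sym_tilings_def sym_tilings_def tilings_eq_tile_partitions by simp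
  also have "\<dots> = card {T \<in> tile_partitions (pair_tiles cell_adj) R. (`) (turn \<circ> turn) ` T = T}"
  proof (rule card_sym_tile_partitions_image)
    show "inj_on (\<lambda>p. \<mu> ` tri x p) R"
      using inj_on_subset[OF inj_on_tri[of x] assms(3)] assms(1) by (auto simp: inj_on_def inj_image_eq_iff)
    show "e \<in> pair_tiles cell_adj \<longleftrightarrow> (\<lambda>p. \<mu> ` tri x p) ` e \<in> lozenges" if "e \<subseteq> R" for e
      using assms that by (intro lozenge_image_iff) auto
    show "(turn \<circ> turn) ` R = R" by (metis assms(4) image_comp)
    show "rotation c ` \<mu> ` tri x p = \<mu> ` tri x ((turn \<circ> turn) p)" if "p \<in> R" for p
    proof -
      have "rotation c ` \<mu> ` t = \<mu> ` rotate_centre x ` t" for t by (simp add: image_image assms(5))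
      then show ?thesis using rotate_centre_tri[of p x] that assms(3) by (simp add: subsetD)
    qed
  qed
  finally show ?thesis unfolding turn_turn_invariant_iff .
qed

subsection \<open>The flipped snowflake\<close>

text \<open>The counterclockwise rotation by 60 degrees about \<open>right_corner x\<close>. It
  takes the central triangle to the down-pointing triangle below its bottom side.\<close>

definition flip :: "nat \<Rightarrow> complex \<Rightarrow> complex" where
  "flip x z = rp x (- real x) + cis (pi / 3) * z"

lemma flip_rp: "flip x (rp a b) = rp (x - b) (a + b - x)"
  unfolding flip_def cis_60_mult_rp rp_add by simp

lemma inj_flip: "inj (flip x)"
  by (auto simp: inj_def flip_def)

lemma flip_tri:
  assumes "(a, b, c) \<in> cells x"
  shows "flip x ` tri x (a, b, c)
    = tri x (int x - b - 1, a + b - int x + (if a + b + c = int x - 1 then 0 else 1), int x - 1 - a)"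
proof (cases "a + b + c = int x - 1")
  case True
  then show ?thesis by (simp add: tri_def flip_rp algebra_simps insert_commute)
next
  case False
  then show ?thesis by (simp add: tri_def flip_rp algebra_simps insert_commute)
qed

lemma flip_unit_triangles: "(`) (flip x) ` unit_triangles = unit_triangles"
proof -
  have "flip x ` tri x p \<in> tri x ` cells x" if "p \<in> cells x" for p
  proof -
    obtain a b c where p: "p = (a, b, c)" by (metis prod_cases3)
    have "(int x - b - 1, a + b - int x + (if a + b + c = int x - 1 then 0 else 1), int x - 1 - a) \<in> cells x"
      by (simp add: cells_def)
    then show ?thesis using that unfolding p by (subst flip_tri) auto
  qed
  moreover have "\<exists>p\<in>cells x. tri x q = flip x ` tri x p" if q: "q \<in> cells x" for q
  proof -
    obtain a b c where abc: "q = (a, b, c)" by (metis prod_cases3)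
    \<comment> \<open>The inverse rotation on cells. It exchanges the two orientations, hence the
      sums \<open>x - 1\<close> and \<open>x - 2\<close>; this fixes the coordinate with the case
      distinction.\<close>
    define p where "p = (int x - 1 - c, int x - 1 - a, a + c - int x + (if a + b + c = int x - 1 then 0 else 1))"
    have p: "p \<in> cells x" by (simp add: p_def cells_def)
    have "flip x ` tri x p = tri x q" unfolding p_def abc
      by (subst flip_tri[OF p[unfolded p_def]], rule arg_cong[where f = "tri x"])
         (use q in \<open>auto simp: abc cells_def\<close>)
    then show ?thesis using p by blast
  qed
  ultimately show ?thesis unfolding unit_triangles_eq[of x] by (auto simp: image_iff)
qed

lemma convex_hull_flip: "convex hull (flip x ` P) = flip x ` (convex hull P)"
proof -
  have flip: "flip x ` S = (+) (rp x (- real x)) ` ((*) (cis (pi / 3)) ` S)" for S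
    by (simp add: flip_def image_image)
  show ?thesis unfolding flip
    by (simp add: convex_hull_translation convex_hull_linear_image[OF bounded_linear.linear[OF bounded_linear_mult_right]])
qed

lemma lattice_polygon_flip: "lattice_polygon (flip x ` P) = (`) (flip x) ` lattice_polygon P"
proof -
  have "lattice_polygon (flip x ` P) = {t \<in> (`) (flip x) ` unit_triangles. t \<subseteq> flip x ` (convex hull P)}"
    unfolding lattice_polygon_def convex_hull_flip flip_unit_triangles ..
  also have "\<dots> = (`) (flip x) ` {t \<in> unit_triangles. flip x ` t \<subseteq> flip x ` (convex hull P)}"
    by (rule Compr_image_eq)
  finally show ?thesis unfolding lattice_polygon_def inj_image_subset_iff[OF inj_flip] .
qed

lemma shift_vector_rp:
  "of_nat x * cis (- pi / 3) = rp x (- real x)" "of_nat x * cis (- 2 * pi / 3) = rp 0 (- real x)"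
  unfolding cis_rp rp_scale_nat by simp_all

lemma dendrite_shift_rp:
  "dendrite_shift x 1 = rp 0 (- real x)" "dendrite_shift x 2 = rp x (- real x)" "dendrite_shift x 3 = rp 0 0"
  "dendrite_shift x 4 = rp 0 (- real x)" "dendrite_shift x 5 = rp x (- real x)" "dendrite_shift x 6 = rp 0 0"
  "dendrite_shift x 7 = rp 0 (- real x)"
  unfolding dendrite_shift_def shift_vector_rp by (simp_all add: cis_rp(8)[symmetric])

lemma flipped_vertex_eq:
  assumes "i \<in> {1..6}"
  shows "flipped_vertex n x i = flip x (hex_vertex n x (next_sector i))"
  using assms
  by (cases rule: sector_cases)
     (simp_all only: flipped_vertex_def next_sector_simps hex_vertex_rp dendrite_shift_rp flip_rp rp_add rp_eq_iff, auto)

lemma next_sector_image: "next_sector ` {1..6} = {1..6}"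
  unfolding one_to_six image_insert image_empty next_sector_simps by auto

lemma inj_on_next_sector: "inj_on next_sector {1..6}"
  by (metis inj_onI sector_indices(4))

text \<open>Translating a hole with its dendrite has the same effect as taking the hole with the
  same label one sector further on and rotating it.\<close>

lemma shifted_holes:
  assumes i: "i \<in> {1..6}" and k: "k \<ge> 1"
  shows "(+) (dendrite_shift x i) ` tri x (acell x i k) = flip x ` tri x (acell x (next_sector i) k)"
    and "(+) (dendrite_shift x (i + 1)) ` tri x (bcell x i k) = flip x ` tri x (bcell x (next_sector i) k)"
proof -
  have suc: "(1::nat) + 1 = 2" "(2::nat) + 1 = 3" "(3::nat) + 1 = 4" "(4::nat) + 1 = 5" "(5::nat) + 1 = 6" "(6::nat) + 1 = 7"
    by simp_all
  note simps = suc next_sector_simps dendrite_shift_rp acell_simps[OF k] bcell_simps[OF k]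
  show "(+) (dendrite_shift x i) ` tri x (acell x i k) = flip x ` tri x (acell x (next_sector i) k)"
    using i by (cases rule: sector_cases)
      (simp_all only: simps, simp_all add: tri_def flip_rp rp_add insert_commute algebra_simps)
  show "(+) (dendrite_shift x (i + 1)) ` tri x (bcell x i k) = flip x ` tri x (bcell x (next_sector i) k)"
    using i by (cases rule: sector_cases)
      (simp_all only: simps, simp_all add: tri_def flip_rp rp_add insert_commute algebra_simps)
qed

text \<open>Hence every count for ordinary snowflakes applies to the flipped one, where the hole
  sets of the triangles now belong to trapezoids and conversely.\<close>

lemma flipped_snowflake_eq:
  assumes A: "\<And>i. i \<in> {1..6} \<Longrightarrow> A i \<subseteq> {1..n}" and B: "\<And>i. i \<in> {1..6} \<Longrightarrow> B i \<subseteq> {1..n}"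
  shows "flipped_snowflake n x A B
    = (`) (flip x) ` snowflake n x (\<lambda>i. A (prev_sector i)) (\<lambda>i. B (prev_sector i))"
proof -
  let ?F = "(`) (flip x)"
  let ?A = "\<lambda>i. A (prev_sector i)" and ?B = "\<lambda>i. B (prev_sector i)"
  let ?H = "\<lambda>i. unit_holes n x i i (?A i) \<union> unit_holes n x i (i + 1) (?B i)"
  let ?G = "\<lambda>i. translate_region (dendrite_shift x i) (unit_holes n x i i (A i))
    \<union> translate_region (dendrite_shift x (i + 1)) (unit_holes n x i (i + 1) (B i))"
  have images: "f ` g ` h ` K = f' ` g ` h' ` K" if "\<And>k. k \<in> K \<Longrightarrow> f (g (h k)) = f' (g (h' k))"
    for f f' :: "complex set \<Rightarrow> complex set" and g :: "cell \<Rightarrow> complex set" and h h' :: "nat \<Rightarrow> cell" and K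
    using that by (simp add: image_image)
  have "flipped_vertex n x ` {1..6} = (\<lambda>i. flip x (hex_vertex n x (next_sector i))) ` {1..6}"
    using flipped_vertex_eq by (intro image_cong) auto
  also have "\<dots> = flip x ` hex_vertex n x ` next_sector ` {1..6}" by (simp only: image_image)
  finally have hex: "flipped_vertex n x ` {1..6} = flip x ` hex_vertex n x ` {1..6}"
    unfolding next_sector_image .
  have cen: "{left_corner x, right_corner x, of_nat x * cis (- pi / 3)}
      = flip x ` {top_corner x, left_corner x, right_corner x}"
    unfolding central_corner_rp image_insert image_empty flip_rp shift_vector_rp by auto
  have holes: "?G i = ?F ` ?H (next_sector i)" if i: "i \<in> {1..6}" for i
  proof -
    note ni = sector_indices(1)[OF i]
    have "translate_region (dendrite_shift x i) (unit_holes n x i i (A i)) = ?F ` unit_holes n x (next_sector i) (next_sector i) (A i)"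
      unfolding unit_holes_eq[OF i A[OF i]] unit_holes_eq[OF ni A[OF i]] translate_region_def
      by (rule images, rule shifted_holes(1)[OF i]) (use A[OF i] in auto)
    moreover have "translate_region (dendrite_shift x (i + 1)) (unit_holes n x i (i + 1) (B i))
        = ?F ` unit_holes n x (next_sector i) (next_sector i + 1) (B i)"
      unfolding unit_holes_eq[OF i B[OF i]] unit_holes_eq[OF ni B[OF i]] translate_region_def
      by (rule images, rule shifted_holes(2)[OF i]) (use B[OF i] in auto)
    ultimately show ?thesis unfolding sector_indices(4)[OF i] image_Un by simp
  qed
  have "(\<Union>i\<in>{1..6}. ?G i) = (\<Union>i\<in>{1..6}. ?F ` ?H (next_sector i))"
    using holes by (intro SUP_cong) auto
  also have "\<dots> = (\<Union>i\<in>next_sector ` {1..6}. ?F ` ?H i)" by simp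
  also have "\<dots> = ?F ` (\<Union>i\<in>{1..6}. ?H i)" unfolding next_sector_image image_UN ..
  finally have "flipped_snowflake n x A B
      = ?F ` lattice_polygon (hex_vertex n x ` {1..6})
        - ?F ` lattice_polygon {top_corner x, left_corner x, right_corner x} - ?F ` (\<Union>i\<in>{1..6}. ?H i)"
    unfolding flipped_snowflake_def hex cen lattice_polygon_flip by simp
  moreover have "inj ?F" using inj_flip[of x] by (simp add: inj_def inj_image_eq_iff)
  ultimately show ?thesis unfolding snowflake_def by (simp only: image_set_diff)
qed

lemma rp_divide: "rp a b / of_nat m = rp (a / m) (b / m)"
  by (simp add: rp_def add_divide_distrib)

lemma snowflake_center_rp: "snowflake_center n x = rp (x / 3) (x / 3)"
proof -
  have "(\<Sum>i=1..6. hex_vertex n x i) = rp (2 * x) (2 * x)"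
    unfolding one_to_six by (simp del: One_nat_def add: hex_vertex_rp rp_add)
  then show ?thesis unfolding snowflake_center_def using rp_divide[of "2 * x" "2 * x" 6] by simp
qed

lemma flipped_center_eq: "flipped_center n x = flip x (snowflake_center n x)"
proof -
  have "(\<Sum>i=1..6. flipped_vertex n x i) = (\<Sum>i=1..6. flip x (hex_vertex n x (next_sector i)))"
    using flipped_vertex_eq by (intro sum.cong) auto
  also have "\<dots> = (\<Sum>i\<in>next_sector ` {1..6}. flip x (hex_vertex n x i))"
    by (simp only: sum.reindex[OF inj_on_next_sector] comp_def)
  also have "\<dots> = 6 * rp x (- real x) + cis (pi / 3) * (\<Sum>i=1..6. hex_vertex n x i)"
    unfolding next_sector_image flip_def by (simp add: sum.distrib sum_distrib_left)
  finally show ?thesis unfolding flipped_center_def snowflake_center_def flip_def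
    by (simp add: field_simps)
qed

lemma rotation_flip: "rotation (flipped_center n x) (flip x z) = flip x (rotate_centre x z)"
  unfolding flipped_center_eq rotate_centre_def rotation_def snowflake_center_rp flip_def
  by (simp add: algebra_simps)

subsection \<open>Comparison of the two tiling counts\<close>

lemma quotient_eqI: "a * d = b * c \<Longrightarrow> 0 < b \<Longrightarrow> 0 < d \<Longrightarrow> a / b = c / d"
  for a b c d :: real
  by (simp add: field_simps)

context snowflake_cells
begin

abbreviation shifted :: "(nat \<Rightarrow> nat set) \<Rightarrow> nat \<Rightarrow> nat set" where
  "shifted F \<equiv> \<lambda>i. F (prev_sector i)"

lemma shifted_snowflake_cells: "snowflake_cells n (shifted A) (shifted B)"
  using A B AB sector_indices(2) by unfold_locales blast+

lemma num_tilings_snowflake: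
  "real (num_tilings (snowflake n x A B)) = (\<Sum>C\<in>Pow gates. \<Prod>i=1..6. sector_weight C i)"
proof -
  have "num_tilings (snowflake n x A B) = num_tilings ((\<lambda>p. id ` tri x p) ` (\<Union>i\<in>{1..6}. part i))"
    unfolding snowflake_eq by simp
  also have "\<dots> = card (tile_partitions (pair_tiles cell_adj) (\<Union>i\<in>{1..6}. part i))"
    by (rule num_tilings_image) (simp_all add: parts_subset_cells del: One_nat_def)
  finally show ?thesis by (simp only: card_tile_partitions_parts)
qed

definition shift_gates :: "(nat \<times> nat) set \<Rightarrow> (nat \<times> nat) set" where
  "shift_gates C = (\<lambda>(i, k). (next_sector i, k)) ` C"

lemma shift_gates_Image:
  assumes "C \<subseteq> gates" "i \<in> {1..6}"
  shows "shift_gates C `` {next_sector i} = C `` {i}"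
proof -
  have "j = i" if "(j, k) \<in> C" "next_sector j = next_sector i" for j k
    using that assms inj_onD[OF inj_on_next_sector, of j i] by (auto simp: gates_def)
  then show ?thesis by (auto simp: shift_gates_def image_iff)
qed

lemma shifted_gates_eq: "snowflake_cells.gates n (shifted A) (shifted B) = shift_gates gates"
proof -
  interpret S: snowflake_cells n x "shifted A" "shifted B" by (rule shifted_snowflake_cells)
  show ?thesis
  proof (intro equalityI subsetI)
    fix c assume "c \<in> S.gates"
    then obtain i k where c: "c = (i, k)" "i \<in> {1..6}" "k \<in> {1..n}" "k \<notin> A (prev_sector i)"
      "k \<notin> B (prev_sector (prev_sector i))" by (auto simp: S.gates_def)
    then have "(prev_sector i, k) \<in> gates" using sector_indices(2)[of i] by (simp add: gates_def)
    then have "(next_sector (prev_sector i), k) \<in> shift_gates gates" unfolding shift_gates_def by force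
    then show "c \<in> shift_gates gates" using c(1) sector_indices(5)[OF c(2)] by simp
  next
    fix c assume "c \<in> shift_gates gates"
    then obtain i k where "c = (next_sector i, k)" "i \<in> {1..6}" "k \<in> {1..n}" "k \<notin> A i" "k \<notin> B (prev_sector i)"
      by (auto simp: shift_gates_def gates_def)
    then show "c \<in> S.gates" using sector_indices(1,4)[of i] by (simp add: S.gates_def)
  qed
qed

text \<open>After undoing the index shift, gates and dent sets are those of the unflipped region;
  only the truncation has moved to the other three sectors.\<close>

lemma num_tilings_flipped:
  "real (num_tilings (flipped_snowflake n x A B)) = (\<Sum>C\<in>Pow gates. \<Prod>i=1..6.
     binom_minor n (trunc x (next_sector i)) (A i \<union> C `` {i}) (B i \<union> C `` {next_sector i}))"
proof -
  interpret S: snowflake_cells n x "shifted A" "shifted B" by (rule shifted_snowflake_cells)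
  let ?R = "\<Union>i\<in>{1..6}. S.part i"
  have "num_tilings (flipped_snowflake n x A B) = num_tilings ((\<lambda>p. flip x ` tri x p) ` ?R)"
    using flipped_snowflake_eq[OF A B, where x = x] S.snowflake_eq by (simp add: image_image)
  also have "\<dots> = card (tile_partitions (pair_tiles cell_adj) ?R)"
    by (rule num_tilings_image) (use inj_flip flip_unit_triangles S.parts_subset_cells in auto)
  finally have "real (num_tilings (flipped_snowflake n x A B)) = (\<Sum>C\<in>Pow S.gates. \<Prod>i=1..6. S.sector_weight C i)"
    by (simp only: S.card_tile_partitions_parts)
  also have "Pow S.gates = shift_gates ` Pow gates"
    unfolding shifted_gates_eq shift_gates_def by (rule image_Pow_surj[symmetric]) simp
  also have "(\<Sum>C\<in>shift_gates ` Pow gates. \<Prod>i=1..6. S.sector_weight C i)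
      = (\<Sum>C\<in>Pow gates. \<Prod>i=1..6. S.sector_weight (shift_gates C) i)"
  proof (subst sum.reindex)
    have "inj_on (\<lambda>(i, k). (next_sector i, k)) gates"
      using inj_on_next_sector by (auto simp: inj_on_def gates_def)
    then show "inj_on shift_gates (Pow gates)" unfolding shift_gates_def by (rule inj_on_image_Pow)
  qed simp
  also have "\<dots> = (\<Sum>C\<in>Pow gates. \<Prod>i=1..6.
     binom_minor n (trunc x (next_sector i)) (A i \<union> C `` {i}) (B i \<union> C `` {next_sector i}))"
  proof (rule sum.cong[OF refl])
    fix C assume "C \<in> Pow gates"
    then have C: "C \<subseteq> gates" by simp
    have "(\<Prod>i=1..6. S.sector_weight (shift_gates C) i) = (\<Prod>i\<in>next_sector ` {1..6}. S.sector_weight (shift_gates C) i)"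
      unfolding next_sector_image ..
    also have "\<dots> = (\<Prod>i=1..6. S.sector_weight (shift_gates C) (next_sector i))"
      by (simp only: prod.reindex[OF inj_on_next_sector] comp_def)
    also have "\<dots> = (\<Prod>i=1..6. binom_minor n (trunc x (next_sector i)) (A i \<union> C `` {i}) (B i \<union> C `` {next_sector i}))"
    proof (rule prod.cong[OF refl])
      fix i :: nat assume i: "i \<in> {1..6}"
      show "S.sector_weight (shift_gates C) (next_sector i)
          = binom_minor n (trunc x (next_sector i)) (A i \<union> C `` {i}) (B i \<union> C `` {next_sector i})"
        unfolding S.sector_weight_def sector_indices(4)[OF i] shift_gates_Image[OF C i]
          shift_gates_Image[OF C sector_indices(1)[OF i]] ..
    qed
    finally show "(\<Prod>i=1..6. S.sector_weight (shift_gates C) i)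
      = (\<Prod>i=1..6. binom_minor n (trunc x (next_sector i)) (A i \<union> C `` {i}) (B i \<union> C `` {next_sector i}))" .
  qed
  finally show ?thesis .
qed

definition poch :: "nat set \<Rightarrow> real" where
  "poch S = (\<Prod>a\<in>S. pochhammer (real a) x)"

lemma poch_pos: "S \<subseteq> {1..n} \<Longrightarrow> poch S > 0"
  unfolding poch_def by (intro prod_pos pochhammer_pos) auto

lemma binom_minor_poch:
  assumes "P \<subseteq> {1..n}" "Q \<subseteq> {1..n}"
  shows "binom_minor n x P Q = binom_minor n 0 P Q * (poch P * poch Q / poch {1..n})"
  using binom_minor_scale[OF assms, of x] poch_pos[of "{1..n}"]
  by (simp add: poch_def[symmetric] field_simps)

lemma poch_Un: "S \<subseteq> {1..n} \<Longrightarrow> T \<subseteq> {1..n} \<Longrightarrow> S \<inter> T = {} \<Longrightarrow> poch (S \<union> T) = poch S * poch T"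
  unfolding poch_def by (rule prod.union_disjoint) (auto intro: finite_subset)

text \<open>Written without division, so that it can be summed over \<open>C\<close>. The truncated
  sectors are 1, 3, 5 on the left and 2, 4, 6 on the right; three on each side, so the powers of
  \<open>poch {1..n}\<close> agree.\<close>

lemma flipped_term:
  assumes C: "C \<subseteq> gates"
  shows "(\<Prod>i=1..6. binom_minor n (trunc x (next_sector i)) (A i \<union> C `` {i}) (B i \<union> C `` {next_sector i}))
      * (poch (A 2) * poch (A 4) * poch (A 6) * poch (B 2) * poch (B 4) * poch (B 6))
    = (\<Prod>i=1..6. sector_weight C i)
      * (poch (A 1) * poch (A 3) * poch (A 5) * poch (B 1) * poch (B 3) * poch (B 5))"
proof -
  let ?b = "\<lambda>i. binom_minor n 0 (A i \<union> C `` {i}) (B i \<union> C `` {next_sector i})"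
  let ?c = "\<lambda>i. poch (C `` {i})"
  let ?w = "\<lambda>i. poch (A i) * poch (B i) * (?c i * ?c (next_sector i)) / poch {1..n}"
  have w: "binom_minor n x (A i \<union> C `` {i}) (B i \<union> C `` {next_sector i}) = ?b i * ?w i" if i: "i \<in> {1..6}" for i
  proof -
    have "C `` {i} \<subseteq> {1..n}" "A i \<inter> C `` {i} = {}" "C `` {next_sector i} \<subseteq> {1..n}"
      "B i \<inter> C `` {next_sector i} = {}"
      using C sector_indices(4)[OF i] by (auto simp: gates_def)
    then have "poch (A i \<union> C `` {i}) = poch (A i) * ?c i"
      "poch (B i \<union> C `` {next_sector i}) = poch (B i) * ?c (next_sector i)"
      using A[OF i] B[OF i] by (auto intro!: poch_Un)
    then show ?thesis unfolding binom_minor_poch[OF gates_Image[OF C i]] by (simp add: algebra_simps)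
  qed
  have tr: "trunc x 1 = 0" "trunc x 2 = x" "trunc x 3 = 0" "trunc x 4 = x" "trunc x 5 = 0" "trunc x 6 = x"
    by (simp_all add: trunc_def)
  have expand: "(\<Prod>i=1..6. f i) = f 1 * f 2 * f 3 * f 4 * f 5 * f (6::nat)" for f :: "nat \<Rightarrow> real"
    unfolding one_to_six by (simp add: mult.assoc)
  have w': "binom_minor n x (A 1 \<union> C `` {1}) (B 1 \<union> C `` {2}) = ?b 1 * ?w 1"
    "binom_minor n x (A 2 \<union> C `` {2}) (B 2 \<union> C `` {3}) = ?b 2 * ?w 2"
    "binom_minor n x (A 3 \<union> C `` {3}) (B 3 \<union> C `` {4}) = ?b 3 * ?w 3"
    "binom_minor n x (A 4 \<union> C `` {4}) (B 4 \<union> C `` {5}) = ?b 4 * ?w 4"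
    "binom_minor n x (A 5 \<union> C `` {5}) (B 5 \<union> C `` {6}) = ?b 5 * ?w 5"
    "binom_minor n x (A 6 \<union> C `` {6}) (B 6 \<union> C `` {1}) = ?b 6 * ?w 6"
    using w[of 1] w[of 2] w[of 3] w[of 4] w[of 5] w[of 6] by (simp_all only: next_sector_simps) simp_all
  show ?thesis
    unfolding expand sector_weight_def next_sector_simps tr w' by (simp add: field_simps)
qed

lemma odd_even_products:
  "(\<Prod>a\<in>#odd_union A. pochhammer (real a) x) * (\<Prod>b\<in>#odd_union B. pochhammer (real b) x)
    = poch (A 1) * poch (A 3) * poch (A 5) * poch (B 1) * poch (B 3) * poch (B 5)"
  "(\<Prod>a\<in>#even_union A. pochhammer (real a) x) * (\<Prod>b\<in>#even_union B. pochhammer (real b) x)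
    = poch (A 2) * poch (A 4) * poch (A 6) * poch (B 2) * poch (B 4) * poch (B 6)"
  by (simp_all add: odd_union_def even_union_def poch_def prod_unfold_prod_mset mult.assoc)

lemma finite_snowflake: "finite (snowflake n x A B)"
  unfolding snowflake_eq using finite_part by auto

theorem flipped_ratio:
  assumes "tilings (snowflake n x A B) \<noteq> {}"
  shows "real (num_tilings (flipped_snowflake n x A B)) / real (num_tilings (snowflake n x A B))
    = (poch (A 1) * poch (A 3) * poch (A 5) * poch (B 1) * poch (B 3) * poch (B 5))
      / (poch (A 2) * poch (A 4) * poch (A 6) * poch (B 2) * poch (B 4) * poch (B 6))" (is "_ = ?o / ?e")
proof -
  have "real (num_tilings (flipped_snowflake n x A B)) * ?e = real (num_tilings (snowflake n x A B)) * ?o"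
    unfolding num_tilings_flipped num_tilings_snowflake sum_distrib_right
    by (rule sum.cong[OF refl]) (simp only: Pow_iff flipped_term)
  moreover have "real (num_tilings (snowflake n x A B)) > 0"
    unfolding num_tilings_def tilings_eq_tile_partitions
    using assms finite_tile_partitions[OF finite_snowflake] by (simp add: card_gt_0_iff tilings_eq_tile_partitions)
  moreover have "?e > 0" by (intro mult_pos_pos poch_pos A B) auto
  ultimately show ?thesis by (rule quotient_eqI)
qed

end

context symmetric_snowflake_cells
begin

lemma shifted_symmetric: "symmetric_snowflake_cells n (shifted A) (shifted B)"
proof -
  interpret S: snowflake_cells n x "shifted A" "shifted B" by (rule shifted_snowflake_cells)
  show ?thesis
    by unfold_locales (simp_all only: sector_indices(12) A_turn[OF sector_indices(2)] B_turn[OF sector_indices(2)])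
qed

lemma turn_Union_parts: "turn ` (\<Union>i\<in>{1..6}. part i) = (\<Union>i\<in>{1..6}. part i)"
proof -
  have "turn ` (\<Union>i\<in>{1..6}. part i) = (\<Union>i\<in>turn_sector ` {1..6}. part i)"
    using turn_part by (simp add: image_UN)
  then show ?thesis unfolding image_\<tau> .
qed

lemma num_sym_tilings_snowflake:
  "real (num_sym_tilings (snowflake_center n x) (snowflake n x A B))
    = (\<Sum>C\<in>Pow ({1..n} - A 1 - B 2). \<Sum>D\<in>Pow ({1..n} - A 2 - B 1).
        binom_minor n 0 (A 1 \<union> C) (B 1 \<union> D) * binom_minor n x (A 2 \<union> D) (B 2 \<union> C))"
proof -
  have "num_sym_tilings (snowflake_center n x) (snowflake n x A B)
      = num_sym_tilings (snowflake_center n x) ((\<lambda>p. id ` tri x p) ` (\<Union>i\<in>{1..6}. part i))"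
    unfolding snowflake_eq by simp
  also have "\<dots> = card {T \<in> tile_partitions (pair_tiles cell_adj) (\<Union>i\<in>{1..6}. part i). (`) turn ` T = T}"
    by (rule num_sym_tilings_image)
       (simp_all add: parts_subset_cells turn_Union_parts rotate_centre_def snowflake_center_rp del: One_nat_def)
  finally show ?thesis by (simp only: card_sym_tile_partitions_parts)
qed

lemma num_sym_tilings_flipped:
  "real (num_sym_tilings (flipped_center n x) (flipped_snowflake n x A B))
    = (\<Sum>C\<in>Pow ({1..n} - A 1 - B 2). \<Sum>D\<in>Pow ({1..n} - A 2 - B 1).
        binom_minor n x (A 1 \<union> C) (B 1 \<union> D) * binom_minor n 0 (A 2 \<union> D) (B 2 \<union> C))"
proof -
  interpret S: symmetric_snowflake_cells n x "shifted A" "shifted B" by (rule shifted_symmetric)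
  let ?R = "\<Union>i\<in>{1..6}. S.part i"
  have "num_sym_tilings (flipped_center n x) (flipped_snowflake n x A B)
      = num_sym_tilings (flipped_center n x) ((\<lambda>p. flip x ` tri x p) ` ?R)"
    using flipped_snowflake_eq[OF A B, where x = x] S.snowflake_eq by (simp add: image_image)
  also have "\<dots> = card {T \<in> tile_partitions (pair_tiles cell_adj) ?R. (`) turn ` T = T}"
    by (rule num_sym_tilings_image)
       (use inj_flip flip_unit_triangles S.parts_subset_cells S.turn_Union_parts rotation_flip in auto)
  finally have "real (num_sym_tilings (flipped_center n x) (flipped_snowflake n x A B))
    = (\<Sum>C\<in>Pow ({1..n} - A 2 - B 1). \<Sum>D\<in>Pow ({1..n} - A 1 - B 2).
        binom_minor n 0 (A 2 \<union> C) (B 2 \<union> D) * binom_minor n x (A 1 \<union> D) (B 1 \<union> C))"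
    by (simp only: S.card_sym_tile_partitions_parts prev_sector_simps AB_cyclic)
  \<comment> \<open>The index shift interchanges odd and even sectors, and with them the two
    summation variables.\<close>
  then show ?thesis
    by (subst sum.swap) (simp only: mult.commute)
qed

text \<open>Each of \<open>C\<close> and \<open>D\<close> is a dent set of both determinants, so its
  Pochhammer factor appears on both sides, whichever of the two is truncated.\<close>

lemma flipped_sym_term:
  assumes "C \<subseteq> {1..n} - A 1 - B 2" "D \<subseteq> {1..n} - A 2 - B 1"
  shows "binom_minor n x (A 1 \<union> C) (B 1 \<union> D) * binom_minor n 0 (A 2 \<union> D) (B 2 \<union> C) * (poch (A 2) * poch (B 2))
    = binom_minor n 0 (A 1 \<union> C) (B 1 \<union> D) * binom_minor n x (A 2 \<union> D) (B 2 \<union> C) * (poch (A 1) * poch (B 1))"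
proof -
  have sub: "A 1 \<subseteq> {1..n}" "A 2 \<subseteq> {1..n}" "B 1 \<subseteq> {1..n}" "B 2 \<subseteq> {1..n}" "C \<subseteq> {1..n}" "D \<subseteq> {1..n}"
    using A[of 1] A[of 2] B[of 1] B[of 2] assms by auto
  have un: "poch (A 1 \<union> C) = poch (A 1) * poch C" "poch (B 1 \<union> D) = poch (B 1) * poch D"
    "poch (A 2 \<union> D) = poch (A 2) * poch D" "poch (B 2 \<union> C) = poch (B 2) * poch C"
    by (rule poch_Un; use sub assms in blast)+
  have "binom_minor n x (A 1 \<union> C) (B 1 \<union> D)
      = binom_minor n 0 (A 1 \<union> C) (B 1 \<union> D) * (poch (A 1 \<union> C) * poch (B 1 \<union> D) / poch {1..n})"
    "binom_minor n x (A 2 \<union> D) (B 2 \<union> C)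
      = binom_minor n 0 (A 2 \<union> D) (B 2 \<union> C) * (poch (A 2 \<union> D) * poch (B 2 \<union> C) / poch {1..n})"
    by (rule binom_minor_poch; use sub in blast)+
  then show ?thesis unfolding un by (simp add: field_simps)
qed

theorem flipped_sym_ratio:
  assumes "sym_tilings (snowflake_center n x) (snowflake n x A B) \<noteq> {}"
  shows "real (num_sym_tilings (flipped_center n x) (flipped_snowflake n x A B))
      / real (num_sym_tilings (snowflake_center n x) (snowflake n x A B))
    = (poch (A 1) * poch (B 1)) / (poch (A 2) * poch (B 2))" (is "_ = ?o / ?e")
proof -
  have "real (num_sym_tilings (flipped_center n x) (flipped_snowflake n x A B)) * ?e
      = real (num_sym_tilings (snowflake_center n x) (snowflake n x A B)) * ?o"
    unfolding num_sym_tilings_flipped num_sym_tilings_snowflake sum_distrib_right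
    by (intro sum.cong refl flipped_sym_term) auto
  moreover have "real (num_sym_tilings (snowflake_center n x) (snowflake n x A B)) > 0"
  proof -
    have "finite (sym_tilings (snowflake_center n x) (snowflake n x A B))"
      unfolding sym_tilings_def tilings_eq_tile_partitions
      using finite_tile_partitions[OF finite_snowflake] by simp
    then show ?thesis using assms by (simp add: num_sym_tilings_def card_gt_0_iff)
  qed
  moreover have "?e > 0" by (intro mult_pos_pos poch_pos A B) auto
  ultimately show ?thesis by (rule quotient_eqI)
qed

text \<open>With equal hole sets in the three odd and in the three even sectors, the ratio of all
  tilings is the cube of the symmetric one.\<close>

theorem flipped_sym_ratio_root:
  assumes "tilings (snowflake n x A B) \<noteq> {}"
  shows "(poch (A 1) * poch (B 1)) / (poch (A 2) * poch (B 2))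
    = root 3 (real (num_tilings (flipped_snowflake n x A B)) / real (num_tilings (snowflake n x A B)))"
    (is "?q = _")
proof -
  have "real (num_tilings (flipped_snowflake n x A B)) / real (num_tilings (snowflake n x A B)) = ?q ^ 3"
    unfolding flipped_ratio[OF assms] AB_cyclic by (simp add: power3_eq_cube mult_ac)
  moreover have "0 \<le> ?q"
    by (intro divide_nonneg_nonneg mult_nonneg_nonneg less_imp_le[OF poch_pos] A B) auto
  ultimately show ?thesis by (simp add: real_root_power_cancel)
qed

end

theorem theorem2p1:
  fixes n x :: nat and A B :: "nat \<Rightarrow> nat set"
  assumes "\<forall>i\<in>{1..6}. A i \<subseteq> {1..n}"
    and "\<forall>i\<in>{1..6}. B i \<subseteq> {1..n}"
    and "\<forall>i\<in>{1..6}. 1 \<notin> A i \<inter> B i"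
  shows
    "(tilings (snowflake n x A B) \<noteq> {} \<longrightarrow>
        real (num_tilings (flipped_snowflake n x A B)) / real (num_tilings (snowflake n x A B))
        = ((\<Prod>a\<in>#odd_union A. pochhammer (real a) x) * (\<Prod>b\<in>#odd_union B. pochhammer (real b) x))
          / ((\<Prod>a\<in>#even_union A. pochhammer (real a) x) * (\<Prod>b\<in>#even_union B. pochhammer (real b) x)))
     \<and>
     (rotate_region (snowflake_center n x) (snowflake n x A B) = snowflake n x A B \<and>
      A 1 = A 3 \<and> A 3 = A 5 \<and> A 2 = A 4 \<and> A 4 = A 6 \<and>
      B 1 = B 3 \<and> B 3 = B 5 \<and> B 2 = B 4 \<and> B 4 = B 6 \<and>
      sym_tilings (snowflake_center n x) (snowflake n x A B) \<noteq> {} \<longrightarrow>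
        real (num_sym_tilings (flipped_center n x) (flipped_snowflake n x A B))
          / real (num_sym_tilings (snowflake_center n x) (snowflake n x A B))
        = ((\<Prod>a\<in>A 1. pochhammer (real a) x) * (\<Prod>b\<in>B 1. pochhammer (real b) x))
          / ((\<Prod>a\<in>A 2. pochhammer (real a) x) * (\<Prod>b\<in>B 2. pochhammer (real b) x))
        \<and>
        ((\<Prod>a\<in>A 1. pochhammer (real a) x) * (\<Prod>b\<in>B 1. pochhammer (real b) x))
          / ((\<Prod>a\<in>A 2. pochhammer (real a) x) * (\<Prod>b\<in>B 2. pochhammer (real b) x))
        = root 3 (real (num_tilings (flipped_snowflake n x A B))
                  / real (num_tilings (snowflake n x A B))))"
proof -
  interpret S: snowflake_cells n x A B
    using assms by unfold_locales auto
  have products: "(\<Prod>a\<in>F. pochhammer (real a) x) = S.poch F" for F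
    by (simp add: S.poch_def)
  have cyclic: "F (turn_sector i) = F i"
    if "F 1 = F 3" "F 3 = F 5" "F 2 = F 4" "F 4 = F 6" "i \<in> {1..6}" for F :: "nat \<Rightarrow> nat set" and i
    using that(5) by (cases rule: sector_cases) (simp_all only: turn_sector_def next_sector_simps that(1-4))
  have symmetric: "symmetric_snowflake_cells n A B"
    if "A 1 = A 3" "A 3 = A 5" "A 2 = A 4" "A 4 = A 6" "B 1 = B 3" "B 3 = B 5" "B 2 = B 4" "B 4 = B 6"
    using cyclic[OF that(1-4)] cyclic[OF that(5-8)] by unfold_locales
  show ?thesis
  proof ((intro conjI impI; (elim conjE)?), goal_cases)
    case 1
    then show ?case unfolding S.odd_even_products by (rule S.flipped_ratio)
  next
    case 2
    interpret T: symmetric_snowflake_cells n x A B using 2(2-9) by (rule symmetric)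
    show ?case unfolding products using 2(10) by (rule T.flipped_sym_ratio)
  next
    case 3
    interpret T: symmetric_snowflake_cells n x A B using 3(2-9) by (rule symmetric)
    \<comment> \<open>A symmetric tiling is in particular a tiling, which is what the ratio of all
      tilings requires.\<close>
    have "tilings (snowflake n x A B) \<noteq> {}" using 3(10) by (auto simp: sym_tilings_def)
    then show ?case unfolding products by (rule T.flipped_sym_ratio_root)
  qed
qed

end
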